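(* Let $X$ and $Y$ be infinite Tychonoff spaces. Then: (1) The dual $C_k(X\times Y)^*$ of $C_k(X\times Y)$ admits a weak$^*$-basic sequence. (2) The bidual $C_k(X)^{**}$ of $C_k(X)$ admits a weak$^*$-basic sequence. (3) If $C_k(X)$ is barrelled, then the dual $C_k(X)^*$ admits a weak$^*$-basic sequence. (4) If $X$ contains an infinite discrete subset which is $C^*$-embedded in $X$, then the dual $C_k(X)^*$ admits a weak$^*$-basic sequence. (5) Suppose that $X$ and $Y$ are compact. For each $n\in\mathbb{N}$ let $K_n\subset X$ and $L_n\subset Y$ be finite sets with $|K_n|=2^n$ and $|L_n|=n$, let $\varphi_n:K_n\to\{-1,1\}^{L_n}$ be a bijection, and let $$\mu_n:=\frac{1}{n2^n}\sum_{(s,j)\in K_n\times L_n}\varphi_n(s)(j)\,\delta_{(s,j)},$$ a finitely supported signed measure on $X\times Y$, regarded as an element of the dual $C(X\times Y)^*$ of the Banach space $C(X\times Y)$. Then every subsequence $(\mu_{k_n})$ of $(\mu_n)$ contains a subsequence that is strongly normal and is a weak$^*$-basic sequence in $C(X\times Y)^*$.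
   Context: All vector spaces are real. For a Tychonoff space $Z$, $C_k(Z)$ is the space of all continuous real-valued functions on $Z$ with the compact-open topology; for compact $Z$, $C(Z)$ is the Banach space of continuous real-valued functions with the supremum norm. $\delta_z$ denotes the Dirac measure at $z$. For a locally convex space $E$, $E^*$ is its topological dual, the weak$^*$ topology on $E^*$ is $\sigma(E^*,E)$, and $E^*_b$ is $E^*$ with the strong topology $\beta(E^*,E)$. The bidual is $E^{**}=(E^*_b)^*$, with weak$^*$ topology $\sigma(E^{**},E^* )$. A sequence $(e_n)_{n\in\mathbb{N}}$ in a locally convex space $F$ is a Schauder basis of $F$ if every $x\in F$ has a unique representation $x=\sum_{n=1}^\infty b_ne_n$ (convergence in the topology of $F$) and all coefficient functionals $x\mapsto b_n$ are continuous on $F$. A sequence is basic if it is a Schauder basis of its closed linear span. A weak$^*$-basic sequence in $E^*$ (respectively $E^{**}$) is a basic sequence in $E^*$ (respectively $E^{**}$) endowed with the weak$^*$ topology. A subset $D$ of $X$ is $C^*$-embedded in $X$ if every bounded continuous real-valued function on $D$ extends to a bounded continuous real-valued function on $X$. A sequence $(y_n^* )$ in the dual $E^*$ of a Banach space $E$ is strongly normal if $\|y_n^*\|=1$ for all $n\in\mathbb{N}$ and the set $\{x\in E:\sum_n|y_n^*(x)|<\infty\}$ is dense in $E$. *)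

theory Defs
  imports "HOL-Analysis.Analysis" "HOL-Library.Function_Algebras"
begin

instantiation "fun" :: (type, real_vector) real_vector
begin

definition scaleR_fun :: "real \<Rightarrow> ('a \<Rightarrow> 'b) \<Rightarrow> 'a \<Rightarrow> 'b"
  where "scaleR_fun c f = (\<lambda>x. c *\<^sub>R f x)"

instance
  by standard (simp_all add: scaleR_fun_def plus_fun_def algebra_simps)

end

text \<open>A locally convex space is represented by a topology on a vector space type whose
  \<^const>\<open>topspace\<close> (a linear subspace of the type) is the underlying vector space. Spaces of
  functions with domain \<open>D\<close> consist of total functions that vanish outside \<open>D\<close>, so that they are
  linear subspaces of a function type.\<close>

definition dual :: "'v::real_vector topology \<Rightarrow> ('v \<Rightarrow> real) set" where
  "dual E = {\<phi>. continuous_map E euclideanreal \<phi> \<and>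
     (\<forall>x\<in>topspace E. \<forall>y\<in>topspace E. \<phi> (x + y) = \<phi> x + \<phi> y) \<and>
     (\<forall>c. \<forall>x\<in>topspace E. \<phi> (c *\<^sub>R x) = c * \<phi> x) \<and>
     (\<forall>x. x \<notin> topspace E \<longrightarrow> \<phi> x = 0)}"

definition weak_star :: "'v::real_vector topology \<Rightarrow> ('v \<Rightarrow> real) topology" where
  "weak_star E = topology_generated_by
     {{\<phi> \<in> dual E. \<phi> x \<in> U} | x U. x \<in> topspace E \<and> open U}"

definition tvs_bounded :: "'v::real_vector topology \<Rightarrow> 'v set \<Rightarrow> bool" where
  "tvs_bounded E B \<longleftrightarrow> B \<subseteq> topspace E \<and>
     (\<forall>U. openin E U \<and> 0 \<in> U \<longrightarrow> (\<exists>r>0. \<forall>s\<ge>r. B \<subseteq> (\<lambda>x. s *\<^sub>R x) ` U))"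

text \<open>The topology of uniform convergence on bounded sets, given by its neighbourhood bases.\<close>

definition strong_dual :: "'v::real_vector topology \<Rightarrow> ('v \<Rightarrow> real) topology" where
  "strong_dual E = topology (\<lambda>W. W \<subseteq> dual E \<and>
     (\<forall>\<phi>\<in>W. \<exists>B e. tvs_bounded E B \<and> e > 0 \<and>
        {\<psi> \<in> dual E. \<forall>x\<in>B. \<bar>\<psi> x - \<phi> x\<bar> < e} \<subseteq> W))"

abbreviation weak_star_bidual :: "'v::real_vector topology \<Rightarrow> (('v \<Rightarrow> real) \<Rightarrow> real) topology" where
  "weak_star_bidual E \<equiv> weak_star (strong_dual E)"

definition barrel :: "'v::real_vector topology \<Rightarrow> 'v set \<Rightarrow> bool" where
  "barrel E B \<longleftrightarrow> closedin E B \<and> convex B \<and>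
     (\<forall>c. \<forall>x\<in>B. \<bar>c\<bar> \<le> 1 \<longrightarrow> c *\<^sub>R x \<in> B) \<and>
     (\<forall>x\<in>topspace E. \<exists>r>0. \<forall>c. \<bar>c\<bar> \<le> r \<longrightarrow> c *\<^sub>R x \<in> B)"

definition barrelled :: "'v::real_vector topology \<Rightarrow> bool" where
  "barrelled E \<longleftrightarrow> (\<forall>B. barrel E B \<longrightarrow> (\<exists>U. openin E U \<and> 0 \<in> U \<and> U \<subseteq> B))"

definition expansion :: "'v::real_vector topology \<Rightarrow> (nat \<Rightarrow> 'v) \<Rightarrow> 'v \<Rightarrow> (nat \<Rightarrow> real) \<Rightarrow> bool" where
  "expansion F e x b \<longleftrightarrow> limitin F (\<lambda>N. \<Sum>n<N. b n *\<^sub>R e n) x sequentially"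

definition schauder_basis :: "'v::real_vector topology \<Rightarrow> (nat \<Rightarrow> 'v) \<Rightarrow> bool" where
  "schauder_basis F e \<longleftrightarrow> range e \<subseteq> topspace F \<and>
     (\<forall>x\<in>topspace F. \<exists>!b. expansion F e x b) \<and>
     (\<forall>n. continuous_map F euclideanreal (\<lambda>x. (THE b. expansion F e x b) n))"

definition basic_sequence :: "'v::real_vector topology \<Rightarrow> (nat \<Rightarrow> 'v) \<Rightarrow> bool" where
  "basic_sequence F e \<longleftrightarrow> range e \<subseteq> topspace F \<and>
     schauder_basis (subtopology F (F closure_of span (range e))) e"

definition tychonoff_space :: "'a topology \<Rightarrow> bool" where
  "tychonoff_space X \<longleftrightarrow> completely_regular_space X \<and> Hausdorff_space X"

definition cfun :: "'a topology \<Rightarrow> ('a \<Rightarrow> real) set" where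
  "cfun X = {f. continuous_map X euclideanreal f \<and> (\<forall>x. x \<notin> topspace X \<longrightarrow> f x = 0)}"

definition Ck :: "'a topology \<Rightarrow> ('a \<Rightarrow> real) topology" where
  "Ck X = topology_generated_by
     {{f \<in> cfun X. f ` K \<subseteq> U} | K U. compactin X K \<and> open U}"

definition C_star_embedded :: "'a topology \<Rightarrow> 'a set \<Rightarrow> bool" where
  "C_star_embedded X D \<longleftrightarrow> D \<subseteq> topspace X \<and>
     (\<forall>f. continuous_map (subtopology X D) euclideanreal f \<and> bounded (f ` D) \<longrightarrow>
        (\<exists>g. continuous_map X euclideanreal g \<and> bounded (g ` topspace X) \<and> (\<forall>x\<in>D. g x = f x)))"

text \<open>A normed space is a linear subspace \<open>E\<close> of a vector space type with a norm \<open>N\<close> on \<open>E\<close>.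
  The case distinction is needed because \<^locale>\<open>Metric_space\<close> requires nonnegativity and
  symmetry of the distance also outside the carrier.\<close>

definition norm_topology :: "'v::real_vector set \<Rightarrow> ('v \<Rightarrow> real) \<Rightarrow> 'v topology" where
  "norm_topology E N =
    Metric_space.mtopology E (\<lambda>x y. if x \<in> E \<and> y \<in> E then N (x - y) else 0)"

definition dual_norm :: "'v::real_vector set \<Rightarrow> ('v \<Rightarrow> real) \<Rightarrow> ('v \<Rightarrow> real) \<Rightarrow> real" where
  "dual_norm E N \<phi> = (SUP x\<in>{x \<in> E. N x \<le> 1}. \<bar>\<phi> x\<bar>)"

definition strongly_normal ::
    "'v::real_vector set \<Rightarrow> ('v \<Rightarrow> real) \<Rightarrow> (nat \<Rightarrow> 'v \<Rightarrow> real) \<Rightarrow> bool" where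
  "strongly_normal E N y \<longleftrightarrow> range y \<subseteq> dual (norm_topology E N) \<and>
     (\<forall>n. dual_norm E N (y n) = 1) \<and>
     norm_topology E N closure_of {x \<in> E. summable (\<lambda>n. \<bar>y n x\<bar>)} = E"

text \<open>Only meaningful for compact nonempty \<open>Z\<close>.\<close>

definition sup_norm :: "'a topology \<Rightarrow> ('a \<Rightarrow> real) \<Rightarrow> real" where
  "sup_norm Z f = (SUP z\<in>topspace Z. \<bar>f z\<bar>)"

abbreviation C_Banach :: "'a topology \<Rightarrow> ('a \<Rightarrow> real) topology" where
  "C_Banach Z \<equiv> norm_topology (cfun Z) (sup_norm Z)"

text \<open>The Dirac measure at \<open>z\<close> acting on continuous functions by integration.\<close>

definition dirac :: "'a topology \<Rightarrow> 'a \<Rightarrow> ('a \<Rightarrow> real) \<Rightarrow> real" where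
  "dirac Z z = (\<lambda>f. if f \<in> cfun Z then f z else 0)"

lemma tvs_bounded_Un:
  assumes "tvs_bounded E A" "tvs_bounded E B"
  shows "tvs_bounded E (A \<union> B)"
  unfolding tvs_bounded_def
proof (intro conjI allI impI)
  show "A \<union> B \<subseteq> topspace E" using assms by (auto simp: tvs_bounded_def)
  fix U assume U: "openin E U \<and> 0 \<in> U"
  obtain r where r: "r > 0" "\<And>s. s \<ge> r \<Longrightarrow> A \<subseteq> (\<lambda>x. s *\<^sub>R x) ` U"
    using assms(1) U unfolding tvs_bounded_def by meson
  obtain q where q: "q > 0" "\<And>s. s \<ge> q \<Longrightarrow> B \<subseteq> (\<lambda>x. s *\<^sub>R x) ` U"
    using assms(2) U unfolding tvs_bounded_def by meson
  show "\<exists>r>0. \<forall>s\<ge>r. A \<union> B \<subseteq> (\<lambda>x. s *\<^sub>R x) ` U"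
    by (rule exI[of _ "max r q"]) (use r q in simp)
qed

lemma openin_strong_dual:
  "openin (strong_dual E) W \<longleftrightarrow> W \<subseteq> dual E \<and>
     (\<forall>\<phi>\<in>W. \<exists>B e. tvs_bounded E B \<and> e > 0 \<and>
        {\<psi> \<in> dual E. \<forall>x\<in>B. \<bar>\<psi> x - \<phi> x\<bar> < e} \<subseteq> W)"
proof -
  let ?N = "\<lambda>\<phi> B e. {\<psi> \<in> dual E. \<forall>x\<in>B. \<bar>\<psi> x - \<phi> x\<bar> < e}"
  let ?P = "\<lambda>W. W \<subseteq> dual E \<and> (\<forall>\<phi>\<in>W. \<exists>B e. tvs_bounded E B \<and> e > (0::real) \<and> ?N \<phi> B e \<subseteq> W)"
  have "istopology ?P"
    unfolding istopology_def
  proof (rule conjI)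
    show "\<forall>S T. ?P S \<longrightarrow> ?P T \<longrightarrow> ?P (S \<inter> T)"
    proof (intro allI impI)
      fix S T assume S: "?P S" and T: "?P T"
      have "\<exists>B e. tvs_bounded E B \<and> e > 0 \<and> ?N \<phi> B e \<subseteq> S \<inter> T" if \<phi>: "\<phi> \<in> S \<inter> T" for \<phi>
      proof -
        obtain A d where A: "tvs_bounded E A" "d > 0" "?N \<phi> A d \<subseteq> S" using S \<phi> by blast
        obtain B e where B: "tvs_bounded E B" "e > 0" "?N \<phi> B e \<subseteq> T" using T \<phi> by blast
        have "?N \<phi> (A \<union> B) (min d e) \<subseteq> ?N \<phi> A d \<inter> ?N \<phi> B e" by auto
        then have "?N \<phi> (A \<union> B) (min d e) \<subseteq> S \<inter> T" using A(3) B(3) by blast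
        moreover have "min d e > 0" using A B by simp
        ultimately show ?thesis using tvs_bounded_Un[OF A(1) B(1)] by blast
      qed
      then show "?P (S \<inter> T)" using S by blast
    qed
    show "\<forall>\<K>. (\<forall>K\<in>\<K>. ?P K) \<longrightarrow> ?P (\<Union>\<K>)"
    proof (intro allI impI conjI ballI)
      fix \<K> assume K: "\<forall>K\<in>\<K>. ?P K"
      then show "\<Union>\<K> \<subseteq> dual E" by blast
      fix \<phi> assume "\<phi> \<in> \<Union>\<K>"
      then obtain M where M: "M \<in> \<K>" "\<phi> \<in> M" by blast
      then obtain B e where "tvs_bounded E B" "e > 0" "?N \<phi> B e \<subseteq> M" using K by meson
      then show "\<exists>B e. tvs_bounded E B \<and> e > 0 \<and> ?N \<phi> B e \<subseteq> \<Union>\<K>" using M by blast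
    qed
  qed
  then show ?thesis by (simp add: strong_dual_def topology_inverse')
qed

lemma topspace_strong_dual [simp]: "topspace (strong_dual E) = dual E"
proof
  show "topspace (strong_dual E) \<subseteq> dual E"
    using openin_strong_dual openin_topspace by metis
  have "tvs_bounded E {}" by (auto simp: tvs_bounded_def intro: exI[of _ 1])
  then have "openin (strong_dual E) (dual E)"
    unfolding openin_strong_dual by (auto intro: exI[of _ "{}"] exI[of _ 1])
  then show "dual E \<subseteq> topspace (strong_dual E)" by (rule openin_subset)
qed

lemma topspace_Ck [simp]: "topspace (Ck X) = cfun X"
proof -
  let ?S = "{{f \<in> cfun X. f ` K \<subseteq> U} | K U. compactin X K \<and> open (U::real set)}"
  have "cfun X \<in> ?S"
    by (rule CollectI, intro exI[of _ "{}"] exI[of _ UNIV]) simp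
  moreover have "A \<subseteq> cfun X" if "A \<in> ?S" for A
    using that by (elim CollectE exE conjE) simp
  ultimately have "\<Union>?S = cfun X"
    by (intro equalityI Union_upper Union_least)
  then show ?thesis
    by (simp only: Ck_def topology_generated_by_topspace)
qed

lemma topspace_weak_star [simp]:
  assumes "topspace E \<noteq> {}"
  shows "topspace (weak_star E) = dual E"
proof -
  let ?S = "{{\<phi> \<in> dual E. \<phi> x \<in> U} | x U. x \<in> topspace E \<and> open U}"
  obtain x where "x \<in> topspace E" using assms by blast
  then have "dual E \<in> ?S"
    by (intro CollectI exI[of _ x] exI[of _ UNIV]) simp
  moreover have "A \<subseteq> dual E" if "A \<in> ?S" for A
    using that by (elim CollectE exE conjE) simp
  ultimately have "\<Union>?S = dual E"
    by (intro equalityI Union_upper Union_least)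
  then show ?thesis
    by (simp only: weak_star_def topology_generated_by_topspace)
qed

lemma subspace_cfun: "subspace (cfun X)"
  by (auto simp: subspace_def cfun_def scaleR_fun_def plus_fun_def zero_fun_def
      intro!: continuous_intros)

lemma Metric_space_sup_norm:
  assumes "compact_space Z" "topspace Z \<noteq> {}"
  shows "Metric_space (cfun Z)
    (\<lambda>f g. if f \<in> cfun Z \<and> g \<in> cfun Z then sup_norm Z (f - g) else 0)"
proof -
  have bdd: "bdd_above ((\<lambda>z. \<bar>(f - g) z\<bar>) ` topspace Z)" if "f \<in> cfun Z" "g \<in> cfun Z" for f g
  proof -
    have "continuous_map Z euclideanreal (\<lambda>z. \<bar>(f - g) z\<bar>)"
      using that by (auto simp: cfun_def fun_diff_def intro!: continuous_intros)
    then have "compactin euclideanreal ((\<lambda>z. \<bar>(f - g) z\<bar>) ` topspace Z)"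
      using assms(1) image_compactin unfolding compact_space_def by blast
    then show ?thesis
      by (intro bounded_imp_bdd_above compact_imp_bounded) simp
  qed
  have ge: "\<bar>f z - g z\<bar> \<le> sup_norm Z (f - g)"
    if "f \<in> cfun Z" "g \<in> cfun Z" "z \<in> topspace Z" for f g z
    using cSUP_upper[OF that(3) bdd[OF that(1,2)]] by (simp add: sup_norm_def)
  have comm: "sup_norm Z (f - g) = sup_norm Z (g - f)" for f g
    by (simp add: sup_norm_def abs_minus_commute)
  have nonneg: "0 \<le> sup_norm Z (f - g)" if "f \<in> cfun Z" "g \<in> cfun Z" for f g
    using ge[OF that] assms(2) by fastforce
  have zero: "sup_norm Z (f - g) = 0 \<longleftrightarrow> f = g" if f: "f \<in> cfun Z" and g: "g \<in> cfun Z" for f g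
  proof
    assume "sup_norm Z (f - g) = 0"
    then have "f z = g z" for z
      using ge[OF f g, of z] f g by (cases "z \<in> topspace Z") (auto simp: cfun_def)
    then show "f = g" by blast
  qed (use assms(2) in \<open>simp add: sup_norm_def\<close>)
  have tri: "sup_norm Z (f - h) \<le> sup_norm Z (f - g) + sup_norm Z (g - h)"
    if f: "f \<in> cfun Z" and g: "g \<in> cfun Z" and h: "h \<in> cfun Z" for f g h
    unfolding sup_norm_def[of Z "f - h"]
  proof (rule cSUP_least)
    fix z assume z: "z \<in> topspace Z"
    show "\<bar>(f - h) z\<bar> \<le> sup_norm Z (f - g) + sup_norm Z (g - h)"
      using ge[OF f g z] ge[OF g h z] by simp
  qed (use assms in blast)
  show ?thesis
    by (rule Metric_space.intro) (simp_all add: nonneg comm zero tri)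
qed

end

theory Submission
  imports Defs
begin

text \<open>Let \<open>y n\<close> be continuous functionals on a locally convex space \<open>E\<close> and \<open>e n\<close> vectors biorthogonal to them.
Every member \<open>\<mu>\<close> of the weak-star closed span of the \<open>y n\<close> vanishes on their common kernel. So the
sequence is weak-star basic as soon as \<open>\<Sum>n. \<mu> (e n) * y n f\<close> converges to \<open>\<mu> f\<close> for all \<open>f\<close> and all \<open>\<mu>\<close>
that vanish on the common kernel: the coefficients \<open>\<mu> (e n)\<close> are weak-star continuous and
determined by \<open>\<mu>\<close>. This is \<open>weak_star_basic_sequence\<close>, from which all basic sequences below are obtained.

On a space \<open>C_k(Z)\<close> the convergence is obtained from an open map onto a sequence space. If
\<open>f \<mapsto> (y n f)\<close> takes values in the null sequences or in the square-summable sequences, and each such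
sequence \<open>b\<close> is the image of a function bounded by a multiple of the norm of \<open>b\<close>, then the error
\<open>\<mu> f - (\<Sum>n<N. \<mu> (e n) * y n f)\<close> is the value of \<open>\<mu>\<close> at a function lifting the tail of \<open>(y n f)\<close>, and it
tends to zero (\<open>basic_sequence_of_quotient\<close>). By iteration it is enough to lift each \<open>b\<close> up to an
error of half its norm. There are two sources of such maps.

\<^item> Finitely supported measures of norm one that tend weak-star to zero and whose mass escapes
  from each finite set. A subsequence is almost disjointly supported and gives a map onto the null
  sequences (\<open>point_functionals_subsequence\<close>).
\<^item> Functions \<open>r n\<close> with values in \<open>[-1, 1]\<close> that take all patterns of values \<open>1\<close> and \<open>-1\<close> on a compact
  set. A limit of uniform averages over such patterns is a positive functional under which the \<open>r n\<close>
  behave like independent random signs, and \<open>f \<mapsto> (\<Lambda> (f * r n))\<close> maps onto the square-summable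
  sequences (\<open>rademacher_basic_sequence\<close>).

If \<open>Z\<close> has an infinite compact subset, consider its derived set. An isolated point of the derived
set is the limit of a sequence of distinct points, which is the first situation; if the derived set
has no isolated point, it carries functions as in the second one
(\<open>infinite_compact_basic_sequence\<close>). If every compact set is finite, functionals are
finitely supported, and an infinite discrete C*-embedded subset carries functionals whose
closed span contains nothing but their linear combinations. A continuous unbounded function
yields such a subset. If there is none and all compact sets are finite, the
functions bounded by one form a barrel that is no neighbourhood of zero. This settles the claims on
C*-embedded subsets and on barrelled spaces.

For a product on which all continuous functions are bounded, the slices \<open>f (x, _)\<close> of a
continuous function form a totally bounded family (\<open>product_slices_totally_bounded\<close>, a form of
Glicksberg's theorem). Averaging over all signs then shows by the second moment that the sign
measures of the last claim tend weak-star to zero, which is the first situation again. The remaining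
products have a continuous unbounded function. Compact products are of the former kind, and there the
lifting of null sequences also gives the density required for strong normality.

For the bidual, disjointly supported functions \<open>h n\<close> with \<open>h n (x n) = 1\<close> act on the dual as coordinates
biorthogonal to the point masses at \<open>x n\<close>, and \<open>\<Sum>n. \<phi> (h n) * \<delta>(x n)\<close> converges in the strong
topology when the \<open>x n\<close> lie in a compact set, or is a finite sum when all compact sets are finite.\<close>

section \<open>Biorthogonal systems and weak-star basic sequences\<close>

lemma dual_add: "\<phi> \<in> dual E \<Longrightarrow> x \<in> topspace E \<Longrightarrow> y \<in> topspace E \<Longrightarrow> \<phi> (x + y) = \<phi> x + \<phi> y"
  and dual_scale: "\<phi> \<in> dual E \<Longrightarrow> x \<in> topspace E \<Longrightarrow> \<phi> (c *\<^sub>R x) = c * \<phi> x"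
  by (auto simp: dual_def)

lemma dual_zero:
  assumes "\<phi> \<in> dual E" "subspace (topspace E)"
  shows "\<phi> 0 = 0"
  using dual_scale[OF assms(1), of 0 0] subspace_0[OF assms(2)] by simp

lemma dual_diff:
  assumes "\<phi> \<in> dual E" "subspace (topspace E)" "x \<in> topspace E" "y \<in> topspace E"
  shows "\<phi> (x - y) = \<phi> x - \<phi> y"
  using dual_add[OF assms(1) assms(3) subspace_scale[OF assms(2,4), of "-1"]]
    dual_scale[OF assms(1,4), of "-1"] by simp

lemma dual_sum:
  assumes "\<phi> \<in> dual E" "subspace (topspace E)" "\<And>i. i \<in> I \<Longrightarrow> g i \<in> topspace E"
  shows "\<phi> (\<Sum>i\<in>I. c i *\<^sub>R g i) = (\<Sum>i\<in>I. c i * \<phi> (g i))"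
  using assms(3)
proof (induction I rule: infinite_finite_induct)
  case (insert j J)
  have "(\<Sum>i\<in>J. c i *\<^sub>R g i) \<in> topspace E" "c j *\<^sub>R g j \<in> topspace E"
    using insert.prems assms(2) by (auto intro!: subspace_sum subspace_scale)
  then show ?case
    using insert dual_add[OF assms(1)] dual_scale[OF assms(1)] by simp
qed (use dual_zero[OF assms(1,2)] in simp_all)

lemma sum_fun_apply: "(\<Sum>i\<in>I. f i) x = (\<Sum>i\<in>I. f i x)"
  by (induction I rule: infinite_finite_induct) auto

lemma sum_scaleR_fun_apply:
  fixes f :: "'i \<Rightarrow> 'x \<Rightarrow> real"
  shows "(\<Sum>i\<in>I. c i *\<^sub>R f i) x = (\<Sum>i\<in>I. c i * f i x)"
  by (simp add: sum_fun_apply scaleR_fun_def)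

lemma dualI:
  assumes "continuous_map E euclideanreal \<phi>"
    and "\<And>x y. x \<in> topspace E \<Longrightarrow> y \<in> topspace E \<Longrightarrow> \<phi> (x + y) = \<phi> x + \<phi> y"
    and "\<And>c x. x \<in> topspace E \<Longrightarrow> \<phi> (c *\<^sub>R x) = c * \<phi> x"
    and "\<And>x. x \<notin> topspace E \<Longrightarrow> \<phi> x = 0"
  shows "\<phi> \<in> dual E"
  unfolding dual_def mem_Collect_eq by (intro conjI ballI allI impI) (fact assms)+

lemma dual_continuous: "\<phi> \<in> dual E \<Longrightarrow> continuous_map E euclideanreal \<phi>"
  and dual_outside: "\<phi> \<in> dual E \<Longrightarrow> x \<notin> topspace E \<Longrightarrow> \<phi> x = 0"
  unfolding dual_def mem_Collect_eq by (elim conjE, assumption) (elim conjE allE impE)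

lemma subspace_dual: "subspace (dual E)"
proof (rule subspaceI)
  have "continuous_map E euclideanreal (\<lambda>_. 0)" by simp
  then show "0 \<in> dual E"
    by (intro dualI) (simp_all only: zero_fun_def add_0 mult_zero_right)
next
  fix \<phi> \<psi> assume \<phi>: "\<phi> \<in> dual E" and \<psi>: "\<psi> \<in> dual E"
  have "continuous_map E euclideanreal (\<lambda>x. \<phi> x + \<psi> x)"
    by (intro continuous_map_add dual_continuous \<phi> \<psi>)
  then have "(\<lambda>x. \<phi> x + \<psi> x) \<in> dual E"
    using dual_add[OF \<phi>] dual_add[OF \<psi>] dual_scale[OF \<phi>] dual_scale[OF \<psi>]
      dual_outside[OF \<phi>] dual_outside[OF \<psi>]
    by (intro dualI) (simp_all add: distrib_left)
  then show "\<phi> + \<psi> \<in> dual E" by (simp only: plus_fun_def)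
next
  fix c :: real and \<phi> assume \<phi>: "\<phi> \<in> dual E"
  have "continuous_map E euclideanreal (\<lambda>x. c * \<phi> x)"
    by (intro continuous_map_real_mult_left dual_continuous \<phi>)
  then have "(\<lambda>x. c * \<phi> x) \<in> dual E"
    using dual_add[OF \<phi>] dual_scale[OF \<phi>] dual_outside[OF \<phi>]
    by (intro dualI) (simp_all add: distrib_left)
  then show "c *\<^sub>R \<phi> \<in> dual E" by (simp only: scaleR_fun_def real_scaleR_def)
qed

text \<open>Only subbasic open sets, which test a single vector, have to be checked: the sets that eventually
contain the sequence once they contain the limit are closed under finite intersections and unions.\<close>

lemma limitin_weak_star:
  assumes "topspace E \<noteq> {}" "\<mu> \<in> dual E" "\<And>N. s N \<in> dual E"
    and "\<And>x. x \<in> topspace E \<Longrightarrow> (\<lambda>N. s N x) \<longlonglongrightarrow> \<mu> x"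
  shows "limitin (weak_star E) s \<mu> sequentially"
proof -
  have "\<mu> \<in> U \<longrightarrow> (\<forall>\<^sub>F N in sequentially. s N \<in> U)" if "openin (weak_star E) U" for U
    using that unfolding weak_star_def openin_topology_generated_by_iff
  proof (induction rule: generate_topology_on.induct)
    case (Basis S)
    then obtain x V where S: "S = {\<phi> \<in> dual E. \<phi> x \<in> V}" "x \<in> topspace E" "open V" by blast
    have "\<forall>\<^sub>F N in sequentially. s N x \<in> V" if "\<mu> x \<in> V"
      using assms(4)[OF S(2)] S(3) that by (rule topological_tendstoD)
    then show ?case using S assms(3) by simp
  next
    case (UN K)
    show ?case
    proof
      assume "\<mu> \<in> \<Union>K"
      then obtain k where "k \<in> K" "\<mu> \<in> k" by blast
      then have "\<forall>\<^sub>F N in sequentially. s N \<in> k" using UN.IH by simp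
      then show "\<forall>\<^sub>F N in sequentially. s N \<in> \<Union>K"
        by (rule eventually_mono) (rule UnionI[OF \<open>k \<in> K\<close>])
    qed
  qed (auto elim: eventually_elim2)
  then show ?thesis using assms(1,2) by (simp add: limitin_def)
qed

lemma continuous_map_weak_star_eval:
  assumes "x \<in> topspace E"
  shows "continuous_map (weak_star E) euclideanreal (\<lambda>\<phi>. \<phi> x)"
proof -
  have "openin (weak_star E) {\<phi> \<in> dual E. \<phi> x \<in> U}" if "open U" for U
    unfolding weak_star_def using assms that by (intro topology_generated_by_Basis) blast
  moreover have "topspace (weak_star E) = dual E"
    using assms by (intro topspace_weak_star) blast
  ultimately show ?thesis by (simp add: continuous_map_def)
qed

text \<open>The condition on \<open>\<mu>\<close> says that the classes of the \<open>e n\<close> form a weak Schauder basis of the quotient of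
\<open>E\<close> by the common kernel of the \<open>y n\<close>. Elements of the weak-star closed span annihilate this kernel because
each evaluation is weak-star continuous, so they are among the functionals covered by the hypothesis.\<close>

lemma weak_star_basic_sequence:
  assumes sub: "subspace (topspace E)"
    and y: "\<And>n. y n \<in> dual E" and e: "\<And>n. e n \<in> topspace E"
    and bio: "\<And>m n. y m (e n) = (if m = n then 1 else 0)"
    and conv: "\<And>\<mu> f. \<mu> \<in> dual E \<Longrightarrow>
       (\<And>g. g \<in> topspace E \<Longrightarrow> (\<And>n. y n g = 0) \<Longrightarrow> \<mu> g = 0) \<Longrightarrow> f \<in> topspace E \<Longrightarrow>
       (\<lambda>N. \<Sum>n<N. \<mu> (e n) * y n f) \<longlonglongrightarrow> \<mu> f"
  shows "basic_sequence (weak_star E) y"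
proof -
  have ne: "topspace E \<noteq> {}" by (rule ex_in_conv[THEN iffD1], rule exI, rule e)
  define W where "W = weak_star E"
  define C where "C = W closure_of span (range y)"
  have topW: "topspace W = dual E" unfolding W_def using ne by (rule topspace_weak_star)
  have sp: "span (range y) \<subseteq> dual E"
    by (rule span_minimal[OF image_subsetI subspace_dual]) (rule y)
  have spC: "span (range y) \<subseteq> C"
    unfolding C_def by (rule closure_of_subset) (unfold topW, rule sp)
  have Cd: "C \<subseteq> dual E" unfolding C_def topW[symmetric] by (rule closure_of_subset_topspace)
  have kill: "\<mu> g = 0" if \<mu>: "\<mu> \<in> C" and g: "g \<in> topspace E" "\<And>n. y n g = 0" for \<mu> g
  proof -
    have "closedin W {\<phi> \<in> topspace W. \<phi> g \<in> {0}}"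
      unfolding W_def
      by (rule closedin_continuous_map_preimage[OF continuous_map_weak_star_eval[OF g(1)]]) simp
    moreover have "subspace {\<phi>::'a \<Rightarrow> real. \<phi> g = 0}"
    proof (rule subspaceI)
      show "c *\<^sub>R \<phi> \<in> {\<phi>::'a \<Rightarrow> real. \<phi> g = 0}" if "\<phi> \<in> {\<phi>. \<phi> g = 0}" for c \<phi>
        using that by (simp only: mem_Collect_eq scaleR_fun_def scaleR_zero_right)
    qed simp_all
    then have "span (range y) \<subseteq> {\<phi>. \<phi> g = 0}"
      using g(2) by (intro span_minimal) auto
    ultimately have "C \<subseteq> {\<phi> \<in> topspace W. \<phi> g \<in> {0}}"
      unfolding C_def using sp topW by (intro closure_of_minimal) auto
    then show ?thesis using \<mu> by blast
  qed
  have ex: "expansion (subtopology W C) y \<mu> (\<lambda>n. \<mu> (e n))" if \<mu>: "\<mu> \<in> C" for \<mu>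
  proof -
    let ?s = "\<lambda>N. \<Sum>n<N. \<mu> (e n) *\<^sub>R y n"
    have s: "?s N \<in> span (range y)" for N
      by (intro span_sum span_scale span_base) simp
    have "limitin W ?s \<mu> sequentially"
      unfolding W_def
    proof (rule limitin_weak_star[OF ne])
      fix f assume f: "f \<in> topspace E"
      show "(\<lambda>N. ?s N f) \<longlonglongrightarrow> \<mu> f"
        unfolding sum_scaleR_fun_apply
      proof (rule conv[OF _ _ f])
        show "\<mu> \<in> dual E" using \<mu> Cd by (rule rev_subsetD)
        show "\<mu> g = 0" if "g \<in> topspace E" "\<And>n. y n g = 0" for g
          using \<mu> that by (rule kill)
      qed
    qed (rule rev_subsetD[OF \<mu> Cd], rule rev_subsetD[OF s sp])
    moreover have "\<forall>N. ?s N \<in> C" using s subsetD[OF spC] by simp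
    ultimately show ?thesis
      unfolding expansion_def limitin_subtopology using \<mu> by (intro conjI always_eventually)
  qed
  have uniq: "b = (\<lambda>n. \<mu> (e n))" if b: "expansion (subtopology W C) y \<mu> b" for \<mu> b
  proof
    fix n
    have "limitin W (\<lambda>N. \<Sum>n<N. b n *\<^sub>R y n) \<mu> sequentially"
      using b unfolding expansion_def limitin_subtopology by (elim conjE)
    from continuous_map_limit[OF continuous_map_weak_star_eval[OF e[of n]] this[unfolded W_def]]
    have "(\<lambda>N. \<Sum>m<N. b m * y m (e n)) \<longlonglongrightarrow> \<mu> (e n)"
      unfolding limitin_canonical_iff o_def sum_scaleR_fun_apply .
    moreover have "(\<lambda>N. \<Sum>m<N. b m * y m (e n)) \<longlonglongrightarrow> b n"
    proof (rule tendsto_eventually, rule eventually_sequentiallyI)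
      fix N assume "Suc n \<le> N"
      have "(\<Sum>m<N. b m * y m (e n)) = (\<Sum>m<N. if m = n then b m else 0)"
        by (intro sum.cong) (auto simp: bio)
      then show "(\<Sum>m<N. b m * y m (e n)) = b n"
        using \<open>Suc n \<le> N\<close> by (simp add: sum.delta)
    qed
    ultimately show "b n = \<mu> (e n)" by (metis LIMSEQ_unique)
  qed
  have THE: "(THE b. expansion (subtopology W C) y \<mu> b) = (\<lambda>n. \<mu> (e n))" if "\<mu> \<in> C" for \<mu>
    by (rule the_equality[of _ "\<lambda>n. \<mu> (e n)"]) (rule ex[OF that], rule uniq)
  have "schauder_basis (subtopology W C) y"
    unfolding schauder_basis_def
  proof (intro conjI ballI allI)
    have tC: "topspace (subtopology W C) = C"
      unfolding topspace_subtopology topW using Cd by (rule Int_absorb1)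
    show "range y \<subseteq> topspace (subtopology W C)"
      unfolding tC by (rule subset_trans[OF span_superset spC])
    show "\<exists>!b. expansion (subtopology W C) y \<mu> b" if "\<mu> \<in> topspace (subtopology W C)" for \<mu>
      by (rule ex1I[where P = "expansion (subtopology W C) y \<mu>", OF ex[OF that[unfolded tC]] uniq])
    fix n
    have "continuous_map (subtopology W C) euclideanreal (\<lambda>\<mu>. \<mu> (e n))"
      unfolding W_def
      by (rule continuous_map_from_subtopology[OF continuous_map_weak_star_eval[OF e]])
    then show "continuous_map (subtopology W C) euclideanreal
        (\<lambda>\<mu>. (THE b. expansion (subtopology W C) y \<mu> b) n)"
      by (rule continuous_map_eq) (simp add: tC THE)
  qed
  moreover have "range y \<subseteq> topspace W" unfolding topW using y by (rule image_subsetI)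
  ultimately show ?thesis
    unfolding basic_sequence_def C_def W_def by (intro conjI)
qed

lemma weak_star_cong:
  "topspace E = topspace F \<Longrightarrow> dual E = dual F \<Longrightarrow> weak_star E = weak_star F"
  by (simp add: weak_star_def)


section \<open>Continuous functions and functionals with compact support\<close>

lemma cfun_continuous: "f \<in> cfun Z \<Longrightarrow> continuous_map Z euclideanreal f"
  and cfun_outside: "f \<in> cfun Z \<Longrightarrow> z \<notin> topspace Z \<Longrightarrow> f z = 0"
  by (auto simp: cfun_def)

lemma cfun_lambda_intros:
  assumes "f \<in> cfun Z"
  shows "g \<in> cfun Z \<Longrightarrow> (\<lambda>z. f z + g z) \<in> cfun Z"
    and "g \<in> cfun Z \<Longrightarrow> (\<lambda>z. f z - g z) \<in> cfun Z"
    and "g \<in> cfun Z \<Longrightarrow> (\<lambda>z. f z * g z) \<in> cfun Z"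
    and "(\<lambda>z. c * f z) \<in> cfun Z"
    and "0 \<le> B \<Longrightarrow> (\<lambda>z. max (- B) (min B (f z))) \<in> cfun Z"
  using assms by (auto simp: cfun_def intro!: continuous_intros)

lemma cfun_sum:
  assumes "\<And>i. i \<in> I \<Longrightarrow> f i \<in> cfun Z"
  shows "(\<lambda>z. \<Sum>i\<in>I. f i z) \<in> cfun Z"
proof -
  have "(\<Sum>i\<in>I. f i) \<in> cfun Z" using assms by (intro subspace_sum subspace_cfun)
  moreover have "(\<Sum>i\<in>I. f i) = (\<lambda>z. \<Sum>i\<in>I. f i z)" by (rule ext) (rule sum_fun_apply)
  ultimately show ?thesis by simp
qed

lemma Ck_nbhd_0:
  assumes "openin (Ck Z) U" "0 \<in> U"
  shows "\<exists>K e. compactin Z K \<and> e > 0 \<and> (\<forall>f\<in>cfun Z. (\<forall>z\<in>K. \<bar>f z\<bar> < e) \<longrightarrow> f \<in> U)"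
proof -
  let ?Q = "\<lambda>U. \<exists>K e. compactin Z K \<and> e > 0 \<and> (\<forall>f\<in>cfun Z. (\<forall>z\<in>K. \<bar>f z\<bar> < e) \<longrightarrow> f \<in> U)"
  have "0 \<in> U \<longrightarrow> ?Q U"
    using assms(1) unfolding Ck_def openin_topology_generated_by_iff
  proof (induction rule: generate_topology_on.induct)
    case (Int a b)
    show ?case
    proof
      assume "0 \<in> a \<inter> b"
      then have "0 \<in> a" "0 \<in> b" by blast+
      then have Q: "?Q a" "?Q b" by - (rule mp[OF Int.IH(1)], assumption, rule mp[OF Int.IH(2)])
      obtain K d where K: "compactin Z K" "d > 0" "\<forall>f\<in>cfun Z. (\<forall>z\<in>K. \<bar>f z\<bar> < d) \<longrightarrow> f \<in> a"
        using Q(1) by (elim exE conjE)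
      obtain L e where L: "compactin Z L" "e > 0" "\<forall>f\<in>cfun Z. (\<forall>z\<in>L. \<bar>f z\<bar> < e) \<longrightarrow> f \<in> b"
        using Q(2) by (elim exE conjE)
      show "?Q (a \<inter> b)"
        using K L by (intro exI[of _ "K \<union> L"] exI[of _ "min d e"]) (auto intro: compactin_Un)
    qed
  next
    case (UN \<K>)
    show ?case
    proof
      assume "0 \<in> \<Union>\<K>"
      then obtain k where k: "k \<in> \<K>" "0 \<in> k" by (rule UnionE)
      obtain K e where K: "compactin Z K" "e > 0" "\<forall>f\<in>cfun Z. (\<forall>z\<in>K. \<bar>f z\<bar> < e) \<longrightarrow> f \<in> k"
        using mp[OF UN.IH[OF k(1)] k(2)] by (elim exE conjE)
      then show "?Q (\<Union>\<K>)" using k(1) by (intro exI[of _ K] exI[of _ e]) auto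
    qed
  next
    case (Basis S)
    then obtain K V where S: "S = {f \<in> cfun Z. f ` K \<subseteq> V}" "compactin Z K" "open (V::real set)"
      by blast
    show ?case
    proof
      assume 0: "0 \<in> S"
      have "\<exists>e>0. K \<noteq> {} \<longrightarrow> ball 0 e \<subseteq> V"
      proof (cases "K = {}")
        case False
        then have "0 \<in> V" using 0 S(1) by auto
        then show ?thesis using S(3) open_contains_ball by blast
      qed (auto intro: exI[of _ 1])
      then obtain e where "e > 0" "K \<noteq> {} \<longrightarrow> ball 0 e \<subseteq> V" by blast
      then show "?Q S"
        unfolding S(1) using S(2)
        by (intro exI[of _ K] exI[of _ e]) (auto simp: subset_eq)
    qed
  qed simp
  then show ?thesis by (rule mp) (rule assms(2))
qed

text \<open>The subbasic sets control only the image of a whole compact set. To control the oscillation around \<open>f\<close>, the compact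
set is cut into finitely many compact pieces on which \<open>f\<close> is nearly constant.\<close>

lemma Ck_nbhd:
  assumes f: "f \<in> cfun Z" and K: "compactin Z K" and e: "e > 0"
  obtains U where "openin (Ck Z) U" "f \<in> U" "\<And>g z. g \<in> U \<Longrightarrow> z \<in> K \<Longrightarrow> \<bar>g z - f z\<bar> < e"
proof -
  have fc: "continuous_map Z euclideanreal f" using f by (rule cfun_continuous)
  define G where "G x = {z \<in> topspace Z. f z \<in> ball (f x) (e/3)}" for x
  have G: "openin Z (G x)" for x
    unfolding G_def using fc by (rule openin_continuous_map_preimage) simp
  have Kt: "K \<subseteq> topspace Z" using K by (rule compactin_subset_topspace)
  have "K \<subseteq> \<Union>(G ` K)" using Kt e by (auto simp: G_def)
  then obtain \<F> where "finite \<F>" "\<F> \<subseteq> G ` K" "K \<subseteq> \<Union>\<F>"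
    using compactinD[OF K, of "G ` K"] G by blast
  then obtain A where A: "finite A" "A \<subseteq> K" "K \<subseteq> \<Union>(G ` A)"
    by (metis finite_subset_image)
  define K' where "K' x = K \<inter> {z \<in> topspace Z. f z \<in> cball (f x) (e/3)}" for x
  have K': "compactin Z (K' x)" for x
    unfolding K'_def
    by (rule compact_Int_closedin[OF K closedin_continuous_map_preimage[OF fc]]) simp
  define U where "U = cfun Z \<inter> (\<Inter>x\<in>A. {g \<in> cfun Z. g ` K' x \<subseteq> ball (f x) (e/2)})"
  have "openin (Ck Z) {g \<in> cfun Z. g ` K' x \<subseteq> ball (f x) (e/2)}" for x
    unfolding Ck_def using K' by (intro topology_generated_by_Basis) blast
  then have "openin (Ck Z) U"
    unfolding U_def using A(1) openin_topspace[of "Ck Z"]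
    by (cases "A = {}") (auto intro!: openin_Int openin_Inter simp: topspace_Ck[symmetric] simp del: topspace_Ck)
  moreover have "f \<in> U"
    unfolding U_def K'_def using f e by (auto simp: subset_eq)
  moreover have "\<bar>g z - f z\<bar> < e" if g: "g \<in> U" and z: "z \<in> K" for g z
  proof -
    obtain x where x: "x \<in> A" "z \<in> G x" using A(3) z by blast
    then have "z \<in> K' x" using z by (auto simp: G_def K'_def)
    moreover have "g ` K' x \<subseteq> ball (f x) (e/2)" using g x(1) by (simp add: U_def)
    ultimately have "g z \<in> ball (f x) (e/2)" by blast
    then have "dist (f x) (g z) < e/2" by simp
    moreover have "dist (f x) (f z) < e/3" using x(2) by (simp add: G_def)
    ultimately show ?thesis unfolding dist_real_def using e by linarith
  qed
  ultimately show ?thesis by (rule that)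
qed

text \<open>Continuity at zero and homogeneity. In particular, a functional vanishes at functions that vanish on \<open>K\<close> (take \<open>c = 0\<close>) and is bounded on functions of
sup norm at most one, whatever \<open>K\<close> is.\<close>

lemma dual_Ck_bound:
  assumes "\<phi> \<in> dual (Ck Z)"
  shows "\<exists>K M. compactin Z K \<and> M \<ge> 0 \<and>
    (\<forall>f\<in>cfun Z. \<forall>c\<ge>0. (\<forall>z\<in>K. \<bar>f z\<bar> \<le> c) \<longrightarrow> \<bar>\<phi> f\<bar> \<le> M * c)"
proof -
  have cont: "continuous_map (Ck Z) euclideanreal \<phi>" using assms by (simp add: dual_def)
  have "openin (Ck Z) {f \<in> topspace (Ck Z). \<phi> f \<in> {-1<..<1}}"
    using cont by (rule openin_continuous_map_preimage) simp
  moreover have "0 \<in> {f \<in> topspace (Ck Z). \<phi> f \<in> {-1<..<1}}"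
    using dual_zero[OF assms] subspace_cfun[of Z] subspace_0[OF subspace_cfun, of Z] by simp
  ultimately have "\<exists>K e. compactin Z K \<and> e > 0 \<and> (\<forall>f\<in>cfun Z. (\<forall>z\<in>K. \<bar>f z\<bar> < e) \<longrightarrow>
      f \<in> {f \<in> topspace (Ck Z). \<phi> f \<in> {-1<..<1}})"
    by (rule Ck_nbhd_0)
  then obtain K e where K: "compactin Z K" "e > 0"
    "\<forall>f\<in>cfun Z. (\<forall>z\<in>K. \<bar>f z\<bar> < e) \<longrightarrow> f \<in> {f \<in> topspace (Ck Z). \<phi> f \<in> {-1<..<1}}"
    by (elim exE conjE)
  have *: "\<bar>\<phi> f\<bar> \<le> 2 / e * c" if f: "f \<in> cfun Z" and c: "\<And>z. z \<in> K \<Longrightarrow> \<bar>f z\<bar> \<le> c" "c > 0" for f c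
  proof -
    define t where "t = e / (2 * c)"
    have t: "t > 0" using K(2) c(2) by (simp add: t_def)
    have "t *\<^sub>R f \<in> cfun Z" using f by (simp add: subspace_scale[OF subspace_cfun])
    moreover have "\<bar>(t *\<^sub>R f) z\<bar> < e" if "z \<in> K" for z
    proof -
      have "t * \<bar>f z\<bar> \<le> t * c" using c(1)[OF that] t by simp
      also have "\<dots> < e" using K(2) c(2) by (simp add: t_def)
      finally show ?thesis using t by (simp add: scaleR_fun_def abs_mult)
    qed
    ultimately have "\<bar>\<phi> (t *\<^sub>R f)\<bar> < 1" using K(3) by (auto simp: abs_if)
    then have "t * \<bar>\<phi> f\<bar> < 1" using dual_scale[OF assms, of f t] f t by (simp add: abs_mult)
    then have "\<bar>\<phi> f\<bar> < 1 / t" using t by (simp add: field_simps)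
    then show ?thesis using K(2) c(2) by (simp add: t_def)
  qed
  have "\<bar>\<phi> f\<bar> \<le> 2 / e * c" if f: "f \<in> cfun Z" "\<And>z. z \<in> K \<Longrightarrow> \<bar>f z\<bar> \<le> c" "c \<ge> 0" for f c
  proof -
    have "\<bar>\<phi> f\<bar> \<le> 2 / e * c + d" if d: "d > 0" for d
    proof -
      have "\<bar>\<phi> f\<bar> \<le> 2 / e * (c + d * e / 2)"
      proof (rule *[OF f(1)])
        have "0 < d * e / 2" using d K(2) by simp
        then show "\<bar>f z\<bar> \<le> c + d * e / 2" if "z \<in> K" for z using f(2)[OF that] by linarith
        show "0 < c + d * e / 2" using \<open>0 < d * e / 2\<close> f(3) by linarith
      qed
      then show ?thesis using K(2) by (simp add: field_simps)
    qed
    then show ?thesis by (rule field_le_epsilon)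
  qed
  then show ?thesis
    using K(1,2) by (intro exI[of _ K] exI[of _ "2 / e"] conjI ballI allI impI) simp_all
qed

lemma dual_CkI:
  assumes K: "compactin Z K"
    and add: "\<And>f g. f \<in> cfun Z \<Longrightarrow> g \<in> cfun Z \<Longrightarrow> \<phi> (f + g) = \<phi> f + \<phi> g"
    and scale: "\<And>c f. f \<in> cfun Z \<Longrightarrow> \<phi> (c *\<^sub>R f) = c * \<phi> f"
    and out: "\<And>f. f \<notin> cfun Z \<Longrightarrow> \<phi> f = 0"
    and bound: "\<And>f c. f \<in> cfun Z \<Longrightarrow> (\<And>z. z \<in> K \<Longrightarrow> \<bar>f z\<bar> \<le> c) \<Longrightarrow> c \<ge> 0 \<Longrightarrow> \<bar>\<phi> f\<bar> \<le> M * c"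
  shows "\<phi> \<in> dual (Ck Z)"
proof -
  have "continuous_map (Ck Z) euclideanreal \<phi>"
    unfolding continuous_map_def
  proof (intro conjI allI impI)
    fix V :: "real set" assume "openin euclidean V"
    then have V: "open V" by simp
    show "openin (Ck Z) {f \<in> topspace (Ck Z). \<phi> f \<in> V}"
    proof (subst openin_subopen, intro ballI)
      fix f assume "f \<in> {f \<in> topspace (Ck Z). \<phi> f \<in> V}"
      then have f: "f \<in> cfun Z" "\<phi> f \<in> V" by auto
      obtain e where e: "e > 0" "ball (\<phi> f) e \<subseteq> V" using V f(2) open_contains_ball by blast
      define d where "d = e / (\<bar>M\<bar> + 1)"
      have d: "d > 0" "\<bar>M\<bar> * d < e" using e by (auto simp: d_def field_simps)
      obtain U where U: "openin (Ck Z) U" "f \<in> U" "\<And>g z. g \<in> U \<Longrightarrow> z \<in> K \<Longrightarrow> \<bar>g z - f z\<bar> < d"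
        using Ck_nbhd[OF f(1) K d(1)] by blast
      have "\<phi> g \<in> V" if g: "g \<in> U" for g
      proof -
        have gc: "g \<in> cfun Z" using openin_subset[OF U(1)] g by auto
        have "\<phi> g = \<phi> (f + (g - f))" by simp
        also have "\<dots> = \<phi> f + \<phi> (g - f)"
          using f gc by (intro add) (auto intro: subspace_diff[OF subspace_cfun])
        finally have "\<phi> g = \<phi> f + \<phi> (g - f)" .
        moreover have "\<bar>\<phi> (g - f)\<bar> \<le> M * d"
          using U(3)[OF g] d(1) gc f(1)
          by (intro bound) (auto intro: subspace_diff[OF subspace_cfun] less_imp_le)
        moreover have "M * d \<le> \<bar>M\<bar> * d" using d(1) by simp
        ultimately have "dist (\<phi> f) (\<phi> g) < e" using d(2) by (simp add: dist_real_def)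
        then show ?thesis using e(2) by auto
      qed
      then show "\<exists>T. openin (Ck Z) T \<and> f \<in> T \<and> T \<subseteq> {f \<in> topspace (Ck Z). \<phi> f \<in> V}"
        using U openin_subset[OF U(1)] by (intro exI[of _ U]) auto
    qed
  qed simp
  then show ?thesis using add scale out by (simp add: dual_def)
qed

lemma dirac_in_dual:
  assumes "z \<in> topspace Z"
  shows "dirac Z z \<in> dual (Ck Z)"
proof (rule dual_CkI[of Z "{z}" _ 1])
  show "dirac Z z (c *\<^sub>R f) = c * dirac Z z f" if "f \<in> cfun Z" for c f
    using that subspace_scale[OF subspace_cfun that, of c] by (simp add: dirac_def scaleR_fun_def)
  show "dirac Z z (f + g) = dirac Z z f + dirac Z z g" if "f \<in> cfun Z" "g \<in> cfun Z" for f g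
    using that subspace_add[OF subspace_cfun that] by (simp add: dirac_def)
qed (use assms in \<open>auto simp: dirac_def\<close>)

lemma tychonoff_bump:
  assumes "tychonoff_space Z" "openin Z U" "x \<in> U"
  obtains u where "u \<in> cfun Z" "u x = 1" "\<And>z. 0 \<le> u z" "\<And>z. u z \<le> 1" "\<And>z. z \<notin> U \<Longrightarrow> u z = 0"
proof -
  have U: "U \<subseteq> topspace Z" "closedin Z (topspace Z - U)" using assms(2) by (auto simp: openin_subset)
  then obtain f where f: "continuous_map Z (top_of_set {0..1::real}) f" "f x = 0"
    "f ` (topspace Z - U) \<subseteq> {1}"
    using assms unfolding tychonoff_space_def completely_regular_space_def by blast
  define u where "u z = (if z \<in> topspace Z then 1 - f z else 0)" for z
  have f': "continuous_map Z euclideanreal f" "\<And>z. z \<in> topspace Z \<Longrightarrow> f z \<in> {0..1}"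
    using f(1) by (auto simp: continuous_map_in_subtopology)
  have "continuous_map Z euclideanreal u"
    by (rule continuous_map_eq[of _ _ "\<lambda>z. 1 - f z"]) (auto simp: u_def intro!: continuous_intros f')
  then show ?thesis
    using f'(2) f(2,3) assms(3) U(1) by (intro that[of u]) (auto simp: u_def cfun_def)
qed

text \<open>Bump functions adjust the values one point at a time; truncating at \<open>B\<close> afterwards does not change
the prescribed values.\<close>

lemma tychonoff_interpolation:
  assumes Z: "tychonoff_space Z" and A: "finite A" "A \<subseteq> topspace Z" and C: "closedin Z C" "A \<inter> C = {}"
    and B: "\<And>a. a \<in> A \<Longrightarrow> \<bar>v a\<bar> \<le> B" "B \<ge> 0"
  obtains f where "f \<in> cfun Z" "\<And>a. a \<in> A \<Longrightarrow> f a = v a" "\<And>z. z \<in> C \<Longrightarrow> f z = 0" "\<And>z. \<bar>f z\<bar> \<le> B"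
proof -
  have "\<exists>f\<in>cfun Z. (\<forall>a\<in>A. f a = v a) \<and> (\<forall>z\<in>C. f z = 0)"
    using A C(2)
  proof (induction A rule: finite_induct)
    case empty
    show ?case using subspace_0[OF subspace_cfun, of Z] by (intro bexI[of _ 0]) auto
  next
    case (insert a A)
    then obtain f where f: "f \<in> cfun Z" "\<forall>a\<in>A. f a = v a" "\<forall>z\<in>C. f z = 0" by blast
    have "t1_space Z"
      using Z Hausdorff_imp_t1_space by (auto simp: tychonoff_space_def)
    then have "closedin Z (A \<union> C)"
      using insert C(1) by (auto intro!: closedin_Un simp: closedin_t1_singleton t1_space_closedin_finite)
    then have "openin Z (topspace Z - (A \<union> C))" by blast
    moreover have "a \<in> topspace Z - (A \<union> C)" using insert by auto
    ultimately obtain u where u: "u \<in> cfun Z" "u a = 1" "\<And>z. z \<notin> topspace Z - (A \<union> C) \<Longrightarrow> u z = 0"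
      using tychonoff_bump[OF Z] by metis
    have "(\<lambda>z. f z + (v a - f a) * u z) \<in> cfun Z"
      by (intro cfun_lambda_intros f u)
    then show ?case using f u by (intro bexI[of _ "\<lambda>z. f z + (v a - f a) * u z"]) auto
  qed
  then obtain f where f: "f \<in> cfun Z" "\<forall>a\<in>A. f a = v a" "\<forall>z\<in>C. f z = 0" by blast
  show ?thesis
  proof (rule that[of "\<lambda>z. max (- B) (min B (f z))"])
    show "max (- B) (min B (f a)) = v a" if "a \<in> A" for a
      using B(1)[OF that] f(2) that by auto
  qed (use f B(2) in \<open>auto intro: cfun_lambda_intros\<close>)
qed

section \<open>Lifting sequences through almost open maps\<close>

lemma cfun_uniform_limit:
  assumes f: "\<And>N. f N \<in> cfun Z" and g: "\<And>z. z \<notin> topspace Z \<Longrightarrow> g z = 0"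
    and bound: "\<And>N z. \<bar>f N z - g z\<bar> \<le> e N" and e: "e \<longlonglongrightarrow> (0::real)"
  shows "g \<in> cfun Z"
proof -
  have "continuous_map Z Met_TC.mtopology g"
  proof (rule Met_TC.continuous_map_uniform_limit[where F = sequentially and f = f])
    show "\<forall>\<^sub>F N in sequentially. continuous_map Z Met_TC.mtopology (f N)"
      using f by (auto simp: cfun_def)
    show "\<forall>\<^sub>F N in sequentially. \<forall>z\<in>topspace Z. g z \<in> UNIV \<and> dist (f N z) (g z) < d" if "d > 0" for d
      using order_tendstoD(2)[OF e that]
    proof (rule eventually_mono)
      fix N assume "e N < d"
      then show "\<forall>z\<in>topspace Z. g z \<in> UNIV \<and> dist (f N z) (g z) < d"
        using bound[of N] by (auto simp: dist_real_def intro: le_less_trans)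
    qed
  qed simp
  then show ?thesis using g by (simp add: cfun_def)
qed

text \<open>The successive approximation in the proof of the open mapping theorem: the error is
halved at each step, so the corrections sum up uniformly on \<open>Z\<close>. The sum is again a
continuous function, although \<open>C_k(Z)\<close> itself is in general not complete.\<close>

lemma almost_open_lifting:
  assumes y: "\<And>n. y n \<in> dual (Ck Z)" and C: "C \<ge> 0"
    and coord: "\<And>b n. b \<in> F \<Longrightarrow> \<bar>b n\<bar> \<le> \<nu> b"
    and almost: "\<And>b. b \<in> F \<Longrightarrow> \<exists>h\<in>cfun Z. (\<forall>z. \<bar>h z\<bar> \<le> C * \<nu> b) \<and>
        (\<lambda>n. b n - y n h) \<in> F \<and> \<nu> (\<lambda>n. b n - y n h) \<le> \<nu> b / 2"
    and b: "b \<in> F"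
  obtains h where "h \<in> cfun Z" "\<And>z. \<bar>h z\<bar> \<le> 2 * C * \<nu> b" "\<And>n. y n h = b n"
proof -
  have "\<forall>b\<in>F. \<exists>h. h \<in> cfun Z \<and> (\<forall>z. \<bar>h z\<bar> \<le> C * \<nu> b) \<and>
        (\<lambda>n. b n - y n h) \<in> F \<and> \<nu> (\<lambda>n. b n - y n h) \<le> \<nu> b / 2"
    by (rule ballI) (rule almost[unfolded Bex_def])
  from bchoice[OF this] obtain H where H': "\<forall>b\<in>F. H b \<in> cfun Z \<and> (\<forall>z. \<bar>H b z\<bar> \<le> C * \<nu> b) \<and>
        (\<lambda>n. b n - y n (H b)) \<in> F \<and> \<nu> (\<lambda>n. b n - y n (H b)) \<le> \<nu> b / 2"
    by (elim exE)
  have H: "\<And>b. b \<in> F \<Longrightarrow> H b \<in> cfun Z" "\<And>b z. b \<in> F \<Longrightarrow> \<bar>H b z\<bar> \<le> C * \<nu> b"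
    "\<And>b. b \<in> F \<Longrightarrow> (\<lambda>n. b n - y n (H b)) \<in> F"
    "\<And>b. b \<in> F \<Longrightarrow> \<nu> (\<lambda>n. b n - y n (H b)) \<le> \<nu> b / 2"
    using bspec[OF H'] by blast+
  define B where "B = rec_nat b (\<lambda>_ c n. c n - y n (H c))"
  have B0: "B 0 = b" and BS: "\<And>k. B (Suc k) = (\<lambda>n. B k n - y n (H (B k)))"
    by (simp_all add: B_def)
  have BF: "B k \<in> F" for k by (induction k) (use b H(3) in \<open>auto simp: B0 BS\<close>)
  have B\<nu>: "\<nu> (B k) \<le> \<nu> b * (1/2) ^ k" for k
  proof (induction k)
    case (Suc k)
    have "\<nu> (B (Suc k)) \<le> \<nu> (B k) / 2" unfolding BS by (rule H(4)[OF BF])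
    then show ?case using Suc by simp
  qed (simp add: B0)
  define D where "D = C * \<nu> b"
  have Hb: "\<bar>H (B k) z\<bar> \<le> D * (1/2) ^ k" for k z
  proof -
    have "\<bar>H (B k) z\<bar> \<le> C * \<nu> (B k)" by (rule H(2)[OF BF])
    also have "\<dots> \<le> C * (\<nu> b * (1/2) ^ k)" by (rule mult_left_mono[OF B\<nu> C])
    finally show ?thesis by (simp add: D_def mult.assoc)
  qed
  have geo: "summable (\<lambda>k. D * (1/2) ^ k)" by (intro summable_mult summable_geometric) simp
  have abs_sm: "summable (\<lambda>k. \<bar>H (B k) z\<bar>)" for z
    by (rule summable_comparison_test'[OF geo, of 0]) (simp add: Hb)
  then have sm: "summable (\<lambda>k. H (B k) z)" for z by (rule summable_rabs_cancel)
  define S where "S z = (\<Sum>k. H (B k) z)" for z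
  define P where "P N = (\<lambda>z. \<Sum>k<N. H (B k) z)" for N
  have geosum: "(\<Sum>k. D * (1/2) ^ (k + N)) = 2 * D * (1/2) ^ N" for N
  proof -
    have "(\<lambda>k. D * (1/2) ^ N * (1/2) ^ k) sums (D * (1/2) ^ N * (1 / (1 - 1/2)))"
      by (intro sums_mult geometric_sums) simp
    then show ?thesis by (simp add: sums_iff power_add mult_ac)
  qed
  have err: "\<bar>P N z - S z\<bar> \<le> 2 * D * (1/2) ^ N" for N z
  proof -
    have "S z - P N z = (\<Sum>k. H (B (k + N)) z)"
      using suminf_split_initial_segment[OF sm, of z N] by (simp add: S_def P_def)
    moreover have "\<bar>\<Sum>k. H (B (k + N)) z\<bar> \<le> (\<Sum>k. \<bar>H (B (k + N)) z\<bar>)"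
      using abs_sm[of z] by (intro summable_rabs) (simp add: summable_iff_shift[of "\<lambda>k. \<bar>H (B k) z\<bar>"])
    moreover have "\<dots> \<le> (\<Sum>k. D * (1/2) ^ (k + N))"
      using abs_sm[of z] geo Hb
      by (intro suminf_le) (simp_all add: summable_iff_shift[of "\<lambda>k. \<bar>H (B k) z\<bar>"]
          summable_iff_shift[of "\<lambda>k. D * (1/2) ^ k"])
    ultimately show ?thesis using geosum by simp
  qed
  have half0: "(\<lambda>N. A * (1/2) ^ N) \<longlonglongrightarrow> 0" for A :: real
    by (intro tendsto_mult_right_zero LIMSEQ_power_zero) simp
  have P: "P N \<in> cfun Z" for N unfolding P_def by (rule cfun_sum) (rule H(1)[OF BF])
  have S: "S \<in> cfun Z"
  proof (rule cfun_uniform_limit[OF P _ err half0])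
    fix z assume "z \<notin> topspace Z"
    then show "S z = 0" using cfun_outside[OF H(1)[OF BF]] by (simp add: S_def)
  qed
  have yP: "y n (P N) = b n - B N n" for n N
  proof -
    have "P N = (\<Sum>k<N. 1 *\<^sub>R H (B k))" by (rule ext) (simp add: P_def sum_fun_apply)
    then have "y n (P N) = (\<Sum>k<N. 1 * y n (H (B k)))"
      using dual_sum[OF y[of n], of "{..<N}" "\<lambda>k. H (B k)" "\<lambda>_. 1"] subspace_cfun[of Z] H(1)[OF BF] by simp
    moreover have "(\<Sum>k<N. y n (H (B k))) = b n - B N n"
      by (induction N) (simp_all add: B0 BS)
    ultimately show ?thesis by simp
  qed
  have "y n S = b n" for n
  proof -
    obtain K M where M: "compactin Z K" "M \<ge> 0"
      "\<forall>f\<in>cfun Z. \<forall>c\<ge>0. (\<forall>z\<in>K. \<bar>f z\<bar> \<le> c) \<longrightarrow> \<bar>y n f\<bar> \<le> M * c"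
      using dual_Ck_bound[OF y[of n]] by (elim exE conjE)
    have "\<bar>y n S - b n\<bar> \<le> (M * (2 * D) + \<nu> b) * (1/2) ^ N" for N
    proof -
      have "0 \<le> \<bar>P N z - S z\<bar>" for z by simp
      then have D0: "0 \<le> 2 * D * (1/2) ^ N" using err by (rule order_trans)
      have "\<bar>y n (P N - S)\<bar> \<le> M * (2 * D * (1/2) ^ N)"
        using err D0 by (intro M(3)[rule_format] subspace_diff[OF subspace_cfun P S]) simp_all
      moreover have "y n (P N - S) = y n (P N) - y n S"
        using dual_diff[OF y[of n]] subspace_cfun[of Z] P S by simp
      moreover have "\<bar>B N n\<bar> \<le> \<nu> b * (1/2) ^ N" using coord[OF BF] B\<nu> by (rule order_trans)
      ultimately show ?thesis using yP[of n N] by (simp add: algebra_simps)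
    qed
    then have "\<bar>y n S - b n\<bar> \<le> 0"
      using LIMSEQ_le_const[OF half0] by blast
    then show ?thesis by simp
  qed
  moreover have "\<bar>S z\<bar> \<le> 2 * C * \<nu> b" for z
    using err[of 0 z] by (simp add: P_def D_def)
  ultimately show ?thesis using S that by blast
qed

definition tail :: "nat \<Rightarrow> (nat \<Rightarrow> real) \<Rightarrow> nat \<Rightarrow> real" where
  "tail N b = (\<lambda>n. if n < N then 0 else b n)"

text \<open>Any function \<open>f\<close> differs from \<open>\<Sum>n<N. y n f * e n\<close> by an element of the common kernel plus a function
lifting the tail of \<open>(y n f)\<close>. That lift is small in the sup norm, hence each functional is small at
it.\<close>

theorem basic_sequence_of_quotient:
  assumes y: "\<And>n. y n \<in> dual (Ck Z)" and C: "C \<ge> 0"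
    and coord: "\<And>b n. b \<in> F \<Longrightarrow> \<bar>b n\<bar> \<le> \<nu> b"
    and almost: "\<And>b. b \<in> F \<Longrightarrow> \<exists>h\<in>cfun Z. (\<forall>z. \<bar>h z\<bar> \<le> C * \<nu> b) \<and>
        (\<lambda>n. b n - y n h) \<in> F \<and> \<nu> (\<lambda>n. b n - y n h) \<le> \<nu> b / 2"
    and range: "\<And>f. f \<in> cfun Z \<Longrightarrow> (\<lambda>n. y n f) \<in> F"
    and tail: "\<And>b N. b \<in> F \<Longrightarrow> tail N b \<in> F" "\<And>b. b \<in> F \<Longrightarrow> (\<lambda>N. \<nu> (tail N b)) \<longlonglongrightarrow> 0"
    and unit: "\<And>n. (\<lambda>m. if m = n then 1 else 0) \<in> F"
  shows "basic_sequence (weak_star (Ck Z)) y"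
proof -
  note lift = almost_open_lifting[OF y C coord almost]
  have "\<exists>h\<in>cfun Z. \<forall>m. y m h = (if m = n then 1 else 0)" for n
    using lift[OF _ _ unit[of n]] by metis
  then obtain e where e: "\<And>n. e n \<in> cfun Z" "\<And>m n. y m (e n) = (if m = n then 1 else 0)"
    by metis
  show ?thesis
  proof (rule weak_star_basic_sequence[of _ y e])
    fix \<mu> f assume \<mu>: "\<mu> \<in> dual (Ck Z)" and f: "f \<in> topspace (Ck Z)"
      and kill: "\<And>g. g \<in> topspace (Ck Z) \<Longrightarrow> (\<And>n. y n g = 0) \<Longrightarrow> \<mu> g = 0"
    obtain K M where M: "compactin Z K" "M \<ge> 0"
      "\<forall>f\<in>cfun Z. \<forall>c\<ge>0. (\<forall>z\<in>K. \<bar>f z\<bar> \<le> c) \<longrightarrow> \<bar>\<mu> f\<bar> \<le> M * c"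
      using dual_Ck_bound[OF \<mu>] by (elim exE conjE)
    define t where "t N = tail N (\<lambda>n. y n f)" for N
    have tF: "t N \<in> F" and t0: "(\<lambda>N. \<nu> (t N)) \<longlonglongrightarrow> 0" for N
      unfolding t_def using range f tail by auto
    have "\<bar>(\<Sum>n<N. \<mu> (e n) * y n f) - \<mu> f\<bar> \<le> M * (2 * C) * \<nu> (t N)" for N
    proof -
      obtain h where h: "h \<in> cfun Z" "\<And>z. \<bar>h z\<bar> \<le> 2 * C * \<nu> (t N)" "\<And>n. y n h = t N n"
        using lift[OF _ _ tF] by metis
      define P where "P = (\<Sum>n<N. y n f *\<^sub>R e n)"
      have P: "P \<in> cfun Z"
        unfolding P_def using e(1) by (intro subspace_sum subspace_scale subspace_cfun)
      have f': "f \<in> cfun Z" using f by simp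
      have fP: "f - P \<in> cfun Z" by (rule subspace_diff[OF subspace_cfun f' P])
      have ev: "\<phi> ((f - P) - h) = \<phi> f - (\<Sum>n<N. y n f * \<phi> (e n)) - \<phi> h" if "\<phi> \<in> dual (Ck Z)" for \<phi>
        using dual_diff[OF that, of "f - P" h] dual_diff[OF that, of f P] subspace_cfun[of Z] f' P fP h(1)
          dual_sum[OF that, of "{..<N}" e "\<lambda>n. y n f"] e(1) by (simp add: P_def)
      have "y m ((f - P) - h) = 0" for m
      proof -
        have "(\<Sum>n<N. y n f * y m (e n)) = (\<Sum>n<N. if n = m then y n f else 0)"
          by (intro sum.cong) (auto simp: e)
        also have "\<dots> = (if m < N then y m f else 0)" by simp
        finally show ?thesis unfolding ev[OF y] h(3) by (simp add: t_def tail_def)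
      qed
      then have "\<mu> ((f - P) - h) = 0"
        using subspace_diff[OF subspace_cfun fP h(1)] by (intro kill) simp_all
      then have "\<mu> f - (\<Sum>n<N. y n f * \<mu> (e n)) = \<mu> h" unfolding ev[OF \<mu>] by simp
      moreover have "\<bar>\<mu> h\<bar> \<le> M * (2 * C * \<nu> (t N))"
        using h(2) order_trans[OF abs_ge_zero h(2)] by (intro M(3)[rule_format] h(1))
      ultimately show ?thesis by (simp add: mult_ac abs_minus_commute)
    qed
    moreover have "(\<lambda>N. M * (2 * C) * \<nu> (t N)) \<longlonglongrightarrow> 0"
      by (rule tendsto_mult_right_zero[OF t0])
    ultimately have "(\<lambda>N. (\<Sum>n<N. \<mu> (e n) * y n f) - \<mu> f) \<longlonglongrightarrow> 0"
      unfolding real_norm_def[symmetric] by (rule Lim_null_comparison[OF always_eventually[OF allI]])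
    then show "(\<lambda>N. \<Sum>n<N. \<mu> (e n) * y n f) \<longlonglongrightarrow> \<mu> f" by (rule LIM_zero_cancel)
  qed (simp_all only: topspace_Ck subspace_cfun y e)
qed

section \<open>Finitely supported functionals and null sequences\<close>

definition point_functional :: "'a topology \<Rightarrow> 'a set \<Rightarrow> ('a \<Rightarrow> real) \<Rightarrow> ('a \<Rightarrow> real) \<Rightarrow> real" where
  "point_functional Z S a = (\<Sum>z\<in>S. a z *\<^sub>R dirac Z z)"

lemma point_functional_apply:
  "f \<in> cfun Z \<Longrightarrow> point_functional Z S a f = (\<Sum>z\<in>S. a z * f z)"
  unfolding point_functional_def sum_scaleR_fun_apply by (simp add: dirac_def)

lemma point_functional_in_dual:
  assumes "S \<subseteq> topspace Z"
  shows "point_functional Z S a \<in> dual (Ck Z)"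
  unfolding point_functional_def
  by (rule subspace_sum[OF subspace_dual], rule subspace_scale[OF subspace_dual], rule dirac_in_dual)
    (rule subsetD[OF assms])

text \<open>The next index may depend on the finitely many indices already chosen, and the condition imposed at a stage
holds for all later indices as well.\<close>

lemma subsequence_selection:
  fixes P :: "nat list \<Rightarrow> nat \<Rightarrow> bool"
  assumes "\<And>xs. \<exists>k0. \<forall>k\<ge>k0. P xs k"
  obtains r where "strict_mono r" "\<And>n k. r n \<le> k \<Longrightarrow> P (map r [0..<n]) k"
proof -
  have "\<forall>xs. \<exists>k0. \<forall>k\<ge>k0. P xs k" using assms by (rule allI)
  from choice[OF this] obtain g where g: "\<forall>xs. \<forall>k\<ge>g xs. P xs k" by (elim exE)
  define nxt where "nxt xs = max (g xs) (if xs = [] then 0 else Suc (last xs))" for xs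
  define L where "L = rec_nat [] (\<lambda>_ xs. xs @ [nxt xs])"
  have L0: "L 0 = []" and LS: "\<And>n. L (Suc n) = L n @ [nxt (L n)]" by (simp_all add: L_def)
  define r where "r n = nxt (L n)" for n
  have L: "L n = map r [0..<n]" for n
    by (induction n) (simp_all add: L0 LS r_def)
  have "r n < r (Suc n)" for n
  proof -
    have "last (L (Suc n)) = r n" "L (Suc n) \<noteq> []" by (simp_all add: LS r_def)
    then have "Suc (r n) \<le> nxt (L (Suc n))" unfolding nxt_def by simp
    then show ?thesis by (simp add: r_def[of "Suc n"])
  qed
  then have "strict_mono r" by (simp add: strict_mono_Suc_iff)
  moreover have "P (map r [0..<n]) k" if "r n \<le> k" for n k
  proof -
    have "g (L n) \<le> k" using that by (simp add: r_def nxt_def)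
    then show ?thesis using g by (simp add: L)
  qed
  ultimately show ?thesis by (rule that)
qed

definition supnorm_seq :: "(nat \<Rightarrow> real) \<Rightarrow> real" where
  "supnorm_seq b = (SUP n. \<bar>b n\<bar>)"

lemma supnorm_seq_upper:
  assumes "b \<longlonglongrightarrow> 0"
  shows "\<bar>b n\<bar> \<le> supnorm_seq b"
proof -
  have "Bseq b" using assms by (rule convergent_imp_Bseq[OF convergentI])
  then obtain K where "\<And>n. \<bar>b n\<bar> \<le> K" unfolding Bseq_def by auto
  then have "bdd_above (range (\<lambda>n. \<bar>b n\<bar>))" by (rule bdd_aboveI2)
  then show ?thesis unfolding supnorm_seq_def by (intro cSUP_upper) simp_all
qed

lemma supnorm_seq_least: "(\<And>n. \<bar>b n\<bar> \<le> c) \<Longrightarrow> supnorm_seq b \<le> c"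
  unfolding supnorm_seq_def by (rule cSUP_least) simp_all

lemma tail_c0:
  assumes "b \<longlonglongrightarrow> 0"
  shows "tail N b \<longlonglongrightarrow> 0" and "(\<lambda>N. supnorm_seq (tail N b)) \<longlonglongrightarrow> 0"
proof -
  show t: "tail N b \<longlonglongrightarrow> 0" for N
  proof (rule Lim_transform_eventually[OF assms])
    show "\<forall>\<^sub>F n in sequentially. b n = tail N b n"
      by (rule eventually_sequentiallyI[of N]) (simp add: tail_def)
  qed
  show "(\<lambda>N. supnorm_seq (tail N b)) \<longlonglongrightarrow> 0"
  proof (rule LIMSEQ_I)
    fix e :: real assume e: "0 < e"
    then obtain N0 where N0: "\<And>n. N0 \<le> n \<Longrightarrow> \<bar>b n\<bar> < e/2"
      using LIMSEQ_D[OF assms, of "e/2"] by auto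
    have "norm (supnorm_seq (tail N b) - 0) < e" if N: "N0 \<le> N" for N
    proof -
      have "supnorm_seq (tail N b) \<le> e/2"
      proof (rule supnorm_seq_least)
        show "\<bar>tail N b n\<bar> \<le> e/2" for n
          using N0[of n] N e by (simp add: tail_def less_imp_le)
      qed
      moreover have "0 \<le> supnorm_seq (tail N b)"
        using supnorm_seq_upper[OF t, of N 0] by linarith
      ultimately show ?thesis using e by simp
    qed
    then show "\<exists>no. \<forall>N\<ge>no. norm (supnorm_seq (tail N b) - 0) < e" by blast
  qed
qed

text \<open>For the indices chosen so far, fix functions that take nearly every pattern of prescribed values in \<open>[-1, 1]\<close>
under the corresponding functionals; finitely many patterns suffice. The next functional is chosen almost
to vanish at these functions and to have almost no mass on the previous supports. A null sequence is then
lifted by the function belonging to its rounded initial segment.\<close>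

theorem point_functionals_subsequence_almost_onto_c0:
  fixes a :: "nat \<Rightarrow> 'a \<Rightarrow> real"
  assumes Z: "tychonoff_space Z"
    and S: "\<And>n. finite (S n)" "\<And>n. S n \<subseteq> topspace Z"
    and one: "\<And>n. (\<Sum>z\<in>S n. \<bar>a n z\<bar>) = 1"
    and null: "\<And>f. f \<in> cfun Z \<Longrightarrow> (\<lambda>n. \<Sum>z\<in>S n. a n z * f z) \<longlonglongrightarrow> 0"
    and mass: "\<And>z. (\<lambda>n. if z \<in> S n then \<bar>a n z\<bar> else 0) \<longlonglongrightarrow> 0"
  obtains r where "strict_mono r"
    "\<And>b. b \<longlonglongrightarrow> 0 \<Longrightarrow> \<exists>h\<in>cfun Z. (\<forall>z. \<bar>h z\<bar> \<le> 1 * supnorm_seq b) \<and>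
       (\<lambda>n. b n - point_functional Z (S (r n)) (a (r n)) h) \<longlonglongrightarrow> 0 \<and>
       supnorm_seq (\<lambda>n. b n - point_functional Z (S (r n)) (a (r n)) h) \<le> supnorm_seq b / 2"
proof -
  \<comment> \<open>Rounding to multiples of 1/4 costs at most 1/4. Errors of the functionals below are kept under 1/8, so that
    the total stays below the required 1/2.\<close>
  define G :: "real set" where "G = (\<lambda>j::int. real_of_int j / 4) ` {-4..4}"
  have G1: "\<bar>x\<bar> \<le> 1" if "x \<in> G" for x using that by (auto simp: G_def)
  define grid where "grid x = real_of_int \<lfloor>4 * x\<rfloor> / 4" for x :: real
  have grid: "grid x \<in> G" "\<bar>x - grid x\<bar> \<le> 1/4" if "\<bar>x\<bar> \<le> 1" for x
  proof -
    have "-4 \<le> \<lfloor>4 * x\<rfloor>" "\<lfloor>4 * x\<rfloor> \<le> 4" using that by linarith+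
    then show "grid x \<in> G" by (auto simp: grid_def G_def)
    show "\<bar>x - grid x\<bar> \<le> 1/4" unfolding grid_def by linarith
  qed
  define BL where "BL xs = {bs. set bs \<subseteq> G \<and> length bs = length xs}" for xs :: "nat list"
  have finBL: "finite (BL xs)" for xs
    unfolding BL_def by (rule finite_lists_length_eq) (simp add: G_def)
  have "\<forall>p. \<exists>h. snd p \<in> BL (fst p) \<longrightarrow> h \<in> cfun Z \<and> (\<forall>z. \<bar>h z\<bar> \<le> 1) \<and>
     (\<forall>i<length (fst p). \<forall>z\<in>S (fst p ! i) - (\<Union>j<i. S (fst p ! j)).
        h z = snd p ! i * sgn (a (fst p ! i) z))"
    (is "\<forall>p. \<exists>h. ?R p h")
  proof
    fix p :: "nat list \<times> real list"
    obtain xs bs where p: "p = (xs, bs)" by (cases p)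
    \<comment> \<open>A point in several supports is governed by the first of them.\<close>
    define v where "v z = (let i = LEAST i. i < length xs \<and> z \<in> S (xs ! i) in bs ! i * sgn (a (xs ! i) z))" for z
    have v: "v z = bs ! i * sgn (a (xs ! i) z)"
      if "i < length xs" "z \<in> S (xs ! i) - (\<Union>j<i. S (xs ! j))" for i z
    proof -
      have "(LEAST i. i < length xs \<and> z \<in> S (xs ! i)) = i"
        using that by (intro Least_equality) (auto simp: not_less[symmetric])
      then show ?thesis by (simp add: v_def)
    qed
    show "\<exists>h. ?R p h"
    proof (cases "bs \<in> BL xs")
      case True
      define A where "A = (\<Union>i<length xs. S (xs ! i))"
      have vb: "\<bar>v z\<bar> \<le> 1" if "z \<in> A" for z
      proof -
        define i where "i = (LEAST i. i < length xs \<and> z \<in> S (xs ! i))"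
        have "\<exists>i. i < length xs \<and> z \<in> S (xs ! i)" using that by (auto simp: A_def)
        then have "i < length xs" unfolding i_def by (rule LeastI2_ex) simp
        then have "bs ! i \<in> G" using True by (auto simp: BL_def)
        then have "\<bar>bs ! i\<bar> \<le> 1" by (rule G1)
        moreover have "v z = bs ! i * sgn (a (xs ! i) z)" by (simp add: v_def i_def Let_def)
        ultimately show ?thesis by (simp add: abs_mult sgn_if)
      qed
      obtain h where h: "h \<in> cfun Z" "\<And>z. z \<in> A \<Longrightarrow> h z = v z" "\<And>z. \<bar>h z\<bar> \<le> 1"
        by (rule tychonoff_interpolation[OF Z, of A "{}" v 1]) (use S vb in \<open>auto simp: A_def\<close>)
      have "h z = bs ! i * sgn (a (xs ! i) z)"
        if "i < length xs" "z \<in> S (xs ! i) - (\<Union>j<i. S (xs ! j))" for i z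
        using h(2)[of z] v[OF that] that by (auto simp: A_def)
      then show ?thesis using h(1,3) by (intro exI[of _ h]) (simp add: p)
    qed (simp add: p)
  qed
  from choice[OF this] obtain H0 where H0: "\<forall>p. ?R p (H0 p)" by (elim exE)
  define H where "H xs bs = H0 (xs, bs)" for xs bs
  have H: "H xs bs \<in> cfun Z" "\<bar>H xs bs z\<bar> \<le> 1"
      "i < length xs \<Longrightarrow> z \<in> S (xs ! i) - (\<Union>j<i. S (xs ! j)) \<Longrightarrow> H xs bs z = bs ! i * sgn (a (xs ! i) z)"
    if "bs \<in> BL xs" for xs bs i z
    using H0[rule_format, of "(xs, bs)"] that by (simp_all add: H_def)
  define P where "P xs k \<longleftrightarrow> (\<forall>bs\<in>BL xs. \<bar>\<Sum>z\<in>S k. a k z * H xs bs z\<bar> \<le> 1/8) \<and>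
      (\<Sum>z\<in>S k \<inter> (\<Union>x\<in>set xs. S x). \<bar>a k z\<bar>) \<le> 1/16" for xs k
  have "\<exists>k0. \<forall>k\<ge>k0. P xs k" for xs
  proof -
    have 1: "\<forall>\<^sub>F k in sequentially. \<forall>bs\<in>BL xs. \<bar>\<Sum>z\<in>S k. a k z * H xs bs z\<bar> \<le> 1/8"
    proof (rule eventually_ball_finite[OF finBL], rule ballI)
      fix bs assume "bs \<in> BL xs"
      then have "(\<lambda>k. \<bar>\<Sum>z\<in>S k. a k z * H xs bs z\<bar>) \<longlonglongrightarrow> 0"
        by (intro tendsto_rabs_zero null H(1))
      then have "\<forall>\<^sub>F k in sequentially. \<bar>\<Sum>z\<in>S k. a k z * H xs bs z\<bar> < 1/8"
        by (rule order_tendstoD) simp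
      then show "\<forall>\<^sub>F k in sequentially. \<bar>\<Sum>z\<in>S k. a k z * H xs bs z\<bar> \<le> 1/8"
        by (rule eventually_mono) simp
    qed
    define A where "A = (\<Union>x\<in>set xs. S x)"
    have A: "finite A" using S(1) by (simp add: A_def)
    have "(\<lambda>k. \<Sum>z\<in>A. if z \<in> S k then \<bar>a k z\<bar> else 0) \<longlonglongrightarrow> 0"
      by (intro tendsto_null_sum mass)
    then have "\<forall>\<^sub>F k in sequentially. (\<Sum>z\<in>A. if z \<in> S k then \<bar>a k z\<bar> else 0) < 1/16"
      by (rule order_tendstoD) simp
    moreover have "(\<Sum>z\<in>A. if z \<in> S k then \<bar>a k z\<bar> else 0) = (\<Sum>z\<in>S k \<inter> A. \<bar>a k z\<bar>)" for k
      using A sum.inter_restrict[OF A, of "\<lambda>z. \<bar>a k z\<bar>" "S k"] by (simp add: Int_commute)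
    ultimately have 2: "\<forall>\<^sub>F k in sequentially. (\<Sum>z\<in>S k \<inter> A. \<bar>a k z\<bar>) < 1/16" by simp
    have "\<forall>\<^sub>F k in sequentially. P xs k"
      using 1 2 by eventually_elim (simp add: P_def A_def)
    then show ?thesis by (simp add: eventually_sequentially)
  qed
  then obtain r where r: "strict_mono r" "\<And>n k. r n \<le> k \<Longrightarrow> P (map r [0..<n]) k"
    by (rule subsequence_selection[of P]) (rule that)
  show ?thesis
  proof (rule that[OF r(1)])
    fix b :: "nat \<Rightarrow> real" assume b: "b \<longlonglongrightarrow> 0"
    define s where "s = supnorm_seq b"
    have bs: "\<bar>b n\<bar> \<le> s" for n unfolding s_def by (rule supnorm_seq_upper[OF b])
    have s0: "0 \<le> s" using bs[of 0] by linarith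
    define c where "c n = b n / s" for n
    have bc: "b n = s * c n" for n using bs[of n] by (cases "s = 0") (simp_all add: c_def)
    have c1: "\<bar>c n\<bar> \<le> 1" for n using bs[of n] s0 by (cases "s = 0") (simp_all add: c_def field_simps)
    have "(\<lambda>n. b n / s) \<longlonglongrightarrow> 0" by (rule tendsto_divide_zero[OF b])
    then have "c \<longlonglongrightarrow> 0" by (simp add: c_def[abs_def])
    then obtain N where N: "\<And>n. N \<le> n \<Longrightarrow> \<bar>c n\<bar> < 1/4"
      using LIMSEQ_D[of c 0 "1/4"] by auto
    define xs where "xs = map r [0..<N]"
    define gs where "gs = map (\<lambda>n. grid (c n)) [0..<N]"
    have gs: "gs \<in> BL xs" using grid(1)[OF c1] by (auto simp: BL_def gs_def xs_def)
    define k where "k = H xs gs"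
    have k: "k \<in> cfun Z" "\<And>z. \<bar>k z\<bar> \<le> 1" unfolding k_def by (rule H[OF gs])+
    define y where "y n = (\<Sum>z\<in>S (r n). a (r n) z * k z)" for n
    have err: "\<bar>c n - y n\<bar> \<le> 1/2" for n
    proof (cases "n < N")
      case False
      then have "r N \<le> r n" using r(1) by (simp add: strict_mono_less_eq)
      then have "P xs (r n)" unfolding xs_def by (rule r(2))
      then have "\<bar>y n\<bar> \<le> 1/8" using gs by (simp add: P_def y_def k_def)
      then show ?thesis using N[of n] False by linarith
    next
      case True
      define A where "A = (\<Union>x\<in>set (map r [0..<n]). S x)"
      define m where "m = (\<Sum>z\<in>S (r n) \<inter> A. \<bar>a (r n) z\<bar>)"
      define g where "g = grid (c n)"
      have g: "\<bar>g\<bar> \<le> 1" "\<bar>c n - g\<bar> \<le> 1/4" using grid[OF c1, of n] G1 by (simp_all add: g_def)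
      have "P (map r [0..<n]) (r n)" by (rule r(2)) simp
      then have m: "m \<le> 1/16" by (simp add: P_def m_def A_def)
      have m0: "0 \<le> m" unfolding m_def by (rule sum_nonneg) simp
      have Sn: "finite (S (r n))" by (rule S(1))
      have split: "(\<Sum>z\<in>S (r n). q z) = (\<Sum>z\<in>S (r n) - A. q z) + (\<Sum>z\<in>S (r n) \<inter> A. q z)" for q :: "'a \<Rightarrow> real"
        using sum.Int_Diff[OF Sn, of q A] by linarith
      have kz: "k z = g * sgn (a (r n) z)" if "z \<in> S (r n) - A" for z
      proof -
        have "z \<in> S (xs ! n) - (\<Union>j<n. S (xs ! j))" "n < length xs" "xs ! n = r n" "gs ! n = g"
          using that True by (auto simp: xs_def A_def gs_def g_def)
        then show ?thesis using H(3)[OF gs, of n z] by (simp add: k_def)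
      qed
      have "(\<Sum>z\<in>S (r n) - A. a (r n) z * k z) = (\<Sum>z\<in>S (r n) - A. g * \<bar>a (r n) z\<bar>)"
        by (rule sum.cong) (simp_all add: kz sgn_if)
      also have "\<dots> = g * (1 - m)"
        using split[of "\<lambda>z. \<bar>a (r n) z\<bar>"] one[of "r n"] by (simp add: m_def sum_distrib_left[symmetric])
      finally have 1: "(\<Sum>z\<in>S (r n) - A. a (r n) z * k z) = g * (1 - m)" .
      have "\<bar>\<Sum>z\<in>S (r n) \<inter> A. a (r n) z * k z\<bar> \<le> m"
        unfolding m_def
      proof (rule order_trans[OF sum_abs], rule sum_mono)
        show "\<bar>a (r n) z * k z\<bar> \<le> \<bar>a (r n) z\<bar>" for z
          using mult_left_mono[OF k(2)[of z], of "\<bar>a (r n) z\<bar>"] by (simp add: abs_mult)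
      qed
      moreover have "\<bar>g * m\<bar> \<le> m"
        using mult_right_mono[OF g(1) m0] m0 by (simp add: abs_mult)
      moreover have "y n = g - g * m + (\<Sum>z\<in>S (r n) \<inter> A. a (r n) z * k z)"
        unfolding y_def split 1 by (simp add: algebra_simps)
      ultimately show ?thesis using g(2) m by linarith
    qed
    define h where "h = (\<lambda>z. s * k z)"
    have h: "h \<in> cfun Z" unfolding h_def by (rule cfun_lambda_intros(4)[OF k(1)])
    have hz: "\<bar>h z\<bar> \<le> s" for z
      using mult_left_mono[OF k(2)[of z] s0] s0 by (simp add: h_def abs_mult)
    have yh: "point_functional Z (S (r n)) (a (r n)) h = s * y n" for n
      unfolding point_functional_apply[OF h] by (simp add: h_def y_def sum_distrib_left mult_ac)
    have "(\<lambda>n. b n - point_functional Z (S (r n)) (a (r n)) h) \<longlonglongrightarrow> 0 - 0"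
      unfolding point_functional_apply[OF h]
      using LIMSEQ_subseq_LIMSEQ[OF null[OF h] r(1)] by (intro tendsto_diff b) (simp add: o_def)
    moreover have "supnorm_seq (\<lambda>n. b n - point_functional Z (S (r n)) (a (r n)) h) \<le> s / 2"
    proof (rule supnorm_seq_least)
      fix n
      have "b n - point_functional Z (S (r n)) (a (r n)) h = s * (c n - y n)"
        unfolding yh bc[of n] by (simp add: right_diff_distrib)
      then show "\<bar>b n - point_functional Z (S (r n)) (a (r n)) h\<bar> \<le> s / 2"
        using mult_left_mono[OF err[of n] s0] s0 by (simp add: abs_mult)
    qed
    ultimately show "\<exists>h\<in>cfun Z. (\<forall>z. \<bar>h z\<bar> \<le> 1 * supnorm_seq b) \<and>
       (\<lambda>n. b n - point_functional Z (S (r n)) (a (r n)) h) \<longlonglongrightarrow> 0 \<and>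
       supnorm_seq (\<lambda>n. b n - point_functional Z (S (r n)) (a (r n)) h) \<le> supnorm_seq b / 2"
      using h hz by (intro bexI[of _ h]) (simp_all add: s_def)
  qed
qed

theorem point_functionals_subsequence:
  fixes a :: "nat \<Rightarrow> 'a \<Rightarrow> real"
  assumes Z: "tychonoff_space Z"
    and S: "\<And>n. finite (S n)" "\<And>n. S n \<subseteq> topspace Z"
    and one: "\<And>n. (\<Sum>z\<in>S n. \<bar>a n z\<bar>) = 1"
    and null: "\<And>f. f \<in> cfun Z \<Longrightarrow> (\<lambda>n. \<Sum>z\<in>S n. a n z * f z) \<longlonglongrightarrow> 0"
    and mass: "\<And>z. (\<lambda>n. if z \<in> S n then \<bar>a n z\<bar> else 0) \<longlonglongrightarrow> 0"
  obtains r where "strict_mono r"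
    "basic_sequence (weak_star (Ck Z)) (\<lambda>n. point_functional Z (S (r n)) (a (r n)))"
    "\<And>b. b \<longlonglongrightarrow> 0 \<Longrightarrow> \<exists>h\<in>cfun Z. (\<forall>z. \<bar>h z\<bar> \<le> 2 * supnorm_seq b) \<and>
       (\<forall>n. point_functional Z (S (r n)) (a (r n)) h = b n)"
proof -
  obtain r where r: "strict_mono r" "\<And>b. b \<longlonglongrightarrow> 0 \<Longrightarrow> \<exists>h\<in>cfun Z. (\<forall>z. \<bar>h z\<bar> \<le> 1 * supnorm_seq b) \<and>
       (\<lambda>n. b n - point_functional Z (S (r n)) (a (r n)) h) \<longlonglongrightarrow> 0 \<and>
       supnorm_seq (\<lambda>n. b n - point_functional Z (S (r n)) (a (r n)) h) \<le> supnorm_seq b / 2"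
    using point_functionals_subsequence_almost_onto_c0[OF assms] by blast
  define y where "y n = point_functional Z (S (r n)) (a (r n))" for n
  have y: "y n \<in> dual (Ck Z)" for n unfolding y_def by (rule point_functional_in_dual[OF S(2)])
  define F where "F = {b::nat \<Rightarrow> real. b \<longlonglongrightarrow> 0}"
  have almost: "\<exists>h\<in>cfun Z. (\<forall>z. \<bar>h z\<bar> \<le> 1 * supnorm_seq b) \<and>
        (\<lambda>n. b n - y n h) \<in> F \<and> supnorm_seq (\<lambda>n. b n - y n h) \<le> supnorm_seq b / 2" if "b \<in> F" for b
    using r(2)[of b] that unfolding F_def y_def mem_Collect_eq by blast
  have coord: "\<bar>b n\<bar> \<le> supnorm_seq b" if "b \<in> F" for b n
    using that supnorm_seq_upper by (simp add: F_def)
  have "basic_sequence (weak_star (Ck Z)) y"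
  proof (rule basic_sequence_of_quotient[where F = F and \<nu> = supnorm_seq and C = 1])
    show "y n \<in> dual (Ck Z)" for n by (rule y)
    show "(\<lambda>n. y n f) \<in> F" if f: "f \<in> cfun Z" for f
      unfolding F_def mem_Collect_eq y_def point_functional_apply[OF f]
      using LIMSEQ_subseq_LIMSEQ[OF null[OF f] r(1)] by (simp add: o_def)
    show "tail N b \<in> F" "(\<lambda>N. supnorm_seq (tail N b)) \<longlonglongrightarrow> 0" if "b \<in> F" for b N
      using that tail_c0[of b] by (simp_all add: F_def)
    show "(\<lambda>m. if m = n then 1 else 0) \<in> F" for n
      unfolding F_def mem_Collect_eq
      by (rule tendsto_eventually, rule eventually_sequentiallyI[of "Suc n"]) simp
  qed (use almost coord in simp_all)
  moreover have "\<exists>h\<in>cfun Z. (\<forall>z. \<bar>h z\<bar> \<le> 2 * supnorm_seq b) \<and> (\<forall>n. y n h = b n)"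
    if b: "b \<longlonglongrightarrow> 0" for b
  proof -
    have bF: "b \<in> F" using b by (simp add: F_def)
    obtain h where "h \<in> cfun Z" "\<And>z. \<bar>h z\<bar> \<le> 2 * 1 * supnorm_seq b" "\<And>n. y n h = b n"
      using almost_open_lifting[of y Z 1 F supnorm_seq b, OF y zero_le_one coord almost bF] by metis
    then show ?thesis by auto
  qed
  ultimately show ?thesis using r(1) by (intro that[of r]) (simp_all add: y_def[abs_def])
qed

section \<open>Moments of sign sums and generalised limits\<close>

text \<open>Splitting off one sign; this is the induction step for moments of sums of independent signs.\<close>

lemma sum_signs_insert:
  fixes g :: "('i \<Rightarrow> real) \<Rightarrow> real"
  assumes "j \<notin> A"
  shows "(\<Sum>\<epsilon>\<in>insert j A \<rightarrow>\<^sub>E {-1, 1}. g \<epsilon>) =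
    (\<Sum>\<epsilon>\<in>A \<rightarrow>\<^sub>E {-1, 1}. g (\<epsilon>(j := -1)) + g (\<epsilon>(j := 1)))"
proof -
  have "(\<Sum>\<epsilon>\<in>insert j A \<rightarrow>\<^sub>E {-1, 1}. g \<epsilon>) =
      (\<Sum>p\<in>{-1, 1::real} \<times> (A \<rightarrow>\<^sub>E {-1, 1}). g ((\<lambda>(y, f). f(j := y)) p))"
    unfolding PiE_insert_eq by (rule sum.reindex_cong[OF inj_combinator[OF assms] refl refl])
  also have "\<dots> = (\<Sum>v\<in>{-1, 1::real}. \<Sum>\<epsilon>\<in>A \<rightarrow>\<^sub>E {-1, 1}. g (\<epsilon>(j := v)))"
    by (simp add: sum.cartesian_product case_prod_unfold)
  also have "\<dots> = (\<Sum>\<epsilon>\<in>A \<rightarrow>\<^sub>E {-1, 1}. g (\<epsilon>(j := -1)) + g (\<epsilon>(j := 1)))"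
    by (simp add: sum.distrib)
  finally show ?thesis .
qed

lemma card_signs: "finite A \<Longrightarrow> card (A \<rightarrow>\<^sub>E {-1, 1::real}) = 2 ^ card A"
  by (simp add: card_PiE numeral_2_eq_2)

lemma sum_fun_upd_outside: "j \<notin> A \<Longrightarrow> (\<Sum>i\<in>A. (\<epsilon>(j := v)) i * b i) = (\<Sum>i\<in>A. \<epsilon> i * b i)"
  for \<epsilon> b :: "'i \<Rightarrow> real"
  by (rule sum.cong) auto

lemma second_moment:
  fixes b :: "'i \<Rightarrow> real"
  assumes "finite A"
  shows "(\<Sum>\<epsilon>\<in>A \<rightarrow>\<^sub>E {-1, 1}. (\<Sum>i\<in>A. \<epsilon> i * b i)\<^sup>2) = 2 ^ card A * (\<Sum>i\<in>A. (b i)\<^sup>2)"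
  using assms
proof (induction A rule: finite_induct)
  case (insert j A)
  have "(\<Sum>\<epsilon>\<in>insert j A \<rightarrow>\<^sub>E {-1, 1}. (\<Sum>i\<in>insert j A. \<epsilon> i * b i)\<^sup>2) =
      (\<Sum>\<epsilon>\<in>A \<rightarrow>\<^sub>E {-1, 1}. (- b j + (\<Sum>i\<in>A. \<epsilon> i * b i))\<^sup>2 + (b j + (\<Sum>i\<in>A. \<epsilon> i * b i))\<^sup>2)"
    unfolding sum_signs_insert[OF insert(2)] sum.insert[OF insert(1,2)] sum_fun_upd_outside[OF insert(2)] by simp
  also have "\<dots> = (\<Sum>\<epsilon>\<in>A \<rightarrow>\<^sub>E {-1, 1}. 2 * (b j)\<^sup>2 + 2 * (\<Sum>i\<in>A. \<epsilon> i * b i)\<^sup>2)"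
    by (rule sum.cong) (simp_all add: power2_eq_square algebra_simps)
  also have "\<dots> = 2 ^ card A * (2 * (b j)\<^sup>2) + 2 * (2 ^ card A * (\<Sum>i\<in>A. (b i)\<^sup>2))"
    using insert(1) by (simp add: sum.distrib sum_distrib_left[symmetric] insert.IH card_signs)
  finally show ?case using insert(1,2) by (simp add: algebra_simps)
qed simp

text \<open>The case of exponent four in Khinchine's inequality, for unnormalised sums over all sign patterns.\<close>

lemma fourth_moment:
  fixes b :: "'i \<Rightarrow> real"
  assumes "finite A"
  shows "(\<Sum>\<epsilon>\<in>A \<rightarrow>\<^sub>E {-1, 1}. (\<Sum>i\<in>A. \<epsilon> i * b i) ^ 4) \<le> 2 ^ card A * (3 * (\<Sum>i\<in>A. (b i)\<^sup>2)\<^sup>2)"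
  using assms
proof (induction A rule: finite_induct)
  case (insert j A)
  let ?s = "\<Sum>i\<in>A. (b i)\<^sup>2"
  have id: "(- u + v) ^ 4 + (u + v) ^ 4 = 2 * v ^ 4 + 12 * u\<^sup>2 * v\<^sup>2 + 2 * u ^ 4" for u v :: real
    by (simp add: eval_nat_numeral algebra_simps)
  have "(\<Sum>\<epsilon>\<in>insert j A \<rightarrow>\<^sub>E {-1, 1}. (\<Sum>i\<in>insert j A. \<epsilon> i * b i) ^ 4) =
      (\<Sum>\<epsilon>\<in>A \<rightarrow>\<^sub>E {-1, 1}. (- b j + (\<Sum>i\<in>A. \<epsilon> i * b i)) ^ 4 + (b j + (\<Sum>i\<in>A. \<epsilon> i * b i)) ^ 4)"
    unfolding sum_signs_insert[OF insert(2)] sum.insert[OF insert(1,2)] sum_fun_upd_outside[OF insert(2)] by simp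
  also have "\<dots> = 2 * (\<Sum>\<epsilon>\<in>A \<rightarrow>\<^sub>E {-1, 1}. (\<Sum>i\<in>A. \<epsilon> i * b i) ^ 4) +
      12 * (b j)\<^sup>2 * (\<Sum>\<epsilon>\<in>A \<rightarrow>\<^sub>E {-1, 1}. (\<Sum>i\<in>A. \<epsilon> i * b i)\<^sup>2) + 2 ^ card A * (2 * b j ^ 4)"
    unfolding id using insert(1) by (simp add: sum.distrib sum_distrib_left[symmetric] card_signs)
  also have "\<dots> \<le> 2 * (2 ^ card A * (3 * ?s\<^sup>2)) + 12 * (b j)\<^sup>2 * (2 ^ card A * ?s) + 2 ^ card A * (2 * b j ^ 4)"
    using insert.IH by (simp add: second_moment[OF insert(1)])
  also have "\<dots> = 2 ^ card A * (2 * (3 * ?s\<^sup>2 + 6 * (b j)\<^sup>2 * ?s + b j ^ 4))"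
    by (simp add: algebra_simps)
  also have "\<dots> \<le> 2 ^ card A * (2 * (3 * (?s + (b j)\<^sup>2)\<^sup>2))"
  proof -
    have "(?s + (b j)\<^sup>2)\<^sup>2 = ?s\<^sup>2 + 2 * (b j)\<^sup>2 * ?s + b j ^ 4"
      by (simp add: power2_eq_square eval_nat_numeral algebra_simps)
    then show ?thesis by (intro mult_left_mono) simp_all
  qed
  finally show ?case using insert(1,2) by (simp add: algebra_simps)
qed simp

text \<open>A cluster point of the sequence of evaluations at \<open>m\<close> in the compact product of the
intervals \<open>[- B s, B s]\<close> over all bounded sequences \<open>s\<close>. The approximation property carries over all linear and order
relations between finitely many sequences, as the next lemma records.\<close>

lemma generalised_limit:
  obtains L :: "(nat \<Rightarrow> real) \<Rightarrow> real" where
    "\<And>I e k. finite I \<Longrightarrow> (\<And>s. s \<in> I \<Longrightarrow> Bseq s) \<Longrightarrow> e > 0 \<Longrightarrow> \<exists>m\<ge>k. \<forall>s\<in>I. \<bar>s m - L s\<bar> < e"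
proof -
  define J where "J = {s :: nat \<Rightarrow> real. Bseq s}"
  have "\<forall>s. \<exists>B. s \<in> J \<longrightarrow> (\<forall>m. \<bar>s m\<bar> \<le> B)" by (auto simp: J_def Bseq_def)
  from choice[OF this] obtain B where B: "\<forall>s. s \<in> J \<longrightarrow> (\<forall>m. \<bar>s m\<bar> \<le> B s)" by (elim exE)
  define T where "T = product_topology (\<lambda>s. top_of_set {- B s..B s}) J"
  have cT: "compact_space T"
    unfolding T_def by (simp add: compact_space_product_topology compact_space_subtopology)
  define x where "x m = restrict (\<lambda>s. s m) J" for m :: nat
  have xT: "x m \<in> topspace T" for m
    using B by (auto simp: T_def x_def abs_le_iff minus_le_iff)
  define C where "C k = T closure_of (x ` {k..})" for k
  have "(\<Inter>k. C k) \<noteq> {}"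
  proof (rule compact_space_imp_nest[OF cT])
    show "closedin T (C k)" for k by (simp add: C_def)
    show "C k \<noteq> {}" for k
      using closure_of_subset[of "x ` {k..}" T] xT by (fastforce simp: C_def)
    show "decseq C" unfolding C_def by (intro decseq_SucI closure_of_mono image_mono) auto
  qed
  then obtain L where L: "\<And>k. L \<in> C k" by blast
  show ?thesis
  proof (rule that[of L])
    fix I :: "(nat \<Rightarrow> real) set" and e :: real and k
    assume I: "finite I" "\<And>s. s \<in> I \<Longrightarrow> Bseq s" and e: "e > 0"
    have IJ: "I \<subseteq> J" using I(2) by (auto simp: J_def)
    have LT: "L \<in> topspace T" using L[of 0] closure_of_subset_topspace by (fastforce simp: C_def)
    define U where "U = {f \<in> topspace T. \<forall>s\<in>I. f s \<in> ball (L s) e}"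
    have "openin T {f \<in> topspace T. f s \<in> ball (L s) e}" if "s \<in> I" for s
    proof (rule openin_continuous_map_preimage)
      have "continuous_map T (top_of_set {- B s..B s}) (\<lambda>f. f s)"
        unfolding T_def using that IJ by (intro continuous_map_product_projection) auto
      then show "continuous_map T euclideanreal (\<lambda>f. f s)"
        by (rule continuous_map_into_fulltopology)
    qed simp
    then have "openin T ((\<Inter>s\<in>I. {f \<in> topspace T. f s \<in> ball (L s) e}) \<inter> topspace T)"
      by (rule openin_INT[OF I(1)])
    moreover have "(\<Inter>s\<in>I. {f \<in> topspace T. f s \<in> ball (L s) e}) \<inter> topspace T = U"
      by (auto simp: U_def)
    ultimately have "openin T U" by simp
    moreover have "L \<in> U" using LT e by (simp add: U_def)
    ultimately obtain f where "f \<in> x ` {k..}" "f \<in> U"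
      using L[of k] by (auto simp: C_def in_closure_of)
    then obtain m where "m \<ge> k" "x m \<in> U" by auto
    then show "\<exists>m\<ge>k. \<forall>s\<in>I. \<bar>s m - L s\<bar> < e"
    proof (intro exI[of _ m] conjI ballI)
      fix s assume s: "s \<in> I"
      then have "x m s \<in> ball (L s) e" "s \<in> J" using \<open>x m \<in> U\<close> IJ by (auto simp: U_def)
      then show "\<bar>s m - L s\<bar> < e" by (simp add: x_def dist_real_def abs_minus_commute)
    qed
  qed
qed

lemma generalised_limit_properties:
  fixes L :: "(nat \<Rightarrow> real) \<Rightarrow> real"
  assumes L: "\<And>I e k. finite I \<Longrightarrow> (\<And>s. s \<in> I \<Longrightarrow> Bseq s) \<Longrightarrow> e > 0 \<Longrightarrow> \<exists>m\<ge>k. \<forall>s\<in>I. \<bar>s m - L s\<bar> < e"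
    and B: "Bseq s" "Bseq t" "Bseq u"
  shows "(\<And>m. k \<le> m \<Longrightarrow> u m = s m + t m) \<Longrightarrow> L u = L s + L t"
    and "(\<And>m. k \<le> m \<Longrightarrow> u m = c * s m) \<Longrightarrow> L u = c * L s"
    and "(\<And>m. k \<le> m \<Longrightarrow> u m \<le> s m) \<Longrightarrow> L u \<le> L s"
    and "(\<And>m. k \<le> m \<Longrightarrow> u m \<le> c) \<Longrightarrow> L u \<le> c"
    and "(\<And>m. k \<le> m \<Longrightarrow> c \<le> u m) \<Longrightarrow> c \<le> L u"
proof -
  have near: "\<exists>m\<ge>k. L s - e < s m \<and> s m < L s + e \<and> L t - e < t m \<and> t m < L t + e \<and>
      L u - e < u m \<and> u m < L u + e" if "e > 0" for e
  proof -
    have "\<exists>m\<ge>k. \<forall>v\<in>{s, t, u}. \<bar>v m - L v\<bar> < e" by (rule L) (use B that in auto)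
    then obtain m where m: "m \<ge> k" "\<forall>v\<in>{s, t, u}. \<bar>v m - L v\<bar> < e" by (elim exE conjE)
    have "L v - e < v m \<and> v m < L v + e" if "v \<in> {s, t, u}" for v
      using m(2)[rule_format, OF that] by linarith
    then show ?thesis using m(1) by auto
  qed
  show "L u = L s + L t" if eq: "\<And>m. k \<le> m \<Longrightarrow> u m = s m + t m"
  proof (rule ccontr)
    assume "L u \<noteq> L s + L t"
    then consider "L u < L s + L t" | "L s + L t < L u" by linarith
    then show False
    proof cases
      case 1
      then have "(L s + L t - L u) / 3 > 0" by simp
      from near[OF this] obtain m where m: "k \<le> m" "L s - (L s + L t - L u) / 3 < s m"
        "L t - (L s + L t - L u) / 3 < t m" "u m < L u + (L s + L t - L u) / 3" by blast
      then show False using eq[OF m(1)] by (simp add: field_simps)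
    next
      case 2
      then have "(L u - L s - L t) / 3 > 0" by simp
      from near[OF this] obtain m where m: "k \<le> m" "s m < L s + (L u - L s - L t) / 3"
        "t m < L t + (L u - L s - L t) / 3" "L u - (L u - L s - L t) / 3 < u m" by blast
      then show False using eq[OF m(1)] by (simp add: field_simps)
    qed
  qed
  show "L u = c * L s" if eq: "\<And>m. k \<le> m \<Longrightarrow> u m = c * s m"
  proof (rule ccontr)
    assume "L u \<noteq> c * L s"
    define d where "d = \<bar>L u - c * L s\<bar> / (\<bar>c\<bar> + 1)"
    have p: "\<bar>c\<bar> + 1 > 0" by linarith
    then have "(\<bar>c\<bar> + 1) * d = \<bar>L u - c * L s\<bar>" by (simp add: d_def)
    then have d: "d > 0" "\<bar>L u - c * L s\<bar> = \<bar>c\<bar> * d + d"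
      using \<open>L u \<noteq> c * L s\<close> p by (simp add: d_def, simp add: distrib_right)
    from near[OF d(1)] obtain m where m: "k \<le> m" "L s - d < s m" "s m < L s + d"
      "L u - d < u m" "u m < L u + d" by blast
    have "\<bar>c * (s m - L s)\<bar> \<le> \<bar>c\<bar> * d"
      unfolding abs_mult using m(2,3) by (intro mult_left_mono) linarith+
    then have "\<bar>c * s m - c * L s\<bar> \<le> \<bar>c\<bar> * d" by (simp add: right_diff_distrib)
    then show False using eq[OF m(1)] m(4,5) d(2) by linarith
  qed
  show "L u \<le> L s" if le: "\<And>m. k \<le> m \<Longrightarrow> u m \<le> s m"
  proof (rule ccontr)
    assume "\<not> L u \<le> L s"
    then have "(L u - L s) / 2 > 0" by simp
    from near[OF this] obtain m where m: "k \<le> m" "s m < L s + (L u - L s) / 2"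
      "L u - (L u - L s) / 2 < u m" by blast
    then show False using le[OF m(1)] by (simp add: field_simps)
  qed
  show "L u \<le> c" if le: "\<And>m. k \<le> m \<Longrightarrow> u m \<le> c"
  proof (rule ccontr)
    assume "\<not> L u \<le> c"
    then have "L u - c > 0" by simp
    from near[OF this] obtain m where m: "k \<le> m" "L u - (L u - c) < u m" by blast
    then show False using le[OF m(1)] by linarith
  qed
  show "c \<le> L u" if le: "\<And>m. k \<le> m \<Longrightarrow> c \<le> u m"
  proof (rule ccontr)
    assume "\<not> c \<le> L u"
    then have "c - L u > 0" by simp
    from near[OF this] obtain m where m: "k \<le> m" "u m < L u + (c - L u)" by blast
    then show False using le[OF m(1)] by linarith
  qed
qed

section \<open>Rademacher functionals and square-summable sequences\<close>

definition l2norm :: "(nat \<Rightarrow> real) \<Rightarrow> real" where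
  "l2norm b = sqrt (\<Sum>n. (b n)\<^sup>2)"

text \<open>Bessel's inequality shows that the coefficients \<open>\<Lambda> (f * r n)\<close> are square-summable. To lift a sequence \<open>b\<close>,
truncate \<open>G = (\<Sum>n<N. b n * r n)\<close> at a multiple of the norm of \<open>b\<close>: the fourth moment bounds the
quadratic mean of the part cut off, hence by Bessel's inequality its coefficients.\<close>

theorem rademacher_basic_sequence:
  fixes \<Lambda> :: "('a \<Rightarrow> real) \<Rightarrow> real" and r :: "nat \<Rightarrow> 'a \<Rightarrow> real"
  assumes K: "compactin Z K" and r: "\<And>n. r n \<in> cfun Z" "\<And>n z. \<bar>r n z\<bar> \<le> 1"
    and add: "\<And>f g. f \<in> cfun Z \<Longrightarrow> g \<in> cfun Z \<Longrightarrow> \<Lambda> (\<lambda>z. f z + g z) = \<Lambda> f + \<Lambda> g"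
    and scale: "\<And>f c. f \<in> cfun Z \<Longrightarrow> \<Lambda> (\<lambda>z. c * f z) = c * \<Lambda> f"
    and le: "\<And>f g. f \<in> cfun Z \<Longrightarrow> g \<in> cfun Z \<Longrightarrow> (\<And>z. z \<in> K \<Longrightarrow> f z \<le> g z) \<Longrightarrow> \<Lambda> f \<le> \<Lambda> g"
    and bound: "\<And>f c. f \<in> cfun Z \<Longrightarrow> (\<And>z. z \<in> K \<Longrightarrow> \<bar>f z\<bar> \<le> c) \<Longrightarrow> \<bar>\<Lambda> f\<bar> \<le> c"
    and second: "\<And>b N. \<Lambda> (\<lambda>z. (\<Sum>n<N. b n * r n z) * (\<Sum>n<N. b n * r n z)) = (\<Sum>n<N. (b n)\<^sup>2)"
    and fourth: "\<And>b N. \<Lambda> (\<lambda>z. (\<Sum>n<N. b n * r n z) * (\<Sum>n<N. b n * r n z) *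
        ((\<Sum>n<N. b n * r n z) * (\<Sum>n<N. b n * r n z))) \<le> 3 * (\<Sum>n<N. (b n)\<^sup>2)\<^sup>2"
  shows "\<exists>y. basic_sequence (weak_star (Ck Z)) y"
proof -
  note cf = cfun_lambda_intros
  have zero: "\<Lambda> (\<lambda>_. 0) = 0"
    using scale[OF r(1)[of 0], of 0] by simp
  have lsum: "\<Lambda> (\<lambda>z. \<Sum>n<N. c n * f n z) = (\<Sum>n<N. c n * \<Lambda> (f n))"
    if "\<And>n. f n \<in> cfun Z" for N c and f :: "nat \<Rightarrow> 'a \<Rightarrow> real"
  proof (induction N)
    case (Suc N)
    have "(\<lambda>z. \<Sum>n<N. c n * f n z) \<in> cfun Z" by (rule cfun_sum) (rule cf(4)[OF that])
    then show ?case using Suc add[OF _ cf(4)[OF that]] scale[OF that] by simp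
  qed (simp add: zero)
  define y where "y n = (\<lambda>f. if f \<in> cfun Z then \<Lambda> (\<lambda>z. f z * r n z) else 0)" for n
  have yf: "y n f = \<Lambda> (\<lambda>z. f z * r n z)" if "f \<in> cfun Z" for n f using that by (simp add: y_def)
  have yd: "y n \<in> dual (Ck Z)" for n
  proof (rule dual_CkI[OF K, of _ 1])
    fix f g assume f: "f \<in> cfun Z" and g: "g \<in> cfun Z"
    have fg: "f + g \<in> cfun Z" using subspace_add[OF subspace_cfun f g] .
    have "y n (f + g) = \<Lambda> (\<lambda>z. f z * r n z + g z * r n z)"
      unfolding yf[OF fg] by (simp add: distrib_right)
    then show "y n (f + g) = y n f + y n g"
      unfolding yf[OF f] yf[OF g] using add[OF cf(3)[OF f r(1)] cf(3)[OF g r(1)]] by simp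
  next
    fix f c assume f: "f \<in> cfun Z"
    have cfz: "c *\<^sub>R f \<in> cfun Z" using subspace_scale[OF subspace_cfun f] .
    have "y n (c *\<^sub>R f) = \<Lambda> (\<lambda>z. c * (f z * r n z))"
      unfolding yf[OF cfz] by (simp add: scaleR_fun_def mult.assoc)
    then show "y n (c *\<^sub>R f) = c * y n f"
      unfolding yf[OF f] using scale[OF cf(3)[OF f r(1)]] by simp
  next
    fix f c assume f: "f \<in> cfun Z" "\<And>z. z \<in> K \<Longrightarrow> \<bar>f z\<bar> \<le> c" "0 \<le> c"
    have "\<bar>f z * r n z\<bar> \<le> c" if "z \<in> K" for z
      using mult_mono[OF f(2)[OF that] r(2)[of n z] f(3)] by (simp add: abs_mult)
    then show "\<bar>y n f\<bar> \<le> 1 * c"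
      unfolding yf[OF f(1)] using bound[OF cf(3)[OF f(1) r(1)]] by simp
  qed (simp add: y_def)
  have bessel: "(\<Sum>n<N. (y n f)\<^sup>2) \<le> \<Lambda> (\<lambda>z. f z * f z)" if f: "f \<in> cfun Z" for f N
  proof -
    define G where "G = (\<lambda>z. \<Sum>n<N. y n f * r n z)"
    have G: "G \<in> cfun Z" unfolding G_def by (rule cfun_sum) (rule cf(4)[OF r(1)])
    have fG: "\<Lambda> (\<lambda>z. f z * G z) = (\<Sum>n<N. (y n f)\<^sup>2)"
    proof -
      have "(\<lambda>z. f z * G z) = (\<lambda>z. \<Sum>n<N. y n f * (f z * r n z))"
        by (simp add: G_def sum_distrib_left mult_ac)
      then show ?thesis
        using lsum[of "\<lambda>n z. f z * r n z" "\<lambda>n. y n f" N, OF cf(3)[OF f r(1)]]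
        by (simp add: yf[OF f] power2_eq_square)
    qed
    have GG: "\<Lambda> (\<lambda>z. G z * G z) = (\<Sum>n<N. (y n f)\<^sup>2)" unfolding G_def by (rule second)
    have "0 \<le> \<Lambda> (\<lambda>z. f z * f z + ((-2) * (f z * G z) + G z * G z))"
    proof -
      have "0 \<le> f z * f z + ((-2) * (f z * G z) + G z * G z)" for z
        using zero_le_square[of "f z - G z"] by (simp add: algebra_simps)
      moreover have "(\<lambda>z. f z * f z + ((-2) * (f z * G z) + G z * G z)) \<in> cfun Z"
        by (intro cf f G)
      ultimately show ?thesis
        using le[of "\<lambda>z. 0 * r 0 z" "\<lambda>z. f z * f z + ((-2) * (f z * G z) + G z * G z)", OF cf(4)[OF r(1)]] zero
        by simp
    qed
    also have "\<dots> = \<Lambda> (\<lambda>z. f z * f z) + ((-2) * \<Lambda> (\<lambda>z. f z * G z) + \<Lambda> (\<lambda>z. G z * G z))"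
      using add[OF cf(3)[OF f f] cf(1)[OF cf(4)[OF cf(3)[OF f G]] cf(3)[OF G G]], of "-2"]
        add[OF cf(4)[OF cf(3)[OF f G]] cf(3)[OF G G], of "-2"] scale[OF cf(3)[OF f G], of "-2"]
      by linarith
    finally show ?thesis unfolding fG GG by simp
  qed
  have orth: "\<Lambda> (\<lambda>z. r i z * r j z) = (if i = j then 1 else 0)" for i j
  proof -
    define N where "N = Suc (max i j)"
    have iN: "i < N" "j < N" by (auto simp: N_def)
    have one: "\<Lambda> (\<lambda>z. r k z * r k z) = 1" if "k < N" for k
    proof -
      have "(\<Sum>n<N. (if n = k then 1 else 0) * r n z) = r k z" for z
        using that by (simp add: if_distrib[of "\<lambda>x. x * _"] cong: if_cong)
      moreover have "(\<Sum>n<N. (if n = k then 1 else 0::real)\<^sup>2) = 1"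
        using that by (simp add: if_distrib[of "\<lambda>x. x\<^sup>2"] cong: if_cong)
      ultimately show ?thesis using second[of "\<lambda>n. if n = k then 1 else 0" N] by simp
    qed
    show ?thesis
    proof (cases "i = j")
      case False
      have "(\<Sum>n<N. (if n = i then 1 else if n = j then 1 else 0) * r n z) = r i z + r j z" for z
      proof -
        have "(\<Sum>n<N. (if n = i then 1 else if n = j then 1 else 0) * r n z) =
            (\<Sum>n<N. (if n = i then r i z else 0) + (if n = j then r j z else 0))"
          using False by (intro sum.cong) auto
        then show ?thesis using iN by (simp add: sum.distrib)
      qed
      moreover have "(\<Sum>n<N. (if n = i then 1 else if n = j then 1 else 0::real)\<^sup>2) = 2"
      proof -
        have "(\<Sum>n<N. (if n = i then 1 else if n = j then 1 else 0::real)\<^sup>2) =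
            (\<Sum>n<N. (if n = i then 1 else 0) + (if n = j then 1 else 0))"
          using False by (intro sum.cong) auto
        then show ?thesis using iN by (simp add: sum.distrib)
      qed
      ultimately have "\<Lambda> (\<lambda>z. (r i z + r j z) * (r i z + r j z)) = 2"
        using second[of "\<lambda>n. if n = i then 1 else if n = j then 1 else 0" N] by simp
      moreover have "(\<lambda>z. (r i z + r j z) * (r i z + r j z)) =
          (\<lambda>z. r i z * r i z + (2 * (r i z * r j z) + r j z * r j z))"
        by (simp add: algebra_simps)
      moreover have "\<Lambda> (\<lambda>z. r i z * r i z + (2 * (r i z * r j z) + r j z * r j z)) =
          1 + (2 * \<Lambda> (\<lambda>z. r i z * r j z) + 1)"
        using add[OF cf(3)[OF r(1)[of i] r(1)[of i]] cf(1)[OF cf(4)[OF cf(3)[OF r(1)[of i] r(1)[of j]]] cf(3)[OF r(1)[of j] r(1)[of j]]], of 2]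
          add[OF cf(4)[OF cf(3)[OF r(1)[of i] r(1)[of j]]] cf(3)[OF r(1)[of j] r(1)[of j]], of 2]
          scale[OF cf(3)[OF r(1)[of i] r(1)[of j]], of 2] one[OF iN(1)] one[OF iN(2)]
        by linarith
      ultimately show ?thesis using False by simp
    qed (use one[OF iN(1)] in simp)
  qed
  define F where "F = {b :: nat \<Rightarrow> real. summable (\<lambda>n. (b n)\<^sup>2)}"
  have l2sq: "(l2norm b)\<^sup>2 = (\<Sum>n. (b n)\<^sup>2)" if "b \<in> F" for b
    using that suminf_nonneg[of "\<lambda>n. (b n)\<^sup>2"] by (simp add: l2norm_def F_def)
  have yF: "(\<lambda>n. y n f) \<in> F" and ybd: "(\<Sum>n. (y n f)\<^sup>2) \<le> \<Lambda> (\<lambda>z. f z * f z)" if f: "f \<in> cfun Z" for f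
  proof -
    have "summable (\<lambda>n. (y n f)\<^sup>2)"
      using bessel[OF f] by (intro summableI_nonneg_bounded[where x = "\<Lambda> (\<lambda>z. f z * f z)"]) simp_all
    then show "(\<lambda>n. y n f) \<in> F" "(\<Sum>n. (y n f)\<^sup>2) \<le> \<Lambda> (\<lambda>z. f z * f z)"
      using bessel[OF f] by (simp_all add: F_def suminf_le_const)
  qed
  have tailF: "tail N b \<in> F" and tails: "(\<Sum>n. (tail N b n)\<^sup>2) = (\<Sum>n. (b (n + N))\<^sup>2)" if b: "b \<in> F" for b N
  proof -
    have sm: "summable (\<lambda>n. (b n)\<^sup>2)" using b by (simp add: F_def)
    have "summable (\<lambda>n. (tail N b n)\<^sup>2)"
      by (rule summable_comparison_test'[OF sm, of 0]) (simp add: tail_def)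
    then show "tail N b \<in> F" by (simp add: F_def)
    show "(\<Sum>n. (tail N b n)\<^sup>2) = (\<Sum>n. (b (n + N))\<^sup>2)"
      using suminf_split_initial_segment[OF \<open>summable (\<lambda>n. (tail N b n)\<^sup>2)\<close>, of N]
      by (simp add: tail_def)
  qed
  have tail0: "(\<lambda>N. \<Sum>n. (tail N b n)\<^sup>2) \<longlonglongrightarrow> 0" if b: "b \<in> F" for b
    unfolding tails[OF b] using b suminf_exist_split2[of "\<lambda>n. (b n)\<^sup>2"] by (simp add: F_def)
  have almost: "\<exists>h\<in>cfun Z. (\<forall>z. \<bar>h z\<bar> \<le> 2 * l2norm b) \<and>
        (\<lambda>n. b n - y n h) \<in> F \<and> l2norm (\<lambda>n. b n - y n h) \<le> l2norm b / 2" if b: "b \<in> F" for b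
  proof -
    define s where "s = l2norm b"
    have sm: "summable (\<lambda>n. (b n)\<^sup>2)" using b by (simp add: F_def)
    have s0: "s \<ge> 0" using sm by (simp add: s_def l2norm_def suminf_nonneg)
    have s2: "s\<^sup>2 = (\<Sum>n. (b n)\<^sup>2)" unfolding s_def by (rule l2sq[OF b])
    show ?thesis
    proof (cases "s = 0")
      case True
      have "(\<lambda>z. 0 * r 0 z) \<in> cfun Z" by (rule cf(4)[OF r(1)])
      moreover have "y n (\<lambda>z. 0 * r 0 z) = 0" for n
        unfolding yf[OF calculation] by (simp add: zero)
      ultimately show ?thesis
        using True b by (intro bexI[of _ "\<lambda>z. 0 * r 0 z"]) (simp_all add: s_def)
    next
      case False
      then have s: "s > 0" using s0 by simp
      then have "s\<^sup>2 / 16 > 0" by simp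
      then have "\<forall>\<^sub>F N in sequentially. (\<Sum>n. (tail N b n)\<^sup>2) < s\<^sup>2 / 16"
        by (rule order_tendstoD(2)[OF tail0[OF b]])
      then obtain N where N: "(\<Sum>n. (tail N b n)\<^sup>2) < s\<^sup>2 / 16"
        by (auto simp: eventually_sequentially)
      define G where "G = (\<lambda>z. \<Sum>n<N. b n * r n z)"
      have G: "G \<in> cfun Z" unfolding G_def by (rule cfun_sum) (rule cf(4)[OF r(1)])
      \<comment> \<open>With truncation at \<open>2 * s\<close> the squared error is at most \<open>2 * (1/16) + 2 * (3/64) < 1/4\<close> times \<open>s\<^sup>2\<close>.\<close>
      define M where "M = 2 * s"
      have M: "M > 0" using s by (simp add: M_def)
      define h where "h = (\<lambda>z. max (- M) (min M (G z)))"
      have h: "h \<in> cfun Z" unfolding h_def using M by (intro cf(5)[OF G]) simp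
      define d where "d = (\<lambda>z. G z - h z)"
      have d: "d \<in> cfun Z" unfolding d_def by (rule cf(2)[OF G h])
      define q where "q = 1 / (16 * M\<^sup>2)"
      have dz: "d z * d z \<le> q * (G z * G z * (G z * G z))" for z
      proof -
        \<comment> \<open>The part cut off is dominated by \<open>G\<^sup>2\<close>, so its square is dominated by the fourth power of \<open>G\<close>.\<close>
        have "\<bar>d z\<bar> \<le> max 0 (\<bar>G z\<bar> - M)" using M unfolding d_def h_def by linarith
        also have "\<dots> \<le> (G z)\<^sup>2 / (4 * M)"
        proof -
          have "0 \<le> (\<bar>G z\<bar> - 2 * M)\<^sup>2" by simp
          then have "(\<bar>G z\<bar> - M) * (4 * M) \<le> (G z)\<^sup>2"
            by (simp add: power2_eq_square algebra_simps)
          then show ?thesis using M by (simp add: field_simps)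
        qed
        finally have "\<bar>d z\<bar>\<^sup>2 \<le> ((G z)\<^sup>2 / (4 * M))\<^sup>2" by (rule power_mono) simp
        then show ?thesis using M by (simp add: q_def power2_eq_square)
      qed
      have GN: "(\<Sum>n<N. (b n)\<^sup>2) \<le> s\<^sup>2" unfolding s2 by (rule sum_le_suminf[OF sm]) simp_all
      have "\<Lambda> (\<lambda>z. d z * d z) \<le> \<Lambda> (\<lambda>z. q * (G z * G z * (G z * G z)))"
        by (rule le) (intro cf d G dz)+
      also have "\<dots> = q * \<Lambda> (\<lambda>z. G z * G z * (G z * G z))" by (rule scale) (intro cf G)
      also have "\<dots> \<le> q * (3 * (\<Sum>n<N. (b n)\<^sup>2)\<^sup>2)"
        unfolding G_def by (rule mult_left_mono[OF fourth]) (simp add: q_def)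
      also have "\<dots> \<le> q * (3 * (s\<^sup>2)\<^sup>2)"
        using GN by (intro mult_left_mono power_mono sum_nonneg) (simp_all add: q_def)
      also have "\<dots> = 3 * s\<^sup>2 / 64" using s by (simp add: q_def M_def power2_eq_square)
      finally have dd: "\<Lambda> (\<lambda>z. d z * d z) \<le> 3 * s\<^sup>2 / 64" .
      have yG: "y n G = (if n < N then b n else 0)" for n
      proof -
        have "(\<lambda>z. G z * r n z) = (\<lambda>z. \<Sum>j<N. b j * (r j z * r n z))"
          by (rule ext) (simp add: G_def sum_distrib_right mult.assoc)
        then have "y n G = (\<Sum>j<N. b j * \<Lambda> (\<lambda>z. r j z * r n z))"
          unfolding yf[OF G] using lsum[of "\<lambda>j z. r j z * r n z" b N, OF cf(3)[OF r(1) r(1)]] by simp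
        also have "\<dots> = (\<Sum>j<N. if j = n then b j else 0)"
          unfolding orth by (rule sum.cong) simp_all
        finally show ?thesis by simp
      qed
      have "y n d = y n G - y n h" for n
      proof -
        have "d = G - h" by (simp add: d_def fun_eq_iff)
        then show ?thesis using dual_diff[OF yd[of n], of G h] subspace_cfun[of Z] G h by simp
      qed
      then have eq: "b n - y n h = tail N b n + y n d" for n
        unfolding yG by (simp add: tail_def)
      have sq: "(b n - y n h)\<^sup>2 \<le> 2 * (tail N b n)\<^sup>2 + 2 * (y n d)\<^sup>2" for n
      proof -
        have "0 \<le> (tail N b n - y n d)\<^sup>2" by simp
        then show ?thesis unfolding eq by (simp add: power2_eq_square algebra_simps)
      qed
      have sm1: "summable (\<lambda>n. (tail N b n)\<^sup>2)" "summable (\<lambda>n. (y n d)\<^sup>2)"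
        using tailF[OF b] yF[OF d] by (simp_all add: F_def)
      have sm2: "summable (\<lambda>n. 2 * (tail N b n)\<^sup>2 + 2 * (y n d)\<^sup>2)"
        by (intro summable_add summable_mult sm1)
      have sm3: "summable (\<lambda>n. (b n - y n h)\<^sup>2)"
        by (rule summable_comparison_test'[OF sm2, of 0]) (simp add: sq)
      have "(\<Sum>n. (b n - y n h)\<^sup>2) \<le> (\<Sum>n. 2 * (tail N b n)\<^sup>2 + 2 * (y n d)\<^sup>2)"
        by (rule suminf_le[OF sq sm3 sm2])
      also have "\<dots> = 2 * (\<Sum>n. (tail N b n)\<^sup>2) + 2 * (\<Sum>n. (y n d)\<^sup>2)"
        using sm1 by (simp add: suminf_add[symmetric] suminf_mult summable_mult)
      also have "\<dots> \<le> 2 * (s\<^sup>2 / 16) + 2 * (3 * s\<^sup>2 / 64)"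
        using N ybd[OF d] dd by linarith
      also have "\<dots> \<le> (s / 2)\<^sup>2" by (simp add: power2_eq_square)
      finally have "l2norm (\<lambda>n. b n - y n h) \<le> s / 2"
        unfolding l2norm_def using s0 by (intro real_le_lsqrt) (simp_all add: suminf_nonneg sm3)
      moreover have "\<bar>h z\<bar> \<le> 2 * s" for z using M by (auto simp: h_def M_def)
      ultimately show ?thesis using h sm3 by (intro bexI[of _ h]) (simp_all add: s_def F_def)
    qed
  qed
  have "basic_sequence (weak_star (Ck Z)) y"
  proof (rule basic_sequence_of_quotient[where F = F and \<nu> = l2norm and C = 2])
    show "\<bar>b n\<bar> \<le> l2norm b" if b: "b \<in> F" for b n
    proof -
      have "(b n)\<^sup>2 \<le> (\<Sum>n. (b n)\<^sup>2)"
        using b sum_le_suminf[of "\<lambda>n. (b n)\<^sup>2" "{n}"] by (simp add: F_def)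
      then show ?thesis unfolding l2norm_def by (intro real_le_rsqrt) simp
    qed
    show "(\<lambda>N. l2norm (tail N b)) \<longlonglongrightarrow> 0" if b: "b \<in> F" for b
      using tendsto_real_sqrt[OF tail0[OF b]] by (simp add: l2norm_def)
    show "(\<lambda>m. if m = n then 1 else 0) \<in> F" for n
      unfolding F_def mem_Collect_eq by (rule summable_finite[of "{n}"]) auto
  qed (use yd almost yF tailF in simp_all)
  then show ?thesis by blast
qed

lemma cfun_bounded_on_compact:
  assumes "f \<in> cfun Z" "compactin Z K"
  obtains c where "c \<ge> 0" "\<And>z. z \<in> K \<Longrightarrow> \<bar>f z\<bar> \<le> c"
proof -
  have "compactin euclideanreal (f ` K)"
    using assms by (intro image_compactin[of Z]) (auto simp: cfun_def)
  then have "bounded (f ` K)" by (simp add: compact_imp_bounded)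
  then obtain c where "\<forall>x\<in>f ` K. norm x \<le> c" by (auto simp: bounded_iff)
  then have "\<bar>f z\<bar> \<le> max 0 c" if "z \<in> K" for z using that by fastforce
  then show ?thesis by (intro that[of "max 0 c"]) simp_all
qed

text \<open>Choose for each \<open>m\<close> and each sign pattern of length \<open>m\<close> a point of \<open>K\<close> realising it. The functional \<open>\<Lambda>\<close> is a
generalised limit over \<open>m\<close> of the averages over these points. For \<open>m \<ge> N\<close> the moments of sums of the first \<open>N\<close>
functions under the average are exactly those of sums of independent signs.\<close>

theorem independent_functions_basic_sequence:
  fixes r :: "nat \<Rightarrow> 'a \<Rightarrow> real"
  assumes K: "compactin Z K" and r: "\<And>n. r n \<in> cfun Z" "\<And>n z. \<bar>r n z\<bar> \<le> 1"
    and indep: "\<And>m \<epsilon>. \<epsilon> \<in> {..<m} \<rightarrow>\<^sub>E {-1, 1} \<Longrightarrow> \<exists>x\<in>K. \<forall>i<m. r i x = \<epsilon> i"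
  shows "\<exists>y. basic_sequence (weak_star (Ck Z)) y"
proof -
  define Q where "Q m = {..<m} \<rightarrow>\<^sub>E {-1, 1::real}" for m :: nat
  define X where "X m \<epsilon> = (SOME x. x \<in> K \<and> (\<forall>i<m. r i x = \<epsilon> i))" for m \<epsilon>
  have X: "X m \<epsilon> \<in> K" "\<And>i. i < m \<Longrightarrow> r i (X m \<epsilon>) = \<epsilon> i" if "\<epsilon> \<in> Q m" for m \<epsilon>
  proof -
    have "\<exists>x. x \<in> K \<and> (\<forall>i<m. r i x = \<epsilon> i)" using indep[of \<epsilon> m] that by (auto simp: Q_def)
    from someI_ex[OF this] show "X m \<epsilon> \<in> K" "\<And>i. i < m \<Longrightarrow> r i (X m \<epsilon>) = \<epsilon> i"
      by (simp_all add: X_def)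
  qed
  have Q: "finite (Q m)" "card (Q m) = 2 ^ m" for m
    by (simp_all add: Q_def finite_PiE card_signs)
  define A where "A m f = (\<Sum>\<epsilon>\<in>Q m. f (X m \<epsilon>)) / 2 ^ m" for m and f :: "'a \<Rightarrow> real"
  have Ale: "A m f \<le> A m g" if "\<And>z. z \<in> K \<Longrightarrow> f z \<le> g z" for m f g
    unfolding A_def using that X(1) by (intro divide_right_mono sum_mono) simp_all
  have Ac: "A m (\<lambda>_. c) = c" for m c using Q by (simp add: A_def)
  have Abound: "A m f \<le> c" "- c \<le> A m f" if "\<And>z. z \<in> K \<Longrightarrow> \<bar>f z\<bar> \<le> c" for m f c
  proof -
    have "f z \<le> c" "- c \<le> f z" if "z \<in> K" for z
      using \<open>\<And>z. z \<in> K \<Longrightarrow> \<bar>f z\<bar> \<le> c\<close>[OF that] by linarith+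
    then show "A m f \<le> c" "- c \<le> A m f"
      using Ale[of f "\<lambda>_. c" m] Ale[of "\<lambda>_. - c" f m] by (simp_all add: Ac)
  qed
  have B: "Bseq (\<lambda>m. A m f)" if f: "f \<in> cfun Z" for f
  proof -
    obtain c where c: "c \<ge> 0" "\<And>z. z \<in> K \<Longrightarrow> \<bar>f z\<bar> \<le> c"
      using cfun_bounded_on_compact[OF f K] by blast
    have "norm (A m f) \<le> c" for m using Abound[where f = f and c = c and m = m, OF c(2)] by simp
    then show ?thesis by (rule BseqI')
  qed
  obtain L :: "(nat \<Rightarrow> real) \<Rightarrow> real" where
    L: "\<And>I e k. finite I \<Longrightarrow> (\<And>s. s \<in> I \<Longrightarrow> Bseq s) \<Longrightarrow> e > 0 \<Longrightarrow> \<exists>m\<ge>k. \<forall>s\<in>I. \<bar>s m - L s\<bar> < e"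
    using generalised_limit by blast
  note LL = generalised_limit_properties[of L, OF L]
  define \<Lambda> where "\<Lambda> f = L (\<lambda>m. A m f)" for f
  note cf = cfun_lambda_intros
  have G: "(\<lambda>z. \<Sum>n<N. b n * r n z) \<in> cfun Z" for b and N :: nat
    by (rule cfun_sum) (rule cf(4)[OF r(1)])
  have AG: "A m (\<lambda>z. g (\<Sum>n<N. b n * r n z)) =
      (\<Sum>\<epsilon>\<in>Q m. g (\<Sum>i<m. \<epsilon> i * (if i < N then b i else 0))) / 2 ^ m"
    if "N \<le> m" for m N b and g :: "real \<Rightarrow> real"
  proof -
    have "(\<Sum>n<N. b n * r n (X m \<epsilon>)) = (\<Sum>i<m. \<epsilon> i * (if i < N then b i else 0))" if \<epsilon>: "\<epsilon> \<in> Q m" for \<epsilon>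
    proof -
      have "(\<Sum>i<m. \<epsilon> i * (if i < N then b i else 0)) = (\<Sum>i<N. \<epsilon> i * (if i < N then b i else 0))"
        using \<open>N \<le> m\<close> by (intro sum.mono_neutral_right) auto
      also have "\<dots> = (\<Sum>n<N. b n * r n (X m \<epsilon>))"
        using X(2)[OF \<epsilon>] \<open>N \<le> m\<close> by (intro sum.cong) simp_all
      finally show ?thesis by simp
    qed
    then show ?thesis by (simp add: A_def)
  qed
  have bsq: "(\<Sum>i<m. (if i < N then b i else 0)\<^sup>2) = (\<Sum>i<N. (b i)\<^sup>2)" if "N \<le> m" for m N and b :: "nat \<Rightarrow> real"
  proof -
    have "(\<Sum>i<m. (if i < N then b i else 0)\<^sup>2) = (\<Sum>i<N. (if i < N then b i else 0)\<^sup>2)"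
      using that by (intro sum.mono_neutral_right) auto
    then show ?thesis by simp
  qed
  show ?thesis
  proof (rule rademacher_basic_sequence[of Z K r \<Lambda>, OF K r])
    show "\<Lambda> (\<lambda>z. f z + g z) = \<Lambda> f + \<Lambda> g" if "f \<in> cfun Z" "g \<in> cfun Z" for f g
      unfolding \<Lambda>_def
      by (rule LL(1)[OF _ _ _ B[OF that(1)] B[OF that(2)] B[OF cf(1)[OF that]], of 0])
        (simp_all add: A_def sum.distrib add_divide_distrib)
    show "\<Lambda> (\<lambda>z. c * f z) = c * \<Lambda> f" if "f \<in> cfun Z" for f c
      unfolding \<Lambda>_def
      by (rule LL(2)[OF _ _ _ B[OF that] B[OF that] B[OF cf(4)[OF that]], of 0])
        (simp_all add: A_def sum_distrib_left)
    show "\<Lambda> f \<le> \<Lambda> g" if "f \<in> cfun Z" "g \<in> cfun Z" "\<And>z. z \<in> K \<Longrightarrow> f z \<le> g z" for f g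
      unfolding \<Lambda>_def
      by (rule LL(3)[OF _ _ _ B[OF that(2)] B[OF that(2)] B[OF that(1)], of 0])
        (simp_all add: Ale that(3))
    show "\<bar>\<Lambda> f\<bar> \<le> c" if f: "f \<in> cfun Z" and c: "\<And>z. z \<in> K \<Longrightarrow> \<bar>f z\<bar> \<le> c" for f c
    proof -
      have "\<Lambda> f \<le> c" unfolding \<Lambda>_def
        by (rule LL(4)[OF _ _ _ B[OF f] B[OF f] B[OF f], of 0]) (simp_all add: Abound c)
      moreover have "- c \<le> \<Lambda> f" unfolding \<Lambda>_def
        by (rule LL(5)[OF _ _ _ B[OF f] B[OF f] B[OF f], of 0]) (simp_all add: Abound c)
      ultimately show ?thesis by linarith
    qed
    fix b :: "nat \<Rightarrow> real" and N :: nat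
    have eq: "A m (\<lambda>z. (\<Sum>n<N. b n * r n z) * (\<Sum>n<N. b n * r n z)) = (\<Sum>n<N. (b n)\<^sup>2)" if "N \<le> m" for m
    proof -
      have "A m (\<lambda>z. (\<Sum>n<N. b n * r n z) * (\<Sum>n<N. b n * r n z)) =
          (\<Sum>\<epsilon>\<in>Q m. (\<Sum>i<m. \<epsilon> i * (if i < N then b i else 0)) *
            (\<Sum>i<m. \<epsilon> i * (if i < N then b i else 0))) / 2 ^ m"
        by (rule AG[OF that, of "\<lambda>t. t * t"])
      also have "\<dots> = 2 ^ card {..<m} * (\<Sum>i<m. (if i < N then b i else 0)\<^sup>2) / 2 ^ m"
        unfolding power2_eq_square[symmetric] Q_def
        by (simp only: second_moment[OF finite_lessThan])
      finally show ?thesis unfolding bsq[OF that] by simp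
    qed
    note BG = B[OF cf(3)[OF G[where b = b and N = N] G[where b = b and N = N]]]
    have "\<Lambda> (\<lambda>z. (\<Sum>n<N. b n * r n z) * (\<Sum>n<N. b n * r n z)) \<le> (\<Sum>n<N. (b n)\<^sup>2)"
      unfolding \<Lambda>_def by (rule LL(4)[OF _ _ _ BG BG BG, of N]) (simp_all add: eq)
    moreover have "(\<Sum>n<N. (b n)\<^sup>2) \<le> \<Lambda> (\<lambda>z. (\<Sum>n<N. b n * r n z) * (\<Sum>n<N. b n * r n z))"
      unfolding \<Lambda>_def by (rule LL(5)[OF _ _ _ BG BG BG, of N]) (simp_all add: eq)
    ultimately show "\<Lambda> (\<lambda>z. (\<Sum>n<N. b n * r n z) * (\<Sum>n<N. b n * r n z)) = (\<Sum>n<N. (b n)\<^sup>2)"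
      by (rule antisym)
    have le: "A m (\<lambda>z. (\<Sum>n<N. b n * r n z) * (\<Sum>n<N. b n * r n z) *
        ((\<Sum>n<N. b n * r n z) * (\<Sum>n<N. b n * r n z))) \<le> 3 * (\<Sum>n<N. (b n)\<^sup>2)\<^sup>2" if "N \<le> m" for m
    proof -
      have pw: "t * t * (t * t) = t ^ 4" for t :: real by (simp add: eval_nat_numeral)
      have "(\<Sum>\<epsilon>\<in>Q m. (\<Sum>i<m. \<epsilon> i * (if i < N then b i else 0)) ^ 4) \<le>
          2 ^ m * (3 * (\<Sum>n<N. (b n)\<^sup>2)\<^sup>2)"
        using fourth_moment[OF finite_lessThan[of m], of "\<lambda>i. if i < N then b i else 0"]
        unfolding bsq[OF that] by (simp add: Q_def)
      then show ?thesis
        unfolding AG[OF that, of "\<lambda>t. t * t * (t * t)"] unfolding pw by (simp add: field_simps)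
    qed
    note BG4 = B[OF cf(3)[OF cf(3)[OF G[where b = b and N = N] G[where b = b and N = N]]
          cf(3)[OF G[where b = b and N = N] G[where b = b and N = N]]]]
    show "\<Lambda> (\<lambda>z. (\<Sum>n<N. b n * r n z) * (\<Sum>n<N. b n * r n z) *
        ((\<Sum>n<N. b n * r n z) * (\<Sum>n<N. b n * r n z))) \<le> 3 * (\<Sum>n<N. (b n)\<^sup>2)\<^sup>2"
      unfolding \<Lambda>_def by (rule LL(4)[OF _ _ _ BG4 BG4 BG4, of N]) (simp_all add: le)
  qed
qed

section \<open>Infinite compact subsets\<close>

text \<open>Each sign pattern is attained by \<open>rs\<close> on a whole open set that meets \<open>P\<close>, which leaves room for
splitting by one more function.\<close>

definition sign_splitting :: "'a topology \<Rightarrow> 'a set \<Rightarrow> ('a \<Rightarrow> real) list \<Rightarrow> bool" where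
  "sign_splitting Z P rs \<longleftrightarrow> (\<forall>f\<in>set rs. f \<in> cfun Z \<and> (\<forall>z. \<bar>f z\<bar> \<le> 1)) \<and>
     (\<forall>ss. set ss \<subseteq> {-1, 1} \<and> length ss = length rs \<longrightarrow>
       (\<exists>U. openin Z U \<and> U \<inter> P \<noteq> {} \<and> (\<forall>x\<in>U. \<forall>i<length rs. (rs ! i) x = ss ! i)))"

text \<open>The open sets for different patterns are disjoint, and each contains two points of \<open>P\<close>. The new function
comes from interpolating the values \<open>2\<close> and \<open>-2\<close> at these points; truncated at \<open>1\<close> it is constant around
each of them.\<close>

lemma sign_splitting_extend:
  assumes Z: "tychonoff_space Z" and rs: "sign_splitting Z P rs"
    and perfect: "\<And>U. openin Z U \<Longrightarrow> U \<inter> P \<noteq> {} \<Longrightarrow> \<exists>a\<in>U \<inter> P. \<exists>b\<in>U \<inter> P. a \<noteq> b"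
  shows "\<exists>f. sign_splitting Z P (rs @ [f])"
proof -
  define SL where "SL = {ss :: real list. set ss \<subseteq> {-1, 1} \<and> length ss = length rs}"
  have "\<forall>ss. \<exists>p. ss \<in> SL \<longrightarrow> openin Z (fst p) \<and> fst (snd p) \<in> fst p \<inter> P \<and> snd (snd p) \<in> fst p \<inter> P \<and>
      fst (snd p) \<noteq> snd (snd p) \<and> (\<forall>x\<in>fst p. \<forall>i<length rs. (rs ! i) x = ss ! i)"
    (is "\<forall>ss. \<exists>p. ?R ss p")
  proof
    fix ss
    show "\<exists>p. ?R ss p"
    proof (cases "ss \<in> SL")
      case True
      then obtain U where U: "openin Z U" "U \<inter> P \<noteq> {}" "\<forall>x\<in>U. \<forall>i<length rs. (rs ! i) x = ss ! i"
        using rs unfolding sign_splitting_def SL_def by blast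
      then obtain a b where "a \<in> U \<inter> P" "b \<in> U \<inter> P" "a \<noteq> b" using perfect by blast
      then show ?thesis using U by (intro exI[of _ "(U, a, b)"]) simp
    qed simp
  qed
  from choice[OF this] obtain p where p: "\<forall>ss. ?R ss (p ss)"
    by (elim exE)
  define U where "U ss = fst (p ss)" for ss
  define a where "a ss = fst (snd (p ss))" for ss
  define b where "b ss = snd (snd (p ss))" for ss
  have U: "openin Z (U ss)" "\<And>x i. x \<in> U ss \<Longrightarrow> i < length rs \<Longrightarrow> (rs ! i) x = ss ! i"
    and ab: "a ss \<in> U ss" "a ss \<in> P" "b ss \<in> U ss" "b ss \<in> P" "a ss \<noteq> b ss" if "ss \<in> SL" for ss
    using p that by (auto simp: U_def a_def b_def)
  have neq: "a ss \<noteq> b ss'" if "ss \<in> SL" "ss' \<in> SL" for ss ss'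
  proof
    assume eq: "a ss = b ss'"
    have "ss = ss'"
    proof (rule nth_equalityI)
      show "length ss = length ss'" using that by (simp add: SL_def)
      fix i assume "i < length ss"
      then have i: "i < length rs" using that by (simp add: SL_def)
      then show "ss ! i = ss' ! i"
        using U(2)[OF that(1) ab(1)[OF that(1)] i] U(2)[OF that(2) ab(3)[OF that(2)] i] eq by simp
    qed
    then show False using ab(5)[OF that(1)] eq by simp
  qed
  have finSL: "finite SL" unfolding SL_def by (rule finite_lists_length_eq) simp
  define v where "v z = (if z \<in> a ` SL then 2 else -2 :: real)" for z
  have top: "a ` SL \<union> b ` SL \<subseteq> topspace Z"
    using ab(1,3) U(1) openin_subset by fastforce
  obtain f0 where f0: "f0 \<in> cfun Z" "\<And>z. z \<in> a ` SL \<union> b ` SL \<Longrightarrow> f0 z = v z"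
    by (rule tychonoff_interpolation[OF Z, of "a ` SL \<union> b ` SL" "{}" v 2])
      (use finSL top in \<open>auto simp: v_def\<close>)
  have fa: "f0 (a ss) = 2" if "ss \<in> SL" for ss using f0(2) that by (simp add: v_def)
  have fb: "f0 (b ss) = -2" if ss: "ss \<in> SL" for ss
  proof -
    have "b ss \<notin> a ` SL" using neq[OF _ ss] by force
    then show ?thesis using f0(2) ss by (simp add: v_def)
  qed
  define f where "f = (\<lambda>z. max (- 1) (min 1 (f0 z)))"
  have f: "f \<in> cfun Z" unfolding f_def using f0(1) by (intro cfun_lambda_intros(5)) simp_all
  have "\<exists>V. openin Z V \<and> V \<inter> P \<noteq> {} \<and> (\<forall>x\<in>V. \<forall>i<length (rs @ [f]). ((rs @ [f]) ! i) x = ts ! i)"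
    if ts: "set ts \<subseteq> {-1, 1}" "length ts = length (rs @ [f])" for ts
  proof -
    define ss where "ss = butlast ts"
    define t where "t = last ts"
    have "ts \<noteq> []" using ts(2) by auto
    then have tss: "ts = ss @ [t]" by (simp add: ss_def t_def)
    then have ss: "ss \<in> SL" and t: "t \<in> {-1, 1}" using ts by (auto simp: SL_def)
    have f0c: "continuous_map Z euclideanreal f0" by (rule cfun_continuous[OF f0(1)])
    define V where "V = U ss \<inter> {z \<in> topspace Z. t * f0 z \<in> {1<..}}"
    have "continuous_map Z euclideanreal (\<lambda>z. t * f0 z)" using f0c by (rule continuous_map_real_mult_left)
    then have V: "openin Z V" unfolding V_def
      by (intro openin_Int U(1)[OF ss] openin_continuous_map_preimage) auto
    have "(if t = 1 then a ss else b ss) \<in> V \<inter> P"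
      using t ab[OF ss] fa[OF ss] fb[OF ss] top ss by (auto simp: V_def)
    moreover have "((rs @ [f]) ! i) x = ts ! i" if x: "x \<in> V" and i: "i < length (rs @ [f])" for x i
    proof (cases "i < length rs")
      case True
      then show ?thesis using U(2)[OF ss, of x i] x ss by (simp add: nth_append V_def tss SL_def)
    next
      case False
      then have "i = length rs" using i by simp
      moreover have "f x = t" using x t by (auto simp: f_def V_def)
      ultimately show ?thesis using ss by (simp add: nth_append tss SL_def)
    qed
    ultimately show ?thesis using V by blast
  qed
  moreover have "\<bar>f z\<bar> \<le> 1" for z by (auto simp: f_def)
  ultimately show ?thesis
    using rs f by (intro exI[of _ f]) (auto simp: sign_splitting_def)
qed

lemma independent_functions_on_perfect_set:
  assumes Z: "tychonoff_space Z" and P: "P \<noteq> {}" "P \<subseteq> topspace Z"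
    and perfect: "\<And>U. openin Z U \<Longrightarrow> U \<inter> P \<noteq> {} \<Longrightarrow> \<exists>a\<in>U \<inter> P. \<exists>b\<in>U \<inter> P. a \<noteq> b"
  obtains r :: "nat \<Rightarrow> 'a \<Rightarrow> real" where "\<And>n. r n \<in> cfun Z" "\<And>n z. \<bar>r n z\<bar> \<le> 1"
    "\<And>m \<epsilon>. \<epsilon> \<in> {..<m} \<rightarrow>\<^sub>E {-1, 1} \<Longrightarrow> \<exists>x\<in>P. \<forall>i<m. r i x = \<epsilon> i"
proof -
  define nxt where "nxt rs = (SOME f. sign_splitting Z P (rs @ [f]))" for rs
  define R where "R = rec_nat [] (\<lambda>_ rs. rs @ [nxt rs])"
  have R0: "R 0 = []" and RS: "\<And>n. R (Suc n) = R n @ [nxt (R n)]" by (simp_all add: R_def)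
  have R: "sign_splitting Z P (R n)" for n
  proof (induction n)
    case 0
    show ?case using P by (auto simp: R0 sign_splitting_def intro!: exI[of _ "topspace Z"])
  next
    case (Suc n)
    show ?case unfolding RS nxt_def by (rule someI_ex[OF sign_splitting_extend[OF Z Suc perfect]])
  qed
  define r where "r n = nxt (R n)" for n
  have Rm: "R n = map r [0..<n]" for n by (induction n) (simp_all add: R0 RS r_def)
  show ?thesis
  proof (rule that[of r])
    have "r n \<in> set (R (Suc n))" for n unfolding Rm by simp
    then show "r n \<in> cfun Z" "\<bar>r n z\<bar> \<le> 1" for n z
      using R[of "Suc n"] unfolding sign_splitting_def by blast+
    fix m and \<epsilon> :: "nat \<Rightarrow> real" assume \<epsilon>: "\<epsilon> \<in> {..<m} \<rightarrow>\<^sub>E {-1, 1}"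
    have "set (map \<epsilon> [0..<m]) \<subseteq> {-1, 1} \<and> length (map \<epsilon> [0..<m]) = length (R m)"
      using \<epsilon> by (auto simp: Rm PiE_iff)
    then obtain U where U: "U \<inter> P \<noteq> {}" "\<forall>x\<in>U. \<forall>i<length (R m). (R m ! i) x = map \<epsilon> [0..<m] ! i"
      using R[of m] unfolding sign_splitting_def by blast
    then obtain x where "x \<in> U" "x \<in> P" by blast
    then show "\<exists>x\<in>P. \<forall>i<m. r i x = \<epsilon> i" using U(2) by (intro bexI[of _ x]) (simp_all add: Rm)
  qed
qed

lemma compactin_infinite_accumulation:
  assumes K: "compactin Z K" and S: "S \<subseteq> K" "infinite S"
  obtains p where "p \<in> K" "\<And>U. openin Z U \<Longrightarrow> p \<in> U \<Longrightarrow> infinite (U \<inter> S)"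
proof (rule ccontr)
  assume "\<not> thesis"
  then have "\<forall>p\<in>K. \<exists>U. openin Z U \<and> p \<in> U \<and> finite (U \<inter> S)" using that by blast
  then have "K \<subseteq> \<Union>{U. openin Z U \<and> finite (U \<inter> S)}" by blast
  moreover have "openin Z U" if "U \<in> {U. openin Z U \<and> finite (U \<inter> S)}" for U using that by simp
  ultimately obtain \<F> where \<F>: "finite \<F>" "\<F> \<subseteq> {U. openin Z U \<and> finite (U \<inter> S)}" "K \<subseteq> \<Union>\<F>"
    using compactinD[OF K, of "{U. openin Z U \<and> finite (U \<inter> S)}"] by blast
  have "finite (U \<inter> S)" if "U \<in> \<F>" for U using \<F>(2) that by blast
  then have "finite (\<Union>U\<in>\<F>. U \<inter> S)" by (rule finite_UN_I[OF \<F>(1)])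
  moreover have "S \<subseteq> (\<Union>U\<in>\<F>. U \<inter> S)" using S(1) \<F>(3) by blast
  ultimately show False using S(2) finite_subset by blast
qed

lemma eventually_outside_finite_preimage:
  fixes x :: "nat \<Rightarrow> 'a"
  assumes "finite {n. \<not> Q n}"
  shows "\<forall>\<^sub>F n in sequentially. Q n"
  using assms by (simp add: eventually_cofinite cofinite_eq_sequentially[symmetric])

text \<open>Halved differences of point masses at consecutive points tend weak-star to zero; using each point only once lets their mass escape from every finite set.\<close>

lemma convergent_sequence_basic_sequence:
  fixes x :: "nat \<Rightarrow> 'a"
  assumes Z: "tychonoff_space Z" and x: "inj x" "range x \<subseteq> topspace Z"
    and conv: "\<And>f. f \<in> cfun Z \<Longrightarrow> (\<lambda>n. f (x n)) \<longlonglongrightarrow> f p"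
  shows "\<exists>y. basic_sequence (weak_star (Ck Z)) y"
proof -
  define S where "S n = {x (2 * n), x (2 * n + 1)}" for n
  define a where "a n z = (if z = x (2 * n) then 1/2 else -1/2 :: real)" for n z
  have neq: "x (2 * n) \<noteq> x (2 * n + 1)" for n using injD[OF x(1), of "2 * n" "2 * n + 1"] by auto
  have sum: "(\<Sum>z\<in>S n. g (a n z) z) = g (1/2) (x (2 * n)) + g (-1/2) (x (2 * n + 1))" for n and g :: "real \<Rightarrow> 'a \<Rightarrow> real"
    using neq[of n] by (simp add: S_def a_def)
  have sub: "strict_mono (\<lambda>n::nat. 2 * n)" "strict_mono (\<lambda>n::nat. 2 * n + 1)" by (auto simp: strict_mono_def)
  show ?thesis
  proof (rule point_functionals_subsequence[of Z S a, OF Z])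
    show "finite (S n)" "S n \<subseteq> topspace Z" for n using x(2) by (auto simp: S_def)
    show "(\<Sum>z\<in>S n. \<bar>a n z\<bar>) = 1" for n using sum[of "\<lambda>a z. \<bar>a\<bar>" n] by simp
    show "(\<lambda>n. \<Sum>z\<in>S n. a n z * f z) \<longlonglongrightarrow> 0" if f: "f \<in> cfun Z" for f
    proof -
      have "(\<lambda>n. 1/2 * f (x (2 * n)) + -1/2 * f (x (2 * n + 1))) \<longlonglongrightarrow> 1/2 * f p + -1/2 * f p"
        using LIMSEQ_subseq_LIMSEQ[OF conv[OF f] sub(1)] LIMSEQ_subseq_LIMSEQ[OF conv[OF f] sub(2)]
        by (intro tendsto_intros) (simp_all add: o_def)
      then show ?thesis using sum[of "\<lambda>a z. a * f z"] by simp
    qed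
    show "(\<lambda>n. if z \<in> S n then \<bar>a n z\<bar> else 0) \<longlonglongrightarrow> 0" for z
    proof (rule tendsto_eventually, rule eventually_outside_finite_preimage)
      have "{n. \<not> (if z \<in> S n then \<bar>a n z\<bar> else 0) = 0} \<subseteq> {n. x (2 * n) = z} \<union> {n. x (2 * n + 1) = z}"
        by (auto simp: S_def split: if_splits)
      moreover have "finite {n. x (2 * n) = z}"
      proof -
        have "inj (\<lambda>n. x (2 * n))" by (rule injI) (use injD[OF x(1)] in fastforce)
        from finite_vimageI[OF _ this, of "{z}"] show ?thesis by (simp add: vimage_def)
      qed
      moreover have "finite {n. x (2 * n + 1) = z}"
      proof -
        have "inj (\<lambda>n. x (2 * n + 1))" by (rule injI) (use injD[OF x(1)] in fastforce)
        from finite_vimageI[OF _ this, of "{z}"] show ?thesis by (simp add: vimage_def)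
      qed
      ultimately show "finite {n. \<not> (if z \<in> S n then \<bar>a n z\<bar> else 0) = 0}"
        using finite_subset by blast
    qed
  qed blast
qed

text \<open>A form of the theorem of Rosenthal and Lacey that \<open>C(K)\<close> has an infinite-dimensional separable quotient. If \<open>p\<close> is
isolated in the derived set \<open>D\<close>, then every sequence of distinct points of \<open>K\<close> in a small neighbourhood of
\<open>p\<close> converges to \<open>p\<close>, as its accumulation points lie in \<open>D\<close>.\<close>

theorem infinite_compact_basic_sequence:
  assumes Z: "tychonoff_space Z" and K: "compactin Z K" "infinite K"
  shows "\<exists>y. basic_sequence (weak_star (Ck Z)) y"
proof -
  define D where "D = {x \<in> K. \<forall>U. openin Z U \<and> x \<in> U \<longrightarrow> infinite (U \<inter> K)}"
  have Kt: "K \<subseteq> topspace Z" using K(1) by (rule compactin_subset_topspace)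
  obtain p0 where "p0 \<in> K" "\<And>U. openin Z U \<Longrightarrow> p0 \<in> U \<Longrightarrow> infinite (U \<inter> K)"
    using compactin_infinite_accumulation[OF K(1) subset_refl K(2)] by blast
  then have "D \<noteq> {}" by (auto simp: D_def)
  show ?thesis
  proof (cases "\<forall>U. openin Z U \<and> U \<inter> D \<noteq> {} \<longrightarrow> (\<exists>a\<in>U \<inter> D. \<exists>b\<in>U \<inter> D. a \<noteq> b)")
    case True
    have "D \<subseteq> topspace Z" using Kt by (auto simp: D_def)
    obtain r :: "nat \<Rightarrow> 'a \<Rightarrow> real" where r: "\<And>n. r n \<in> cfun Z" "\<And>n z. \<bar>r n z\<bar> \<le> 1"
      "\<And>m \<epsilon>. \<epsilon> \<in> {..<m} \<rightarrow>\<^sub>E {-1, 1} \<Longrightarrow> \<exists>x\<in>D. \<forall>i<m. r i x = \<epsilon> i"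
      using independent_functions_on_perfect_set[OF Z \<open>D \<noteq> {}\<close> \<open>D \<subseteq> topspace Z\<close>] True by metis
    show ?thesis
    proof (rule independent_functions_basic_sequence[OF K(1) r(1,2)])
      fix m and \<epsilon> :: "nat \<Rightarrow> real" assume "\<epsilon> \<in> {..<m} \<rightarrow>\<^sub>E {-1, 1}"
      from r(3)[OF this] show "\<exists>x\<in>K. \<forall>i<m. r i x = \<epsilon> i" by (auto simp: D_def)
    qed
  next
    case False
    then obtain U where U0: "openin Z U" "U \<inter> D \<noteq> {}" "\<not> (\<exists>a\<in>U \<inter> D. \<exists>b\<in>U \<inter> D. a \<noteq> b)"
      by (simp only: not_all not_imp) (elim exE conjE)
    then obtain p where p: "p \<in> U" "p \<in> D" by (auto simp only: ex_in_conv[symmetric] Int_iff)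
    have "q = p" if q: "q \<in> U \<inter> D" for q
    proof (rule ccontr)
      assume "q \<noteq> p"
      then have "\<exists>b\<in>U \<inter> D. q \<noteq> b" using p by (intro bexI[of _ p]) simp_all
      then have "\<exists>a\<in>U \<inter> D. \<exists>b\<in>U \<inter> D. a \<noteq> b" using q by (rule bexI)
      with U0(3) show False by (rule notE)
    qed
    with U0(1) p have U: "openin Z U" "p \<in> U" "p \<in> D" "\<And>q. q \<in> U \<inter> D \<Longrightarrow> q = p" .
    obtain u where u: "u \<in> cfun Z" "u p = 1" "\<And>z. z \<notin> U \<Longrightarrow> u z = 0"
      by (rule tychonoff_bump[OF Z U(1,2)]) (rule that)
    have uc: "continuous_map Z euclideanreal u" by (rule cfun_continuous[OF u(1)])
    define V where "V = {z \<in> topspace Z. u z \<in> {1/2<..}}"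
    have V: "openin Z V" unfolding V_def by (rule openin_continuous_map_preimage[OF uc]) simp
    have "p \<in> V" using U(1,2) openin_subset u(2) by (fastforce simp: V_def)
    then have "infinite (V \<inter> K)" using U(3) V by (auto simp: D_def)
    then obtain x :: "nat \<Rightarrow> 'a" where x: "inj x" "range x \<subseteq> V \<inter> K"
      using infinite_countable_subset by blast
    show ?thesis
    proof (rule convergent_sequence_basic_sequence[OF Z x(1)])
      show "range x \<subseteq> topspace Z" using x(2) Kt by blast
      fix f assume f: "f \<in> cfun Z"
      show "(\<lambda>n. f (x n)) \<longlonglongrightarrow> f p"
      proof (rule tendstoI, rule eventually_outside_finite_preimage, rule ccontr)
        fix e :: real assume e: "e > 0"
        define W where "W = {z \<in> topspace Z. f z \<in> ball (f p) e}"
        have W: "openin Z W" unfolding W_def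
          by (rule openin_continuous_map_preimage[OF cfun_continuous[OF f]]) simp
        assume inf: "infinite {n. \<not> dist (f (x n)) (f p) < e}"
        define S where "S = x ` {n. \<not> dist (f (x n)) (f p) < e}"
        have "infinite S" unfolding S_def using inf x(1) by (simp add: finite_image_iff inj_on_subset)
        moreover have "S \<subseteq> K" using x(2) by (auto simp: S_def)
        ultimately obtain q where q: "q \<in> K" "\<And>U. openin Z U \<Longrightarrow> q \<in> U \<Longrightarrow> infinite (U \<inter> S)"
          using compactin_infinite_accumulation[OF K(1)] by blast
        have "W \<inter> S = {}" by (auto simp: W_def S_def dist_commute)
        then have "q \<notin> W" using q(2)[OF W] by auto
        moreover have "q \<in> D"
          using q finite_subset[OF Int_mono[OF subset_refl \<open>S \<subseteq> K\<close>]] by (auto simp: D_def)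
        moreover have "q \<in> U"
        proof (rule ccontr)
          assume "q \<notin> U"
          define V' where "V' = {z \<in> topspace Z. u z \<in> {..<1/2}}"
          have "openin Z V'" unfolding V'_def by (rule openin_continuous_map_preimage[OF uc]) simp
          moreover have "q \<in> V'" using u(3)[OF \<open>q \<notin> U\<close>] q(1) Kt by (auto simp: V'_def)
          ultimately have "infinite (V' \<inter> S)" by (rule q(2))
          moreover have "1/2 < u (x n)" for n
          proof -
            have "x n \<in> V" using x(2) by blast
            then show ?thesis by (simp add: V_def)
          qed
          then have "x n \<notin> V'" for n by (simp add: V'_def not_less less_imp_le)
          then have "V' \<inter> S = {}" by (auto simp: S_def)
          ultimately show False by simp
        qed
        ultimately have "p \<notin> W" using U(4)[of q] by auto
        then show False using e U(1,2) openin_subset by (fastforce simp: W_def)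
      qed
    qed
  qed
qed

section \<open>Discrete C*-embedded subsets and barrelled spaces\<close>

lemma dual_Ck_finite_support:
  assumes "\<mu> \<in> dual (Ck Z)" and fin: "\<And>K. compactin Z K \<Longrightarrow> finite K"
  obtains K where "finite K" "K \<subseteq> topspace Z"
    "\<And>f. f \<in> cfun Z \<Longrightarrow> (\<And>z. z \<in> K \<Longrightarrow> f z = 0) \<Longrightarrow> \<mu> f = 0"
proof -
  obtain K M where K: "compactin Z K" "M \<ge> 0"
    "\<forall>f\<in>cfun Z. \<forall>c\<ge>0. (\<forall>z\<in>K. \<bar>f z\<bar> \<le> c) \<longrightarrow> \<bar>\<mu> f\<bar> \<le> M * c"
    using dual_Ck_bound[OF assms(1)] by (elim exE conjE)
  have "\<mu> f = 0" if "f \<in> cfun Z" "\<And>z. z \<in> K \<Longrightarrow> f z = 0" for f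
    using K(3)[rule_format, OF that(1), of 0] that(2) by simp
  then show ?thesis using K(1) fin by (intro that[of K] compactin_subset_topspace) simp_all
qed

text \<open>The functional \<open>y n\<close> has mass \<open>2 ^ (- i)\<close> at \<open>d n i\<close> for \<open>i \<le> n\<close>. Let \<open>\<mu>\<close> vanish on the common
kernel and have finite support \<open>K\<close>. The columns \<open>d _ j\<close>, restricted to large first index, have disjoint closures by
C*-embedding, so the closure of one of the first \<open>card K + 1\<close> columns misses \<open>K\<close>. Changing a bounded function on this
column alone brings it into the common kernel without affecting \<open>\<mu>\<close>; the weight of the column does not depend on \<open>n\<close>,
so the change remains bounded. Hence \<open>\<mu>\<close> is a linear combination of finitely many \<open>y n\<close>.\<close>

theorem C_star_embedded_basic_sequence_finite_compacts:
  fixes d :: "nat \<Rightarrow> nat \<Rightarrow> 'a"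
  assumes Z: "tychonoff_space Z" and fin: "\<And>K. compactin Z K \<Longrightarrow> finite K"
    and d: "\<And>n i. d n i \<in> topspace Z" "inj (\<lambda>p. d (fst p) (snd p))"
    and ext: "\<And>c B. (\<And>n i. \<bar>c n i\<bar> \<le> B) \<Longrightarrow> \<exists>g\<in>cfun Z. \<forall>n i. g (d n i) = c n i"
  shows "\<exists>y. basic_sequence (weak_star (Ck Z)) y"
proof -
  define y where "y n = (\<Sum>i\<le>n. (1/2) ^ i *\<^sub>R dirac Z (d n i))" for n
  have yd: "y n \<in> dual (Ck Z)" for n
    unfolding y_def
    by (rule subspace_sum[OF subspace_dual], rule subspace_scale[OF subspace_dual], rule dirac_in_dual, rule d)
  have yf: "y n f = (\<Sum>i\<le>n. (1/2) ^ i * f (d n i))" if "f \<in> cfun Z" for n f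
    unfolding y_def sum_scaleR_fun_apply using that by (simp add: dirac_def)
  have "\<exists>g\<in>cfun Z. \<forall>m i. g (d m i) = (if m = n \<and> i = 0 then 1 else 0)" for n
    by (rule ext[of _ 1]) simp
  then have "\<forall>n. \<exists>g. g \<in> cfun Z \<and> (\<forall>m i. g (d m i) = (if m = n \<and> i = 0 then 1 else 0))" by blast
  from choice[OF this] obtain e where
    e': "\<forall>n. e n \<in> cfun Z \<and> (\<forall>m i. e n (d m i) = (if m = n \<and> i = 0 then 1 else 0))" by (elim exE)
  have e: "e n \<in> cfun Z" "e n (d m i) = (if m = n \<and> i = 0 then 1 else 0)" for n m i
    using e' by simp_all
  have ye: "y m (e n) = (if m = n then 1 else 0)" for m n
  proof -
    have "y m (e n) = (\<Sum>i\<le>m. if i = 0 then (if m = n then 1 else 0) else 0)"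
      unfolding yf[OF e(1)] by (rule sum.cong) (simp_all add: e)
    then show ?thesis by simp
  qed
  have "basic_sequence (weak_star (Ck Z)) y"
  proof (rule weak_star_basic_sequence[of _ y e])
    fix \<mu> f assume \<mu>: "\<mu> \<in> dual (Ck Z)" and f: "f \<in> topspace (Ck Z)"
      and kill: "\<And>g. g \<in> topspace (Ck Z) \<Longrightarrow> (\<And>n. y n g = 0) \<Longrightarrow> \<mu> g = 0"
    obtain K where K: "finite K" "K \<subseteq> topspace Z"
      "\<And>f. f \<in> cfun Z \<Longrightarrow> (\<And>z. z \<in> K \<Longrightarrow> f z = 0) \<Longrightarrow> \<mu> f = 0"
      using dual_Ck_finite_support[OF \<mu> fin] by blast
    have "finite ((\<lambda>p. d (fst p) (snd p)) -` K)" by (rule finite_vimageI[OF K(1) d(2)])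
    then have "finite (fst ` ((\<lambda>p. d (fst p) (snd p)) -` K))" by (rule finite_imageI)
    then obtain N1 where N1: "\<And>n. n \<in> fst ` ((\<lambda>p. d (fst p) (snd p)) -` K) \<Longrightarrow> n < N1"
      by (meson finite_nat_bounded lessThan_iff subsetD)
    have dK: "d n i \<notin> K" if "N1 \<le> n" for n i
    proof
      assume "d n i \<in> K"
      then have "(n, i) \<in> (\<lambda>p. d (fst p) (snd p)) -` K" by simp
      then have "n \<in> fst ` ((\<lambda>p. d (fst p) (snd p)) -` K)"
        by (intro image_eqI[of n fst "(n, i)"]) simp_all
      then show False using N1 that by fastforce
    qed
    have "(\<Sum>n<N. \<mu> (e n) * y n f) = \<mu> f" if N: "max N1 (Suc (card K)) \<le> N" for N
    proof -
      define P where "P = (\<Sum>n<N. y n f *\<^sub>R e n)"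
      have P: "P \<in> cfun Z"
        unfolding P_def using e(1) by (intro subspace_sum subspace_scale subspace_cfun)
      have f': "f \<in> cfun Z" using f by simp
      define g where "g = f - P"
      have g: "g \<in> cfun Z" unfolding g_def by (rule subspace_diff[OF subspace_cfun f' P])
      have ev: "\<phi> g = \<phi> f - (\<Sum>n<N. y n f * \<phi> (e n))" if "\<phi> \<in> dual (Ck Z)" for \<phi>
        using dual_diff[OF that, of f P] subspace_cfun[of Z] f' P
          dual_sum[OF that, of "{..<N}" e "\<lambda>n. y n f"] e(1) by (simp add: P_def g_def)
      have yg: "y m g = 0" if "m < N" for m
      proof -
        have "(\<Sum>n<N. y n f * y m (e n)) = (\<Sum>n<N. if n = m then y n f else 0)"
          by (intro sum.cong) (auto simp: ye)
        then show ?thesis unfolding ev[OF yd] using that by simp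
      qed
      define T where "T = K \<union> (\<Union>n<N. d n ` {..n})"
      have finT: "finite ((\<lambda>t. \<bar>g t\<bar>) ` T)" using K(1) by (simp add: T_def)
      define B where "B = Max (insert 0 ((\<lambda>t. \<bar>g t\<bar>) ` T))"
      have B: "0 \<le> B" "\<And>t. t \<in> T \<Longrightarrow> \<bar>g t\<bar> \<le> B"
        unfolding B_def using finT by (auto intro!: Max_ge)
      \<comment> \<open>Truncation does not affect \<open>\<mu>\<close> and the first \<open>N\<close> functionals and makes all further values \<open>y n gc\<close> bounded.\<close>
      define gc where "gc = (\<lambda>z. max (- B) (min B (g z)))"
      have gc: "gc \<in> cfun Z" unfolding gc_def by (rule cfun_lambda_intros(5)[OF g B(1)])
      have gcB: "\<bar>gc z\<bar> \<le> B" for z using B(1) by (auto simp: gc_def)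
      have gcT: "gc t = g t" if "t \<in> T" for t using B(2)[OF that] by (auto simp: gc_def)
      have "\<mu> (gc - g) = 0"
        by (rule K(3)[OF subspace_diff[OF subspace_cfun gc g]]) (simp add: gcT T_def)
      then have \<mu>gc: "\<mu> gc = \<mu> g" using dual_diff[OF \<mu>, of gc g] subspace_cfun[of Z] gc g by simp
      have ygc: "y m gc = 0" if "m < N" for m
      proof -
        have "y m gc = y m g" unfolding yf[OF gc] yf[OF g]
        proof (rule sum.cong[OF refl])
          fix i assume "i \<in> {..m}"
          then have "d m i \<in> T" using that unfolding T_def by blast
          then show "(1/2) ^ i * gc (d m i) = (1/2) ^ i * g (d m i)" by (simp add: gcT)
        qed
        then show ?thesis using yg[OF that] by simp
      qed
      define \<beta> where "\<beta> n = y n gc" for n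
      have \<beta>: "\<bar>\<beta> n\<bar> \<le> 2 * B" for n
      proof -
        have "\<bar>\<beta> n\<bar> \<le> (\<Sum>i\<le>n. \<bar>(1/2) ^ i * gc (d n i)\<bar>)" unfolding \<beta>_def yf[OF gc] by (rule sum_abs)
        also have "\<dots> \<le> (\<Sum>i\<le>n. (1/2) ^ i * B)"
          by (intro sum_mono) (simp add: abs_mult gcB mult_left_mono power_abs)
        also have "\<dots> = (\<Sum>i\<le>n. (1/2) ^ i) * B" by (simp add: sum_distrib_right)
        also have "\<dots> \<le> 2 * B"
        proof (rule mult_right_mono[OF _ B(1)])
          have "(\<Sum>i<Suc n. (1/2::real) ^ i) = ((1/2) ^ Suc n - 1) / (1/2 - 1)"
            by (rule geometric_sum) simp
          then show "(\<Sum>i\<le>n. (1/2::real) ^ i) \<le> 2" by (simp add: lessThan_Suc_atMost)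
        qed
        finally show ?thesis .
      qed
      define H where "H j = (\<lambda>n. d n j) ` {N..}" for j
      have Ht: "H j \<subseteq> topspace Z" for j using d(1) by (auto simp: H_def)
      have disj: "i = j" if z: "z \<in> Z closure_of H i" "z \<in> Z closure_of H j" for z i j
      proof (rule ccontr)
        assume "i \<noteq> j"
        have "\<exists>g\<in>cfun Z. \<forall>n k. g (d n k) = (if k = i then 1 else 0)" by (rule ext[of _ 1]) simp
        then obtain x where x: "x \<in> cfun Z" "\<And>n k. x (d n k) = (if k = i then 1 else 0)" by blast
        have cl: "Z closure_of H k \<subseteq> {z \<in> topspace Z. x z \<in> {if k = i then 1 else 0}}" for k
        proof (rule closure_of_minimal)
          show "H k \<subseteq> {z \<in> topspace Z. x z \<in> {if k = i then 1 else 0}}"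
            using d(1) x(2) by (auto simp: H_def)
          show "closedin Z {z \<in> topspace Z. x z \<in> {if k = i then 1 else 0}}"
            by (rule closedin_continuous_map_preimage[OF cfun_continuous[OF x(1)]]) simp
        qed
        have "x z = 1" "x z = 0"
          using subsetD[OF cl z(1)] subsetD[OF cl z(2)] \<open>i \<noteq> j\<close> by simp_all
        then show False by simp
      qed
      have "\<exists>j\<le>card K. K \<inter> Z closure_of H j = {}"
      proof (rule ccontr)
        assume "\<not> ?thesis"
        then have "\<forall>j. \<exists>z. j \<le> card K \<longrightarrow> z \<in> K \<inter> Z closure_of H j" by blast
        from choice[OF this] obtain t where t: "\<forall>j. j \<le> card K \<longrightarrow> t j \<in> K \<inter> Z closure_of H j"
          by (elim exE)
        have "inj_on t {..card K}"
        proof (rule inj_onI)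
          fix i j assume "i \<in> {..card K}" "j \<in> {..card K}" "t i = t j"
          then have "t i \<in> Z closure_of H i" "t i \<in> Z closure_of H j" using t by auto
          then show "i = j" by (rule disj)
        qed
        moreover have "t ` {..card K} \<subseteq> K" using t by auto
        ultimately have "card {..card K} \<le> card K" by (rule card_inj_on_le[OF _ _ K(1)])
        then show False by simp
      qed
      then obtain j where j: "j \<le> card K" "K \<inter> Z closure_of H j = {}" by blast
      have "\<exists>g\<in>cfun Z. \<forall>n k. g (d n k) = (if N \<le> n \<and> k = j then \<beta> n * 2 ^ j else 0)"
      proof (rule ext[of _ "2 * B * 2 ^ j"])
        show "\<bar>if N \<le> n \<and> k = j then \<beta> n * 2 ^ j else 0\<bar> \<le> 2 * B * 2 ^ j" for n k
          using \<beta>[of n] B(1) by (simp add: abs_mult)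
      qed
      then obtain w where w: "w \<in> cfun Z" "\<And>n k. w (d n k) = (if N \<le> n \<and> k = j then \<beta> n * 2 ^ j else 0)"
        by blast
      obtain u where u: "u \<in> cfun Z" "\<And>a. a \<in> K \<Longrightarrow> u a = 1" "\<And>z. z \<in> Z closure_of H j \<Longrightarrow> u z = 0"
        by (rule tychonoff_interpolation[OF Z K(1,2) closedin_closure_of j(2), of "\<lambda>_. 1" 1]) auto
      \<comment> \<open>Equal to \<open>w\<close> on all points \<open>d n k\<close>, but zero on the support of \<open>\<mu>\<close>.\<close>
      define q where "q = (\<lambda>z. w z - w z * u z)"
      have q: "q \<in> cfun Z" unfolding q_def by (intro cfun_lambda_intros w u)
      have qd: "q (d n k) = w (d n k)" for n k
      proof (cases "N \<le> n \<and> k = j")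
        case True
        then have "d n k \<in> H j" by (auto simp: H_def)
        then have "d n k \<in> Z closure_of H j" using closure_of_subset[OF Ht] by blast
        then show ?thesis by (simp add: q_def u)
      next
        case False
        then have "w (d n k) = 0" by (simp only: w if_False)
        then show ?thesis by (simp add: q_def)
      qed
      have yq: "y n q = \<beta> n" for n
      proof (cases "N \<le> n")
        case True
        then have "j \<le> n" using N j(1) by simp
        have "y n q = (\<Sum>i\<le>n. if i = j then \<beta> n else 0)"
          unfolding yf[OF q] by (rule sum.cong) (use True in \<open>simp_all add: qd w power_one_over\<close>)
        then show ?thesis using \<open>j \<le> n\<close> by simp
      next
        case False
        then show ?thesis unfolding yf[OF q] using ygc[of n] by (simp add: qd w \<beta>_def)
      qed
      have "\<mu> (gc - q) = 0"
      proof (rule kill)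
        show "gc - q \<in> topspace (Ck Z)" using subspace_diff[OF subspace_cfun gc q] by simp
        show "y n (gc - q) = 0" for n
          using dual_diff[OF yd[of n], of gc q] subspace_cfun[of Z] gc q yq[of n] by (simp add: \<beta>_def)
      qed
      moreover have "\<mu> q = 0" by (rule K(3)[OF q]) (simp add: q_def u)
      ultimately have "\<mu> gc = 0" using dual_diff[OF \<mu>, of gc q] subspace_cfun[of Z] gc q by simp
      then show ?thesis using \<mu>gc unfolding ev[OF \<mu>] by (simp add: mult.commute)
    qed
    then show "(\<lambda>N. \<Sum>n<N. \<mu> (e n) * y n f) \<longlonglongrightarrow> \<mu> f"
      by (intro tendsto_eventually eventually_sequentiallyI[of "max N1 (Suc (card K))"])
  qed (simp_all only: topspace_Ck subspace_cfun yd e ye)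
  then show ?thesis by blast
qed

theorem C_star_embedded_basic_sequence:
  assumes Z: "tychonoff_space Z" and D: "infinite D" "subtopology Z D = discrete_topology D"
    "C_star_embedded Z D"
  shows "\<exists>y. basic_sequence (weak_star (Ck Z)) y"
proof (cases "\<exists>K. compactin Z K \<and> infinite K")
  case True
  then show ?thesis using infinite_compact_basic_sequence[OF Z] by blast
next
  case False
  have DZ: "D \<subseteq> topspace Z" using D(3) by (simp add: C_star_embedded_def)
  obtain x :: "nat \<Rightarrow> 'a" where x: "inj x" "range x \<subseteq> D"
    using infinite_countable_subset[OF D(1)] by blast
  define d where "d n i = x (prod_encode (n, i))" for n i
  show ?thesis
  proof (rule C_star_embedded_basic_sequence_finite_compacts[OF Z, of d])
    show "finite K" if "compactin Z K" for K using False that by blast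
    show "d n i \<in> topspace Z" for n i using x(2) DZ by (auto simp: d_def)
    have "inj (x \<circ> prod_encode)" by (rule inj_compose[OF x(1) inj_prod_encode])
    then show "inj (\<lambda>p. d (fst p) (snd p))" by (simp add: d_def comp_def)
    fix c :: "nat \<Rightarrow> nat \<Rightarrow> real" and B assume c: "\<And>n i. \<bar>c n i\<bar> \<le> B"
    define k where "k z = (if z \<in> range x then case_prod c (prod_decode (inv x z)) else 0)" for z
    have "\<bar>k z\<bar> \<le> max 0 B" for z using c by (auto simp: k_def split: prod.split intro: max.coboundedI2)
    then have "bounded (k ` D)" by (auto simp: bounded_iff)
    moreover have "continuous_map (subtopology Z D) euclideanreal k" by (simp add: D(2))
    ultimately obtain g where g: "continuous_map Z euclideanreal g" "\<And>z. z \<in> D \<Longrightarrow> g z = k z"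
      using D(3) unfolding C_star_embedded_def by blast
    define g' where "g' z = (if z \<in> topspace Z then g z else 0)" for z
    have "continuous_map Z euclideanreal g'"
      by (rule continuous_map_eq[OF g(1)]) (simp add: g'_def)
    then have "g' \<in> cfun Z" by (simp add: cfun_def g'_def)
    moreover have "g' (d n i) = c n i" for n i
    proof -
      have "d n i \<in> D" using x(2) by (auto simp: d_def)
      then have "g' (d n i) = k (d n i)" using DZ by (auto simp: g'_def g)
      also have "\<dots> = c n i" by (simp add: k_def d_def inv_f_f[OF x(1)])
      finally show ?thesis .
    qed
    ultimately show "\<exists>g\<in>cfun Z. \<forall>n i. g (d n i) = c n i" by blast
  qed
qed

text \<open>Along a sequence on which \<open>\<bar>f\<bar>\<close> increases by more than one at each step, bounded functions extend by
composing \<open>\<bar>f\<bar>\<close> with a function on the real line obtained from Tietze's theorem.\<close>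

lemma unbounded_function_discrete_set:
  assumes f: "f \<in> cfun Z" and unb: "\<And>c. \<exists>z. \<bar>f z\<bar> > c"
  obtains D where "infinite D" "subtopology Z D = discrete_topology D" "C_star_embedded Z D"
proof -
  have "\<forall>c. \<exists>z. \<bar>f z\<bar> > c" using unb by blast
  from choice[OF this] obtain s where s: "\<forall>c. \<bar>f (s c)\<bar> > c" by (elim exE)
  define z where "z = rec_nat (s 0) (\<lambda>_ w. s (\<bar>f w\<bar> + 1))"
  have z0: "z 0 = s 0" and zS: "\<And>n. z (Suc n) = s (\<bar>f (z n)\<bar> + 1)" by (simp_all add: z_def)
  define t where "t n = \<bar>f (z n)\<bar>" for n
  have tS: "t n + 1 < t (Suc n)" for n using s by (simp add: t_def zS)
  have gap: "t n + 1 \<le> t m" if "n < m" for n m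
    using that
  proof (induction m)
    case (Suc m)
    then show ?case using tS[of m] by (cases "n = m") auto
  qed simp
  have sep: "n = m" if "dist (t n) (t m) < 1" for n m
    using that gap[of n m] gap[of m n] by (cases n m rule: linorder_cases) (auto simp: dist_real_def)
  have injz: "inj z"
  proof (rule injI)
    fix n m assume "z n = z m"
    then have "dist (t n) (t m) < 1" by (simp add: t_def)
    then show "n = m" by (rule sep)
  qed
  have t0: "t n > 0" for n
  proof (cases n)
    case 0
    then show ?thesis using s by (simp add: t_def z0)
  next
    case (Suc k)
    then show ?thesis using gap[of 0 n] by (simp add: t_def)
  qed
  have ztop: "z n \<in> topspace Z" for n
    using t0[of n] cfun_outside[OF f, of "z n"] by (auto simp: t_def)
  define D where "D = range z"
  have DZ: "D \<subseteq> topspace Z" using ztop by (auto simp: D_def)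
  have fa: "continuous_map Z euclideanreal (\<lambda>w. \<bar>f w\<bar>)"
    using cfun_continuous[OF f] by (rule continuous_map_real_abs)
  have "openin (subtopology Z D) {w}" if "w \<in> D" for w
  proof -
    obtain n where n: "w = z n" using \<open>w \<in> D\<close> by (auto simp: D_def)
    have "openin Z {u \<in> topspace Z. \<bar>f u\<bar> \<in> ball (t n) 1}"
      by (rule openin_continuous_map_preimage[OF fa]) simp
    moreover have "{u \<in> topspace Z. \<bar>f u\<bar> \<in> ball (t n) 1} \<inter> D = {w}"
      using ztop sep by (auto simp: D_def n t_def)
    ultimately show ?thesis unfolding openin_subtopology by metis
  qed
  then have "discrete_topology D = subtopology Z D"
    using DZ by (subst discrete_topology_unique) auto
  moreover have "C_star_embedded Z D"
    unfolding C_star_embedded_def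
  proof (intro conjI allI impI DZ)
    fix g :: "'a \<Rightarrow> real" assume g: "continuous_map (subtopology Z D) euclideanreal g \<and> bounded (g ` D)"
    then obtain B where B: "\<And>w. w \<in> D \<Longrightarrow> \<bar>g w\<bar> \<le> B" by (auto simp: bounded_iff)
    have B0: "0 \<le> B" using B[of "z 0"] by (simp add: D_def)
    define k where "k r = g (z (inv t r))" for r
    have injt: "inj t" by (rule injI) (rule sep, simp)
    have kt: "k (t n) = g (z n)" for n by (simp add: k_def inv_f_f[OF injt])
    have "closed (range t)"
      by (rule discrete_imp_closed[of 1]) (use sep in auto)
    moreover have "continuous_on (range t) k"
      unfolding continuous_on_iff
    proof (intro ballI allI impI)
      fix x e :: real assume "x \<in> range t" "0 < e"
      show "\<exists>d>0. \<forall>x'\<in>range t. dist x' x < d \<longrightarrow> dist (k x') (k x) < e"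
      proof (intro exI[of _ 1] conjI ballI impI)
        fix x' assume "x' \<in> range t" "dist x' x < 1"
        then have "x' = x" using \<open>x \<in> range t\<close> sep by auto
        then show "dist (k x') (k x) < e" using \<open>0 < e\<close> by simp
      qed simp
    qed
    ultimately obtain G where G: "continuous_on UNIV G" "\<And>x. x \<in> range t \<Longrightarrow> G x = k x"
      using Tietze_unbounded[of "range t" k UNIV] by auto
    define g' where "g' w = max (- B) (min B (G \<bar>f w\<bar>))" for w
    have Gc: "continuous_map euclideanreal euclideanreal G" using G(1) by simp
    have "continuous_map Z euclideanreal (\<lambda>w. G \<bar>f w\<bar>)"
      using continuous_map_compose[OF fa Gc] by (simp only: o_def)
    then have "continuous_map Z euclideanreal g'"
      unfolding g'_def by (intro continuous_intros)
    moreover have "bounded (g' ` topspace Z)"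
      using B0 by (auto simp: bounded_iff g'_def intro!: exI[of _ B])
    moreover have "g' w = g w" if "w \<in> D" for w
    proof -
      obtain n where n: "w = z n" using \<open>w \<in> D\<close> by (auto simp: D_def)
      have "G \<bar>f w\<bar> = g w" using G(2)[of "t n"] kt[of n] by (simp add: n t_def)
      then show ?thesis using B[OF that] by (auto simp: g'_def)
    qed
    ultimately show "\<exists>g'. continuous_map Z euclideanreal g' \<and> bounded (g' ` topspace Z) \<and> (\<forall>x\<in>D. g' x = g x)"
      by blast
  qed
  moreover have "infinite D" unfolding D_def using injz by (simp add: finite_image_iff)
  ultimately show ?thesis by (intro that[of D]) simp_all
qed

corollary unbounded_function_basic_sequence:
  assumes "tychonoff_space Z" "f \<in> cfun Z" "\<And>c. \<exists>z. \<bar>f z\<bar> > c"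
  shows "\<exists>y. basic_sequence (weak_star (Ck Z)) y"
  using unbounded_function_discrete_set[OF assms(2,3)] C_star_embedded_basic_sequence[OF assms(1)]
  by blast

text \<open>Otherwise every compact set is finite and every continuous function is bounded. Then the functions bounded by one form a barrel, but a
neighbourhood of zero contains functions that are arbitrarily large outside some finite set.\<close>

theorem barrelled_basic_sequence:
  assumes Z: "tychonoff_space Z" "infinite (topspace Z)" and bar: "barrelled (Ck Z)"
  shows "\<exists>y. basic_sequence (weak_star (Ck Z)) y"
proof (rule ccontr)
  assume no: "\<not> ?thesis"
  then have fin: "finite K" if "compactin Z K" for K
    using infinite_compact_basic_sequence[OF Z(1) that] by blast
  have bdd: "\<exists>c. \<forall>z. \<bar>f z\<bar> \<le> c" if "f \<in> cfun Z" for f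
    using unbounded_function_basic_sequence[OF Z(1) that] no by (meson not_le)
  define B where "B = {f \<in> cfun Z. \<forall>z\<in>topspace Z. \<bar>f z\<bar> \<le> 1}"
  have ne: "topspace Z \<noteq> {}" using Z(2) by auto
  have "barrel (Ck Z) B"
    unfolding barrel_def
  proof (intro conjI)
    have "closedin (Ck Z) {f \<in> topspace (Ck Z). dirac Z z f \<in> {-1..1}}" if "z \<in> topspace Z" for z
      by (rule closedin_continuous_map_preimage[OF dual_continuous[OF dirac_in_dual[OF that]]]) simp
    then have "closedin (Ck Z) (\<Inter>z\<in>topspace Z. {f \<in> topspace (Ck Z). dirac Z z f \<in> {-1..1}})"
      using ne by (intro closedin_INT) auto
    moreover have "(\<Inter>z\<in>topspace Z. {f \<in> topspace (Ck Z). dirac Z z f \<in> {-1..1}}) = B"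
    proof -
      obtain z0 where "z0 \<in> topspace Z" using ne by blast
      then show ?thesis by (auto simp: B_def dirac_def abs_le_iff minus_le_iff)
    qed
    ultimately show "closedin (Ck Z) B" by simp
    show "convex B"
    proof (rule convexI)
      fix f g u v assume fg: "f \<in> B" "g \<in> B" and uv: "0 \<le> u" "0 \<le> v" "u + v = (1::real)"
      have "u *\<^sub>R f + v *\<^sub>R g \<in> cfun Z"
        using fg by (intro subspace_add subspace_scale subspace_cfun) (simp_all add: B_def)
      moreover have "\<bar>(u *\<^sub>R f + v *\<^sub>R g) z\<bar> \<le> 1" if "z \<in> topspace Z" for z
      proof -
        have "\<bar>u * f z + v * g z\<bar> \<le> u * \<bar>f z\<bar> + v * \<bar>g z\<bar>"
          using abs_triangle_ineq[of "u * f z" "v * g z"] uv by (simp add: abs_mult)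
        also have "\<dots> \<le> u * 1 + v * 1"
          using fg uv that by (intro add_mono mult_left_mono) (simp_all add: B_def)
        finally show ?thesis using uv by (simp add: scaleR_fun_def)
      qed
      ultimately show "u *\<^sub>R f + v *\<^sub>R g \<in> B" by (simp add: B_def)
    qed
    have scaled: "c *\<^sub>R f \<in> B" if "f \<in> cfun Z" "\<And>z. \<bar>c\<bar> * \<bar>f z\<bar> \<le> 1" for c f
      using that subspace_scale[OF subspace_cfun that(1), of c]
      by (simp add: B_def) (simp add: scaleR_fun_def abs_mult)
    show "\<forall>c. \<forall>x\<in>B. \<bar>c\<bar> \<le> 1 \<longrightarrow> c *\<^sub>R x \<in> B"
    proof (intro allI ballI impI)
      fix c :: real and f assume f: "f \<in> B" and c: "\<bar>c\<bar> \<le> 1"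
      have "\<bar>f z\<bar> \<le> 1" for z
        using f cfun_outside[of f Z z] by (cases "z \<in> topspace Z") (auto simp: B_def)
      then have "\<bar>c\<bar> * \<bar>f z\<bar> \<le> 1" for z using mult_mono[OF c, of "\<bar>f z\<bar>" 1] by simp
      then show "c *\<^sub>R f \<in> B" using f by (intro scaled) (simp_all add: B_def)
    qed
    show "\<forall>f\<in>topspace (Ck Z). \<exists>r>0. \<forall>c. \<bar>c\<bar> \<le> r \<longrightarrow> c *\<^sub>R f \<in> B"
    proof
      fix f assume "f \<in> topspace (Ck Z)"
      then have f: "f \<in> cfun Z" by simp
      obtain M where M: "\<forall>z. \<bar>f z\<bar> \<le> M" using bdd[OF f] by blast
      have M0: "0 \<le> M" using M order_trans[OF abs_ge_zero] by blast
      have "c *\<^sub>R f \<in> B" if "\<bar>c\<bar> \<le> 1 / (M + 1)" for c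
      proof (rule scaled[OF f])
        fix z
        have "\<bar>c\<bar> * \<bar>f z\<bar> \<le> 1 / (M + 1) * M"
          using that M M0 by (intro mult_mono) simp_all
        also have "\<dots> \<le> 1" using M0 by (simp add: field_simps)
        finally show "\<bar>c\<bar> * \<bar>f z\<bar> \<le> 1" .
      qed
      then show "\<exists>r>0. \<forall>c. \<bar>c\<bar> \<le> r \<longrightarrow> c *\<^sub>R f \<in> B"
        using M0 by (intro exI[of _ "1 / (M + 1)"]) simp
    qed
  qed
  then obtain U where U: "openin (Ck Z) U" "0 \<in> U" "U \<subseteq> B"
    using bar unfolding barrelled_def by metis
  obtain K e where K: "compactin Z K" "e > 0" "\<forall>f\<in>cfun Z. (\<forall>z\<in>K. \<bar>f z\<bar> < e) \<longrightarrow> f \<in> U"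
    using Ck_nbhd_0[OF U(1,2)] by (elim exE conjE)
  have Kf: "finite K" by (rule fin[OF K(1)])
  have KZ: "K \<subseteq> topspace Z" by (rule compactin_subset_topspace[OF K(1)])
  have "\<not> topspace Z \<subseteq> K" using Kf Z(2) finite_subset by blast
  then obtain x where x: "x \<in> topspace Z" "x \<notin> K" by blast
  have "closedin Z K"
    using Z(1) KZ Kf Hausdorff_imp_t1_space t1_space_closedin_finite
    by (auto simp: tychonoff_space_def)
  then have "\<exists>f\<in>cfun Z. f x = 2 \<and> (\<forall>z\<in>K. f z = 0)"
  proof (rule tychonoff_interpolation[where Z = Z and A = "{x}" and C = K and v = "\<lambda>_. 2" and B = 2, rotated 3])
    fix f assume "f \<in> cfun Z" "\<And>a. a \<in> {x} \<Longrightarrow> f a = 2" "\<And>z. z \<in> K \<Longrightarrow> f z = 0"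
    then show "\<exists>f\<in>cfun Z. f x = 2 \<and> (\<forall>z\<in>K. f z = 0)" by (intro bexI[of _ f]) simp_all
  qed (use x Z(1) in simp_all)
  then obtain f where f: "f \<in> cfun Z" "f x = 2" "\<And>z. z \<in> K \<Longrightarrow> f z = 0" by blast
  then have "f \<in> U" using K(2,3) by simp
  then have "f \<in> B" using U(3) by blast
  then have "\<bar>f x\<bar> \<le> 1" using x(1) by (simp add: B_def)
  then show False using f(2) by simp
qed

section \<open>Products on which every continuous function is bounded\<close>

text \<open>If the open sets were locally finite, bump functions in \<open>V n\<close> multiplied by \<open>n\<close> would add up to an
unbounded continuous function.\<close>

lemma open_sets_accumulate:
  assumes Z: "tychonoff_space Z" and bdd: "\<And>f. f \<in> cfun Z \<Longrightarrow> \<exists>c. \<forall>z. \<bar>f z\<bar> \<le> c"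
    and V: "\<And>n::nat. openin Z (V n)" "\<And>n. V n \<noteq> {}"
  obtains z where "z \<in> topspace Z" "\<And>U. openin Z U \<Longrightarrow> z \<in> U \<Longrightarrow> infinite {n. U \<inter> V n \<noteq> {}}"
proof (rule ccontr)
  assume "\<not> thesis"
  then have "\<forall>z. \<exists>U. z \<in> topspace Z \<longrightarrow> openin Z U \<and> z \<in> U \<and> finite {n. U \<inter> V n \<noteq> {}}"
    using that by blast
  from choice[OF this] obtain U where
    U: "\<forall>z. z \<in> topspace Z \<longrightarrow> openin Z (U z) \<and> z \<in> U z \<and> finite {n. U z \<inter> V n \<noteq> {}}" by (elim exE)
  have "\<forall>n. \<exists>h. h \<in> cfun Z \<and> (\<exists>z. h z = 1) \<and> (\<forall>z. z \<notin> V n \<longrightarrow> h z = 0) \<and> (\<forall>z. 0 \<le> h z)"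
    (is "\<forall>n. \<exists>h. ?R n h")
  proof
    fix n
    obtain z where "z \<in> V n" using V(2) by blast
    from tychonoff_bump[OF Z V(1) this] obtain h where "h \<in> cfun Z" "h z = 1" "\<And>z. 0 \<le> h z" "\<And>z. z \<notin> V n \<Longrightarrow> h z = 0"
      by metis
    then show "\<exists>h. ?R n h"
      by blast
  qed
  from choice[OF this] obtain h where
    h: "\<forall>n. ?R n (h n)"
    by (elim exE)
  define F where "F z = (\<Sum>n | z \<in> V n. real n * h n z)" for z
  define J where "J w = {n. U w \<inter> V n \<noteq> {}}" for w
  have FJ: "F z = (\<Sum>n\<in>J w. real n * h n z)" if "w \<in> topspace Z" "z \<in> U w" for z w
    unfolding F_def
    by (rule sum.mono_neutral_left) (use U h that in \<open>auto simp: J_def\<close>)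
  have "continuous_map Z euclideanreal F"
  proof (rule pasting_lemma[where I = "topspace Z" and T = U and f = "\<lambda>w z. \<Sum>n\<in>J w. real n * h n z"])
    show "openin Z (U w)" if "w \<in> topspace Z" for w using U that by blast
    show "continuous_map (subtopology Z (U w)) euclideanreal (\<lambda>z. \<Sum>n\<in>J w. real n * h n z)"
      if "w \<in> topspace Z" for w
    proof (rule continuous_map_from_subtopology[OF cfun_continuous], rule cfun_sum)
      show "(\<lambda>z. real n * h n z) \<in> cfun Z" for n using h by (intro cfun_lambda_intros(4)) blast
    qed
    show "(\<Sum>n\<in>J i. real n * h n x) = (\<Sum>n\<in>J j. real n * h n x)"
      if "i \<in> topspace Z" "j \<in> topspace Z" "x \<in> topspace Z \<inter> U i \<inter> U j" for i j x
      using FJ[OF that(1), of x] FJ[OF that(2), of x] that(3) by simp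
    show "\<exists>j. j \<in> topspace Z \<and> x \<in> U j \<and> F x = (\<Sum>n\<in>J j. real n * h n x)" if "x \<in> topspace Z" for x
      using U FJ[OF that, of x] that by (intro exI[of _ x]) simp
  qed
  moreover have "F z = 0" if "z \<notin> topspace Z" for z
  proof -
    have "{n. z \<in> V n} = {}" using V(1) openin_subset that by blast
    then show ?thesis by (simp add: F_def)
  qed
  ultimately have "F \<in> cfun Z" by (simp add: cfun_def)
  then obtain c where c: "\<forall>z. \<bar>F z\<bar> \<le> c" using bdd by blast
  obtain m :: nat where m: "c < real m" using reals_Archimedean2 by blast
  obtain z where z: "h m z = 1" using h by blast
  then have zm: "z \<in> V m" using h[rule_format, of m] by (metis zero_neq_one)
  then have zt: "z \<in> topspace Z" using V(1) openin_subset by blast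
  have "finite (J z)" using U zt by (simp add: J_def)
  moreover have "m \<in> J z" using U zt zm by (auto simp: J_def)
  ultimately have "real m * h m z \<le> (\<Sum>n\<in>J z. real n * h n z)"
    using h by (intro member_le_sum) simp_all
  also have "\<dots> = F z" using FJ[OF zt, of z] U zt by simp
  finally have "real m \<le> F z" by (simp add: z)
  then show False using c[rule_format, of z] m by linarith
qed

lemma openin_prod_rectangle:
  assumes "openin (prod_topology X Y) U" "(x, y) \<in> U"
  shows "\<exists>A B. openin X A \<and> openin Y B \<and> x \<in> A \<and> y \<in> B \<and> A \<times> B \<subseteq> U"
  using assms unfolding openin_prod_topology_alt by (elim allE impE)

text \<open>Suppose this fails at \<open>x0\<close> and write \<open>D (x, y) = \<bar>f (x, y) - f (x0, y)\<bar>\<close>. One finds rectangles \<open>A n \<times> B n\<close> on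
which \<open>D > e\<close> and decreasing neighbourhoods \<open>N n\<close> of \<open>x0\<close> such that \<open>A n \<subseteq> N n\<close> and \<open>D < e/2\<close> on \<open>N (n + 1) \<times> B n\<close>. At an
accumulation point \<open>(x, y)\<close> of the rectangles, \<open>D (x, y) \<ge> e\<close>, while \<open>D (x, v) \<le> e/2\<close> for all \<open>v\<close> in any \<open>B n\<close>, because
\<open>x\<close> is in the closure of every \<open>N n\<close>; continuity in the second variable gives a contradiction.\<close>

lemma product_slices_equicontinuous:
  fixes f :: "'a \<times> 'b \<Rightarrow> real"
  assumes Z: "tychonoff_space (prod_topology X Y)"
    and bdd: "\<And>g. g \<in> cfun (prod_topology X Y) \<Longrightarrow> \<exists>c. \<forall>z. \<bar>g z\<bar> \<le> c"
    and f: "f \<in> cfun (prod_topology X Y)" and x0: "x0 \<in> topspace X" and e: "e > 0"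
  obtains V where "openin X V" "x0 \<in> V" "\<And>x y. x \<in> V \<Longrightarrow> y \<in> topspace Y \<Longrightarrow> \<bar>f (x, y) - f (x0, y)\<bar> \<le> e"
proof (rule ccontr)
  note found = that
  assume contra: "\<not> thesis"
  have bad: "\<exists>x\<in>V. \<exists>y\<in>topspace Y. \<bar>f (x, y) - f (x0, y)\<bar> > e" if "openin X V" "x0 \<in> V" for V
  proof (rule ccontr)
    assume "\<not> (\<exists>x\<in>V. \<exists>y\<in>topspace Y. \<bar>f (x, y) - f (x0, y)\<bar> > e)"
    then have "\<bar>f (x, y) - f (x0, y)\<bar> \<le> e" if "x \<in> V" "y \<in> topspace Y" for x y
      using that by (meson not_le)
    then have thesis by (rule found[OF that])
    then show False using contra by simp
  qed
  define W where "W = prod_topology X Y"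
  define D where "D p = \<bar>f p - f (x0, snd p)\<bar>" for p
  have fc: "continuous_map W euclideanreal f" using f by (simp add: cfun_def W_def)
  have "continuous_map W W (\<lambda>p. (x0, snd p))"
    unfolding W_def using x0 by (intro continuous_map_pairedI) (auto intro: continuous_map_snd)
  then have "continuous_map W euclideanreal (\<lambda>p. f (x0, snd p))"
    using continuous_map_compose[OF _ fc, of W "\<lambda>p. (x0, snd p)"] by (simp add: o_def)
  then have Dc: "continuous_map W euclideanreal D"
    unfolding D_def using fc by (intro continuous_map_real_abs continuous_map_diff)
  have Dx0: "D (x0, y) = 0" for y by (simp add: D_def)
  have big: "openin W {p \<in> topspace W. D p \<in> {e<..}}"
    by (rule openin_continuous_map_preimage[OF Dc]) simp
  have small: "openin W {p \<in> topspace W. D p \<in> {..<e/2}}"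
    by (rule openin_continuous_map_preimage[OF Dc]) simp
  have "\<forall>N. \<exists>q. openin X N \<and> x0 \<in> N \<longrightarrow> openin X (fst q) \<and> fst q \<noteq> {} \<and> fst q \<subseteq> N \<and>
      openin Y (fst (snd q)) \<and> fst (snd q) \<noteq> {} \<and> openin X (snd (snd q)) \<and> x0 \<in> snd (snd q) \<and> snd (snd q) \<subseteq> N \<and>
      (\<forall>x\<in>fst q. \<forall>y\<in>fst (snd q). D (x, y) > e) \<and> (\<forall>x\<in>snd (snd q). \<forall>y\<in>fst (snd q). D (x, y) < e/2)"
    (is "\<forall>N. \<exists>q. ?R N q")
  proof
    fix N
    show "\<exists>q. ?R N q"
    proof (cases "openin X N \<and> x0 \<in> N")
      case True
      then obtain x y where xy: "x \<in> N" "y \<in> topspace Y" "D (x, y) > e"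
        using bad[of N] by (auto simp: D_def)
      have "x \<in> topspace X" using xy(1) True openin_subset by blast
      then have xyb: "(x, y) \<in> {p \<in> topspace W. D p \<in> {e<..}}" using xy by (simp add: W_def)
      obtain A B where AB: "openin X A" "openin Y B" "x \<in> A" "y \<in> B"
        "A \<times> B \<subseteq> {p \<in> topspace W. D p \<in> {e<..}}"
        using openin_prod_rectangle[OF big[unfolded W_def] xyb[unfolded W_def]] unfolding W_def by (elim exE conjE)
      have xys: "(x0, y) \<in> {p \<in> topspace W. D p \<in> {..<e/2}}" using xy x0 e by (simp add: W_def Dx0)
      obtain A' B' where AB': "openin X A'" "openin Y B'" "x0 \<in> A'" "y \<in> B'"
        "A' \<times> B' \<subseteq> {p \<in> topspace W. D p \<in> {..<e/2}}"
        using openin_prod_rectangle[OF small[unfolded W_def] xys[unfolded W_def]] unfolding W_def by (elim exE conjE)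
      show ?thesis
      proof (intro exI[of _ "(A \<inter> N, B \<inter> B', A' \<inter> N)"] impI, unfold fst_conv snd_conv, intro conjI ballI)
        show "D (u, v) > e" if "u \<in> A \<inter> N" "v \<in> B \<inter> B'" for u v using that AB(5) by blast
        show "D (u, v) < e/2" if "u \<in> A' \<inter> N" "v \<in> B \<inter> B'" for u v using that AB'(5) by blast
      qed (use AB AB' True xy in auto)
    qed (rule exI, rule impI, rule notE)
  qed
  from choice[OF this] obtain Q where Q: "\<forall>N. ?R N (Q N)"
    by (elim exE)
  define N where "N = rec_nat (topspace X) (\<lambda>_ N. snd (snd (Q N)))"
  have N0: "N 0 = topspace X" and NS: "\<And>n. N (Suc n) = snd (snd (Q (N n)))" by (simp_all add: N_def)
  have N: "openin X (N n) \<and> x0 \<in> N n" for n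
    by (induction n) (use Q x0 in \<open>auto simp: N0 NS\<close>)
  define A where "A n = fst (Q (N n))" for n
  define B where "B n = fst (snd (Q (N n)))" for n
  have AB: "openin X (A n)" "A n \<noteq> {}" "A n \<subseteq> N n" "openin Y (B n)" "B n \<noteq> {}" "N (Suc n) \<subseteq> N n"
    "\<And>x y. x \<in> A n \<Longrightarrow> y \<in> B n \<Longrightarrow> D (x, y) > e"
    "\<And>x y. x \<in> N (Suc n) \<Longrightarrow> y \<in> B n \<Longrightarrow> D (x, y) < e/2" for n
    using Q[rule_format, OF N[of n]] by (simp_all add: A_def B_def NS)
  have dec: "N m \<subseteq> N n" if "n \<le> m" for n m using that AB(6) by (rule lift_Suc_antimono_le[rotated])
  have ABW: "openin W (A n \<times> B n)" for n
    unfolding W_def using AB(1,4) by (simp add: openin_prod_Times_iff)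
  obtain p where p: "p \<in> topspace W" "\<And>U. openin W U \<Longrightarrow> p \<in> U \<Longrightarrow> infinite {n. U \<inter> (A n \<times> B n) \<noteq> {}}"
    using open_sets_accumulate[OF Z bdd, of "\<lambda>n. A n \<times> B n"] ABW AB(2,5) unfolding W_def
    by (auto simp: Sigma_empty_iff)
  obtain x y where xy: "p = (x, y)" by (cases p)
  have xyt: "x \<in> topspace X" "y \<in> topspace Y" using p(1) by (simp_all add: xy W_def)
  have far: "e \<le> D (x, y)"
  proof (rule ccontr)
    assume "\<not> e \<le> D (x, y)"
    define U where "U = {p \<in> topspace W. D p \<in> {..<e}}"
    have "openin W U" unfolding U_def by (rule openin_continuous_map_preimage[OF Dc]) simp
    moreover have "p \<in> U" using p(1) \<open>\<not> e \<le> D (x, y)\<close> by (simp add: U_def xy)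
    ultimately have "infinite {n. U \<inter> (A n \<times> B n) \<noteq> {}}" by (rule p(2))
    then have "{n. U \<inter> (A n \<times> B n) \<noteq> {}} \<noteq> {}" by (metis finite.emptyI)
    then obtain n u v where "(u, v) \<in> U" "u \<in> A n" "v \<in> B n" by blast
    then show False using AB(7)[of u n v] by (simp add: U_def)
  qed
  have near: "D (x, v) \<le> e/2" if v: "v \<in> B n" for v n
  proof (rule ccontr)
    assume "\<not> D (x, v) \<le> e/2"
    have vY: "v \<in> topspace Y" using v AB(4) openin_subset by blast
    have "continuous_map X W (\<lambda>u. (u, v))"
      unfolding W_def using vY by (intro continuous_map_pairedI) auto
    then have sc: "continuous_map X euclideanreal (\<lambda>u. D (u, v))"
      using continuous_map_compose[OF _ Dc, of X "\<lambda>u. (u, v)"] by (simp add: o_def)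
    define U where "U = {u \<in> topspace X. D (u, v) \<in> {e/2<..}}"
    have "openin X U" unfolding U_def by (rule openin_continuous_map_preimage[OF sc]) simp
    then have "openin W (U \<times> topspace Y)" by (simp add: W_def openin_prod_Times_iff)
    moreover have "p \<in> U \<times> topspace Y" using xyt \<open>\<not> D (x, v) \<le> e/2\<close> by (simp add: U_def xy)
    ultimately have "infinite {k. (U \<times> topspace Y) \<inter> (A k \<times> B k) \<noteq> {}}" by (rule p(2))
    then have "\<exists>k>n. k \<in> {k. (U \<times> topspace Y) \<inter> (A k \<times> B k) \<noteq> {}}"
      unfolding infinite_nat_iff_unbounded by blast
    then obtain k u where "n < k" "u \<in> U" "u \<in> A k" by blast
    then have "u \<in> N (Suc n)" using AB(3)[of k] dec[of "Suc n" k] by auto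
    then have "D (u, v) < e/2" using v by (rule AB(8))
    then show False using \<open>u \<in> U\<close> by (simp add: U_def)
  qed
  have "continuous_map Y W (\<lambda>v. (x, v))"
    unfolding W_def using xyt by (intro continuous_map_pairedI) auto
  then have sc: "continuous_map Y euclideanreal (\<lambda>v. D (x, v))"
    using continuous_map_compose[OF _ Dc, of Y "\<lambda>v. (x, v)"] by (simp add: o_def)
  define U where "U = {v \<in> topspace Y. D (x, v) \<in> {e/2<..}}"
  have "openin Y U" unfolding U_def by (rule openin_continuous_map_preimage[OF sc]) simp
  then have "openin W (topspace X \<times> U)" by (simp add: W_def openin_prod_Times_iff)
  moreover have "p \<in> topspace X \<times> U" using xyt far e by (simp add: U_def xy)
  ultimately have "infinite {k. (topspace X \<times> U) \<inter> (A k \<times> B k) \<noteq> {}}" by (rule p(2))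
  then have "{k. (topspace X \<times> U) \<inter> (A k \<times> B k) \<noteq> {}} \<noteq> {}" by (metis finite.emptyI)
  then obtain k v where "v \<in> U" "v \<in> B k" by blast
  then show False using near[of v k] by (simp add: U_def)
qed

text \<open>An infinite sequence of points with slices pairwise more than \<open>e\<close> apart has neighbourhoods on
which the slices vary little; an accumulation point of these neighbourhoods brings two of the slices within \<open>e\<close>.\<close>

lemma product_slices_totally_bounded:
  fixes f :: "'a \<times> 'b \<Rightarrow> real"
  assumes Z: "tychonoff_space (prod_topology X Y)" and Y: "topspace Y \<noteq> {}"
    and bdd: "\<And>g. g \<in> cfun (prod_topology X Y) \<Longrightarrow> \<exists>c. \<forall>z. \<bar>g z\<bar> \<le> c"
    and f: "f \<in> cfun (prod_topology X Y)" and e: "e > 0"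
  obtains F where "finite F" "F \<subseteq> topspace X"
    "\<And>x. x \<in> topspace X \<Longrightarrow> \<exists>a\<in>F. \<forall>y\<in>topspace Y. \<bar>f (x, y) - f (a, y)\<bar> \<le> e"
proof (rule ccontr)
  assume contra: "\<not> thesis"
  have "\<forall>xs. \<exists>x. set xs \<subseteq> topspace X \<longrightarrow> x \<in> topspace X \<and>
      (\<forall>a\<in>set xs. \<not> (\<forall>y\<in>topspace Y. \<bar>f (x, y) - f (a, y)\<bar> \<le> e))"
  proof
    fix xs :: "'a list"
    show "\<exists>x. set xs \<subseteq> topspace X \<longrightarrow> x \<in> topspace X \<and>
      (\<forall>a\<in>set xs. \<not> (\<forall>y\<in>topspace Y. \<bar>f (x, y) - f (a, y)\<bar> \<le> e))"
      using contra that[of "set xs"] by blast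
  qed
  from choice[OF this] obtain g where g: "\<forall>xs. set xs \<subseteq> topspace X \<longrightarrow> g xs \<in> topspace X \<and>
      (\<forall>a\<in>set xs. \<not> (\<forall>y\<in>topspace Y. \<bar>f (g xs, y) - f (a, y)\<bar> \<le> e))" by (elim exE)
  define R where "R = rec_nat [] (\<lambda>_ xs. xs @ [g xs])"
  have R0: "R 0 = []" and RS: "\<And>n. R (Suc n) = R n @ [g (R n)]" by (simp_all add: R_def)
  define x where "x n = g (R n)" for n
  have R: "R n = map x [0..<n]" for n by (induction n) (simp_all add: R0 RS x_def)
  have sub: "set (R n) \<subseteq> topspace X" for n
    by (induction n) (use g in \<open>auto simp: R0 RS\<close>)
  have xt: "x n \<in> topspace X" for n using g sub by (simp add: x_def)
  have sep: "\<not> (\<forall>y\<in>topspace Y. \<bar>f (x n, y) - f (x m, y)\<bar> \<le> e)" if "m < n" for m n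
  proof -
    have "x m \<in> set (R n)" using that by (simp add: R)
    then show ?thesis using g sub[of n] by (simp add: x_def[of n])
  qed
  have e4: "e / 4 > 0" using e by simp
  have "\<exists>V. openin X V \<and> x n \<in> V \<and> (\<forall>u\<in>V. \<forall>y\<in>topspace Y. \<bar>f (u, y) - f (x n, y)\<bar> \<le> e / 4)" for n
    using product_slices_equicontinuous[OF Z bdd f xt[of n] e4] by metis
  then have "\<forall>n. \<exists>V. openin X V \<and> x n \<in> V \<and> (\<forall>u\<in>V. \<forall>y\<in>topspace Y. \<bar>f (u, y) - f (x n, y)\<bar> \<le> e / 4)"
    by blast
  from choice[OF this] obtain V where
    V: "\<forall>n. openin X (V n) \<and> x n \<in> V n \<and> (\<forall>u\<in>V n. \<forall>y\<in>topspace Y. \<bar>f (u, y) - f (x n, y)\<bar> \<le> e / 4)"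
    by (elim exE)
  have VY: "openin (prod_topology X Y) (V n \<times> topspace Y)" "V n \<times> topspace Y \<noteq> {}" for n
    using V Y by (auto simp: openin_prod_Times_iff)
  obtain p where p: "p \<in> topspace (prod_topology X Y)"
    "\<And>U. openin (prod_topology X Y) U \<Longrightarrow> p \<in> U \<Longrightarrow> infinite {n. U \<inter> (V n \<times> topspace Y) \<noteq> {}}"
    using open_sets_accumulate[OF Z bdd, of "\<lambda>n. V n \<times> topspace Y"] VY by metis
  have p1: "fst p \<in> topspace X" "snd p \<in> topspace Y" using p(1) by auto
  obtain O' where O': "openin X O'" "fst p \<in> O'"
    "\<And>u y. u \<in> O' \<Longrightarrow> y \<in> topspace Y \<Longrightarrow> \<bar>f (u, y) - f (fst p, y)\<bar> \<le> e / 4"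
    using product_slices_equicontinuous[OF Z bdd f p1(1) e4] by metis
  have "infinite {n. (O' \<times> topspace Y) \<inter> (V n \<times> topspace Y) \<noteq> {}}"
    by (rule p(2)) (use O' p1 in \<open>auto simp: openin_prod_Times_iff mem_Times_iff\<close>)
  then have inf: "infinite {n. O' \<inter> V n \<noteq> {}}"
    by (rule contrapos_nn) (erule finite_subset[rotated], blast)
  then have "{n. O' \<inter> V n \<noteq> {}} \<noteq> {}" by (metis finite.emptyI)
  then obtain m where m: "O' \<inter> V m \<noteq> {}" by blast
  obtain n where n: "m < n" "O' \<inter> V n \<noteq> {}"
    using inf unfolding infinite_nat_iff_unbounded by blast
  obtain u where u: "u \<in> O'" "u \<in> V m" using m by blast
  obtain v where v: "v \<in> O'" "v \<in> V n" using n(2) by blast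
  have "\<bar>f (x n, y) - f (x m, y)\<bar> \<le> e" if y: "y \<in> topspace Y" for y
  proof -
    have "\<bar>f (u, y) - f (x m, y)\<bar> \<le> e / 4" "\<bar>f (v, y) - f (x n, y)\<bar> \<le> e / 4"
      using V u(2) v(2) y by blast+
    moreover have "\<bar>f (u, y) - f (fst p, y)\<bar> \<le> e / 4" "\<bar>f (v, y) - f (fst p, y)\<bar> \<le> e / 4"
      using O'(3) u(1) v(1) y by blast+
    ultimately show ?thesis by linarith
  qed
  then show False using sep[OF n(1)] by blast
qed

text \<open>The elementary inequality \<open>\<bar>t\<bar> \<le> t\<^sup>2 / (4 * \<eta>) + \<eta>\<close> reduces the first moment to the second one and avoids square roots.\<close>

lemma sign_average_bound:
  fixes b :: "'i \<Rightarrow> real"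
  assumes A: "finite A" and c: "\<And>i. i \<in> A \<Longrightarrow> \<bar>b i\<bar> \<le> c" and \<eta>: "\<eta> > 0"
  shows "(\<Sum>\<epsilon>\<in>A \<rightarrow>\<^sub>E {-1, 1}. \<bar>\<Sum>i\<in>A. \<epsilon> i * b i\<bar>) \<le> 2 ^ card A * (real (card A) * c\<^sup>2 / (4 * \<eta>) + \<eta>)"
proof -
  have am: "\<bar>t\<bar> \<le> t\<^sup>2 / (4 * \<eta>) + \<eta>" for t :: real
  proof -
    have "0 \<le> (\<bar>t\<bar> - 2 * \<eta>)\<^sup>2" by simp
    then have "\<bar>t\<bar> * (4 * \<eta>) \<le> t\<^sup>2 + \<eta> * (4 * \<eta>)" by (simp add: power2_eq_square algebra_simps)
    then show ?thesis using \<eta> by (simp add: field_simps)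
  qed
  have "(\<Sum>\<epsilon>\<in>A \<rightarrow>\<^sub>E {-1, 1}. \<bar>\<Sum>i\<in>A. \<epsilon> i * b i\<bar>) \<le>
      (\<Sum>\<epsilon>\<in>A \<rightarrow>\<^sub>E {-1, 1}. (\<Sum>i\<in>A. \<epsilon> i * b i)\<^sup>2 / (4 * \<eta>) + \<eta>)"
    by (intro sum_mono am)
  also have "\<dots> = 2 ^ card A * (\<Sum>i\<in>A. (b i)\<^sup>2) / (4 * \<eta>) + 2 ^ card A * \<eta>"
    by (simp add: sum.distrib sum_divide_distrib[symmetric] second_moment[OF A] card_signs[OF A])
  also have "\<dots> = 2 ^ card A * ((\<Sum>i\<in>A. (b i)\<^sup>2) / (4 * \<eta>) + \<eta>)" by (simp add: algebra_simps)
  also have "\<dots> \<le> 2 ^ card A * (real (card A) * c\<^sup>2 / (4 * \<eta>) + \<eta>)"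
  proof -
    have "(b i)\<^sup>2 \<le> c\<^sup>2" if "i \<in> A" for i
      using power_mono[OF c[OF that], of 2] by simp
    then have "(\<Sum>i\<in>A. (b i)\<^sup>2) \<le> real (card A) * c\<^sup>2"
      using sum_bounded_above[of A "\<lambda>i. (b i)\<^sup>2" "c\<^sup>2"] by simp
    then show ?thesis using \<eta> by (intro mult_left_mono add_mono divide_right_mono) simp_all
  qed
  finally show ?thesis .
qed

text \<open>Up to a small error each slice of \<open>f\<close> may be replaced by one of finitely many functions on \<open>L\<close>. For a fixed such
function the sum over \<open>K\<close> runs over all sign patterns once, and the bound for sign averages applies.\<close>

lemma sign_sums_small:
  fixes f :: "'a \<times> 'b \<Rightarrow> real"
  assumes Z: "tychonoff_space (prod_topology X Y)" and Y: "topspace Y \<noteq> {}"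
    and bdd: "\<And>g. g \<in> cfun (prod_topology X Y) \<Longrightarrow> \<exists>c. \<forall>z. \<bar>g z\<bar> \<le> c"
    and f: "f \<in> cfun (prod_topology X Y)" and e: "e > 0"
  shows "\<exists>N. \<forall>n\<ge>N. \<forall>K L \<phi>. K \<subseteq> topspace X \<and> finite K \<and> card K = 2 ^ n \<and>
      L \<subseteq> topspace Y \<and> finite L \<and> card L = n \<and> bij_betw \<phi> K (L \<rightarrow>\<^sub>E {-1, 1::real}) \<longrightarrow>
      \<bar>\<Sum>(s, j)\<in>K \<times> L. \<phi> s j * f (s, j)\<bar> \<le> e * (real n * 2 ^ n)"
proof -
  obtain c where c: "\<forall>z. \<bar>f z\<bar> \<le> c" using bdd[OF f] by blast
  have e2: "e / 2 > 0" using e by simp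
  obtain F where F: "finite F" "F \<subseteq> topspace X"
    "\<And>x. x \<in> topspace X \<Longrightarrow> \<exists>a\<in>F. \<forall>y\<in>topspace Y. \<bar>f (x, y) - f (a, y)\<bar> \<le> e / 2"
    using product_slices_totally_bounded[OF Z Y bdd f e2] by metis
  define M where "M = real (card F)"
  \<comment> \<open>Half of \<open>e\<close> is spent on replacing slices. The bound for sign averages is used with \<open>\<eta> = \<delta> * n\<close>: its linear part costs
    a quarter of \<open>e\<close>, its constant part another quarter once \<open>n\<close> is large.\<close>
  define \<delta> where "\<delta> = e / (4 * (M + 1))"
  have M0: "M \<ge> 0" by (simp add: M_def)
  have \<delta>: "\<delta> > 0" "M * \<delta> \<le> e / 4" using e M0 by (simp_all add: \<delta>_def field_simps)
  obtain N0 :: nat where N0: "M * (c\<^sup>2 / (4 * \<delta>)) / (e / 4) \<le> real N0" using real_arch_simple by blast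
  show ?thesis
  proof (rule exI[of _ "Suc N0"], intro allI impI, elim conjE)
    fix n K L and \<phi> :: "'a \<Rightarrow> 'b \<Rightarrow> real"
    assume n: "Suc N0 \<le> n" and K: "K \<subseteq> topspace X" "finite K" "card K = 2 ^ n"
      and L: "L \<subseteq> topspace Y" "finite L" "card L = n" and \<phi>: "bij_betw \<phi> K (L \<rightarrow>\<^sub>E {-1, 1::real})"
    have n0: "real n > 0" using n by simp
    have "\<forall>x. \<exists>a. x \<in> topspace X \<longrightarrow> a \<in> F \<and> (\<forall>y\<in>topspace Y. \<bar>f (x, y) - f (a, y)\<bar> \<le> e / 2)"
      using F(3) by blast
    from choice[OF this] obtain \<alpha> where
      \<alpha>: "\<forall>x. x \<in> topspace X \<longrightarrow> \<alpha> x \<in> F \<and> (\<forall>y\<in>topspace Y. \<bar>f (x, y) - f (\<alpha> x, y)\<bar> \<le> e / 2)"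
      by (elim exE)
    have sgn: "\<bar>\<phi> s j\<bar> = 1" if "s \<in> K" "j \<in> L" for s j
    proof -
      have "\<phi> s \<in> L \<rightarrow>\<^sub>E {-1, 1}" using \<phi> that(1) by (auto simp: bij_betw_def)
      then have "\<phi> s j \<in> {-1, 1}" using that(2) by (auto simp: PiE_iff)
      then show ?thesis by auto
    qed
    have row: "\<bar>\<Sum>j\<in>L. \<phi> s j * f (s, j)\<bar> \<le> real n * (e / 2) + (\<Sum>a\<in>F. \<bar>\<Sum>j\<in>L. \<phi> s j * f (a, j)\<bar>)"
      if s: "s \<in> K" for s
    proof -
      have sX: "s \<in> topspace X" using s K(1) by blast
      have "(\<Sum>j\<in>L. \<phi> s j * f (s, j)) = (\<Sum>j\<in>L. \<phi> s j * (f (s, j) - f (\<alpha> s, j))) + (\<Sum>j\<in>L. \<phi> s j * f (\<alpha> s, j))"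
        by (simp add: sum.distrib[symmetric] algebra_simps)
      moreover have "\<bar>\<Sum>j\<in>L. \<phi> s j * (f (s, j) - f (\<alpha> s, j))\<bar> \<le> (\<Sum>j\<in>L. e / 2)"
      proof (rule order_trans[OF sum_abs], rule sum_mono)
        fix j assume j: "j \<in> L"
        then show "\<bar>\<phi> s j * (f (s, j) - f (\<alpha> s, j))\<bar> \<le> e / 2"
          using \<alpha> sX L(1) sgn[OF s j] by (auto simp: abs_mult)
      qed
      moreover have "\<bar>\<Sum>j\<in>L. \<phi> s j * f (\<alpha> s, j)\<bar> \<le> (\<Sum>a\<in>F. \<bar>\<Sum>j\<in>L. \<phi> s j * f (a, j)\<bar>)"
        using \<alpha> sX F(1) by (intro member_le_sum) auto
      ultimately show ?thesis using L(3) by simp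
    qed
    have col: "(\<Sum>s\<in>K. \<bar>\<Sum>j\<in>L. \<phi> s j * f (a, j)\<bar>) \<le> 2 ^ n * (c\<^sup>2 / (4 * \<delta>) + \<delta> * real n)" for a
    proof -
      have "(\<Sum>s\<in>K. \<bar>\<Sum>j\<in>L. \<phi> s j * f (a, j)\<bar>) = (\<Sum>\<epsilon>\<in>L \<rightarrow>\<^sub>E {-1, 1}. \<bar>\<Sum>j\<in>L. \<epsilon> j * f (a, j)\<bar>)"
        by (rule sum.reindex_bij_betw[OF \<phi>])
      also have "\<dots> \<le> 2 ^ n * (real n * c\<^sup>2 / (4 * (\<delta> * real n)) + \<delta> * real n)"
        using sign_average_bound[OF L(2), of "\<lambda>j. f (a, j)" c "\<delta> * real n"] c \<delta>(1) n0 L(3) by simp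
      also have "real n * c\<^sup>2 / (4 * (\<delta> * real n)) = c\<^sup>2 / (4 * \<delta>)" using n0 by simp
      finally show ?thesis .
    qed
    have "\<bar>\<Sum>(s, j)\<in>K \<times> L. \<phi> s j * f (s, j)\<bar> = \<bar>\<Sum>s\<in>K. \<Sum>j\<in>L. \<phi> s j * f (s, j)\<bar>"
      by (simp add: sum.cartesian_product)
    also have "\<dots> \<le> (\<Sum>s\<in>K. real n * (e / 2) + (\<Sum>a\<in>F. \<bar>\<Sum>j\<in>L. \<phi> s j * f (a, j)\<bar>))"
      by (rule order_trans[OF sum_abs]) (rule sum_mono[OF row])
    also have "\<dots> = 2 ^ n * (real n * (e / 2)) + (\<Sum>a\<in>F. \<Sum>s\<in>K. \<bar>\<Sum>j\<in>L. \<phi> s j * f (a, j)\<bar>)"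
      using K(3) by (simp add: sum.distrib sum.swap[of _ F K])
    also have "\<dots> \<le> 2 ^ n * (real n * (e / 2)) + (\<Sum>a\<in>F. 2 ^ n * (c\<^sup>2 / (4 * \<delta>) + \<delta> * real n))"
      by (intro add_left_mono sum_mono col)
    also have "\<dots> = 2 ^ n * (real n * (e / 2) + (M * (c\<^sup>2 / (4 * \<delta>)) + M * \<delta> * real n))"
      by (simp add: M_def algebra_simps)
    also have "\<dots> \<le> 2 ^ n * (real n * (e / 2) + (e / 4 * real n + e / 4 * real n))"
    proof -
      have "e / 4 > 0" using e by simp
      then have "M * (c\<^sup>2 / (4 * \<delta>)) \<le> real N0 * (e / 4)" using N0 by (simp only: pos_divide_le_eq)
      also have "\<dots> \<le> real n * (e / 4)" using n e by (intro mult_right_mono) simp_all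
      finally have "M * (c\<^sup>2 / (4 * \<delta>)) \<le> e / 4 * real n" by (simp add: mult.commute)
      moreover have "M * \<delta> * real n \<le> e / 4 * real n" using \<delta>(2) by (intro mult_right_mono) simp_all
      ultimately show ?thesis by (intro mult_left_mono add_mono) simp_all
    qed
    also have "\<dots> = e * (real n * 2 ^ n)" by (simp add: algebra_simps)
    finally show "\<bar>\<Sum>(s, j)\<in>K \<times> L. \<phi> s j * f (s, j)\<bar> \<le> e * (real n * 2 ^ n)" .
  qed
qed

theorem sign_measures_subsequence:
  fixes X :: "'a topology" and Y :: "'b topology" and K :: "nat \<Rightarrow> 'a set" and L :: "nat \<Rightarrow> 'b set" and \<phi> :: "nat \<Rightarrow> 'a \<Rightarrow> 'b \<Rightarrow> real" and k :: "nat \<Rightarrow> nat"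
  defines "W \<equiv> prod_topology X Y"
  defines "a \<equiv> \<lambda>n p. \<phi> (k n) (fst p) (snd p) / (real (k n) * 2 ^ k n)"
  defines "S \<equiv> \<lambda>n. K (k n) \<times> L (k n)"
  assumes Z: "tychonoff_space (prod_topology X Y)" and Y: "topspace Y \<noteq> {}"
    and bdd: "\<And>g. g \<in> cfun (prod_topology X Y) \<Longrightarrow> \<exists>c. \<forall>z. \<bar>g z\<bar> \<le> c"
    and k: "strict_mono k" "\<And>n. 1 \<le> k n"
    and K: "\<And>n. 1 \<le> n \<Longrightarrow> K n \<subseteq> topspace X" "\<And>n. 1 \<le> n \<Longrightarrow> finite (K n)" "\<And>n. 1 \<le> n \<Longrightarrow> card (K n) = 2 ^ n"
    and L: "\<And>n. 1 \<le> n \<Longrightarrow> L n \<subseteq> topspace Y" "\<And>n. 1 \<le> n \<Longrightarrow> finite (L n)" "\<And>n. 1 \<le> n \<Longrightarrow> card (L n) = n"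
    and \<phi>: "\<And>n. 1 \<le> n \<Longrightarrow> bij_betw (\<phi> n) (K n) (L n \<rightarrow>\<^sub>E {-1, 1})"
  shows "\<And>n. finite (S n)" "\<And>n. S n \<subseteq> topspace W" "\<And>n. (\<Sum>z\<in>S n. \<bar>a n z\<bar>) = 1"
    and "\<And>f. f \<in> cfun W \<Longrightarrow> (\<lambda>n. \<Sum>z\<in>S n. a n z * f z) \<longlonglongrightarrow> 0"
    and "\<And>z. (\<lambda>n. if z \<in> S n then \<bar>a n z\<bar> else 0) \<longlonglongrightarrow> 0"
proof -
  have k0: "real (k n) > 0" for n using k(2)[of n] by simp
  have kn: "n \<le> k n" for n by (rule strict_mono_imp_increasing[OF k(1)])
  have abs_a: "\<bar>a n z\<bar> = 1 / (real (k n) * 2 ^ k n)" if "z \<in> S n" for n z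
  proof -
    have z: "fst z \<in> K (k n)" "snd z \<in> L (k n)" using that by (auto simp: S_def)
    have "\<phi> (k n) (fst z) \<in> L (k n) \<rightarrow>\<^sub>E {-1, 1}" using \<phi>[OF k(2)[of n]] z(1) by (auto simp: bij_betw_def)
    then have "\<phi> (k n) (fst z) (snd z) \<in> {-1, 1}" using z(2) by (auto simp: PiE_iff)
    then have "\<bar>\<phi> (k n) (fst z) (snd z)\<bar> = 1" by auto
    then show ?thesis by (simp add: a_def abs_mult)
  qed
  show "finite (S n)" for n unfolding S_def by (intro finite_cartesian_product K(2) L(2) k(2))
  show "S n \<subseteq> topspace W" for n
    unfolding S_def W_def topspace_prod_topology by (intro Sigma_mono K(1) L(1) k(2))
  show "(\<Sum>z\<in>S n. \<bar>a n z\<bar>) = 1" for n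
    using k0[of n] K(3)[OF k(2)[of n]] L(3)[OF k(2)[of n]]
    by (simp add: abs_a) (simp add: S_def card_cartesian_product)
  show "(\<lambda>n. \<Sum>z\<in>S n. a n z * f z) \<longlonglongrightarrow> 0" if f: "f \<in> cfun W" for f
  proof (rule LIMSEQ_I)
    fix e :: real assume e: "0 < e"
    then have e2: "e / 2 > 0" by simp
    obtain N where N: "\<forall>n\<ge>N. \<forall>K L \<phi>. K \<subseteq> topspace X \<and> finite K \<and> card K = 2 ^ n \<and>
      L \<subseteq> topspace Y \<and> finite L \<and> card L = n \<and> bij_betw \<phi> K (L \<rightarrow>\<^sub>E {-1, 1::real}) \<longrightarrow>
      \<bar>\<Sum>(s, j)\<in>K \<times> L. \<phi> s j * f (s, j)\<bar> \<le> e / 2 * (real n * 2 ^ n)"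
      by (rule exE[OF sign_sums_small[OF Z Y bdd f[unfolded W_def] e2]], assumption, rule that)
    have "norm ((\<Sum>z\<in>S n. a n z * f z) - 0) < e" if n: "N \<le> n" for n
    proof -
      define q where "q = real (k n) * 2 ^ k n"
      have q: "q > 0" using k0 by (simp add: q_def)
      have "(\<Sum>z\<in>S n. a n z * f z) = (\<Sum>(s, j)\<in>K (k n) \<times> L (k n). \<phi> (k n) s j * f (s, j)) / q"
        by (simp add: S_def a_def q_def sum_divide_distrib case_prod_unfold)
      moreover have "\<bar>\<Sum>(s, j)\<in>K (k n) \<times> L (k n). \<phi> (k n) s j * f (s, j)\<bar> \<le> e / 2 * q"
        unfolding q_def
        using N[THEN spec, THEN mp, OF order_trans[OF n kn], THEN spec, THEN spec, THEN spec, THEN mp,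
            OF conjI[OF K(1)[OF k(2)] conjI[OF K(2)[OF k(2)] conjI[OF K(3)[OF k(2)]
              conjI[OF L(1)[OF k(2)] conjI[OF L(2)[OF k(2)] conjI[OF L(3)[OF k(2)] \<phi>[OF k(2)]]]]]]]] .
      ultimately have "\<bar>\<Sum>z\<in>S n. a n z * f z\<bar> \<le> e / 2"
        by (simp only: abs_divide abs_of_pos[OF q] pos_divide_le_eq[OF q])
      then show ?thesis using e by simp
    qed
    then show "\<exists>N. \<forall>n\<ge>N. norm ((\<Sum>z\<in>S n. a n z * f z) - 0) < e" by blast
  qed
  show "(\<lambda>n. if z \<in> S n then \<bar>a n z\<bar> else 0) \<longlonglongrightarrow> 0" for z
  proof (rule Lim_null_comparison[OF always_eventually[OF allI] LIMSEQ_inverse_real_of_nat])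
    fix n
    have "(2::real) ^ k n \<ge> 2" using power_increasing[of 1 "k n" "2::real"] k(2)[of n] by simp
    then have "real (k n) * 2 \<le> real (k n) * 2 ^ k n" by (intro mult_left_mono) simp_all
    moreover have "real (Suc n) \<le> real (k n) * 2" using kn[of n] k(2)[of n] by simp
    ultimately have "real (Suc n) \<le> real (k n) * 2 ^ k n" by linarith
    then have "1 / (real (k n) * 2 ^ k n) \<le> 1 / real (Suc n)"
      using k0[of n] by (intro divide_left_mono) simp_all
    then show "norm (if z \<in> S n then \<bar>a n z\<bar> else 0) \<le> inverse (real (Suc n))"
      using abs_a[of z n] by (simp add: inverse_eq_divide)
  qed
qed

section \<open>The bidual\<close>

text \<open>A function separating two points of \<open>V \<inter> S\<close> leaves infinitely many points of \<open>S\<close> on at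
least one side; the bump is placed at the point on the other side.\<close>

lemma disjoint_bump_step:
  assumes Z: "tychonoff_space Z" and S: "S \<subseteq> topspace Z" and V: "openin Z V" "infinite (V \<inter> S)"
  shows "\<exists>x u V'. x \<in> V \<inter> S \<and> u \<in> cfun Z \<and> (\<forall>z. \<bar>u z\<bar> \<le> 1) \<and> u x = 1 \<and> (\<forall>z. z \<notin> V \<longrightarrow> u z = 0) \<and>
    openin Z V' \<and> V' \<subseteq> V \<and> infinite (V' \<inter> S) \<and> (\<forall>z\<in>V'. u z = 0)"
proof -
  have conclude: ?thesis if x: "x \<in> V \<inter> S" and A: "openin Z A" "x \<in> A" and V': "openin Z V'" "V' \<subseteq> V"
    "infinite (V' \<inter> S)" "A \<inter> V' = {}" for x A V'
  proof -
    have "openin Z (V \<inter> A)" "x \<in> V \<inter> A" using V(1) A x by auto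
    then obtain u where u: "u \<in> cfun Z" "u x = 1" "\<And>z. 0 \<le> u z" "\<And>z. u z \<le> 1" "\<And>z. z \<notin> V \<inter> A \<Longrightarrow> u z = 0"
      by (rule tychonoff_bump[OF Z]) (rule that)
    have "\<bar>u z\<bar> \<le> 1" for z using u(3,4)[of z] by simp
    then show ?thesis
      using x V' u(1,2) u(5) by (intro exI[of _ x] exI[of _ u] exI[of _ V']) auto
  qed
  obtain a where a: "a \<in> V \<inter> S" using V(2) by (metis all_not_in_conv finite.emptyI)
  have "infinite (V \<inter> S - {a})" using V(2) by simp
  then obtain b where b: "b \<in> V \<inter> S" "b \<noteq> a" by (metis DiffE all_not_in_conv finite.emptyI singletonI)
  have "\<exists>f\<in>cfun Z. f a = 0 \<and> f b = 1"
  proof (rule tychonoff_interpolation[OF Z, of "{a, b}" "{}" "\<lambda>z. if z = b then 1 else 0" 1])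
    fix f :: "'a \<Rightarrow> real"
    assume "f \<in> cfun Z" and v: "\<And>z. z \<in> {a, b} \<Longrightarrow> f z = (if z = b then 1 else 0)"
    then show "\<exists>f\<in>cfun Z. f a = 0 \<and> f b = 1" using v[of a] v[of b] b(2) by (intro bexI[of _ f]) auto
  qed (use a b S in auto)
  then obtain f where f: "f \<in> cfun Z" "f a = 0" "f b = 1" by blast
  have ab: "a \<in> topspace Z" "b \<in> topspace Z" using a b S by auto
  have O1: "openin Z {z \<in> topspace Z. f z \<in> A}" if "open A" for A
    by (rule openin_continuous_map_preimage[OF cfun_continuous[OF f(1)]]) (use that in simp)
  define G where "G A = {z \<in> topspace Z. f z \<in> A}" for A
  have G: "openin Z (G A)" if "open A" for A unfolding G_def by (rule O1[OF that])
  have VG: "openin Z (V \<inter> G A)" if "open A" for A using V(1) G[OF that] by blast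
  show ?thesis
  proof (cases "infinite (V \<inter> G {1/3<..} \<inter> S)")
    case True
    show ?thesis
    proof (rule conclude[OF a, of "G {..<1/3}" "V \<inter> G {1/3<..}"])
      show "openin Z (G {..<1/3})" by (rule G) simp
      show "openin Z (V \<inter> G {1/3<..})" by (rule VG) simp
    qed (use True f ab in \<open>auto simp: G_def\<close>)
  next
    case False
    have "V \<inter> S \<subseteq> (V \<inter> G {1/3<..} \<inter> S) \<union> (V \<inter> G {..<2/3} \<inter> S)"
      using S by (auto simp: G_def)
    then have inf: "infinite (V \<inter> G {..<2/3} \<inter> S)"
      using False V(2) by (metis finite_UnI finite_subset)
    show ?thesis
    proof (rule conclude[OF b(1), of "G {2/3<..}" "V \<inter> G {..<2/3}"])
      show "openin Z (G {2/3<..})" by (rule G) simp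
      show "openin Z (V \<inter> G {..<2/3})" by (rule VG) simp
      show "infinite (V \<inter> G {..<2/3} \<inter> S)" by fact
    qed (use f ab in \<open>auto simp: G_def\<close>)
  qed
qed

lemma disjoint_bumps:
  assumes Z: "tychonoff_space Z" and S: "S \<subseteq> topspace Z" "infinite S"
  obtains x :: "nat \<Rightarrow> 'a" and h where "\<And>n. x n \<in> S" "\<And>n. h n \<in> cfun Z" "\<And>n z. \<bar>h n z\<bar> \<le> 1"
    "\<And>n m. h n (x m) = (if n = m then 1 else 0)" "\<And>n m z. n \<noteq> m \<Longrightarrow> h n z = 0 \<or> h m z = 0"
proof -
  have "\<forall>V. \<exists>q. openin Z V \<and> infinite (V \<inter> S) \<longrightarrow>
    fst q \<in> V \<inter> S \<and> fst (snd q) \<in> cfun Z \<and> (\<forall>z. \<bar>fst (snd q) z\<bar> \<le> 1) \<and> fst (snd q) (fst q) = 1 \<and>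
    (\<forall>z. z \<notin> V \<longrightarrow> fst (snd q) z = 0) \<and> openin Z (snd (snd q)) \<and> snd (snd q) \<subseteq> V \<and>
    infinite (snd (snd q) \<inter> S) \<and> (\<forall>z\<in>snd (snd q). fst (snd q) z = 0)"
    (is "\<forall>V. \<exists>q. ?R V q")
  proof
    fix V
    show "\<exists>q. ?R V q"
    proof (cases "openin Z V \<and> infinite (V \<inter> S)")
      case True
      then obtain x u V' where "x \<in> V \<inter> S \<and> u \<in> cfun Z \<and> (\<forall>z. \<bar>u z\<bar> \<le> 1) \<and> u x = 1 \<and> (\<forall>z. z \<notin> V \<longrightarrow> u z = 0) \<and>
        openin Z V' \<and> V' \<subseteq> V \<and> infinite (V' \<inter> S) \<and> (\<forall>z\<in>V'. u z = 0)"
        using disjoint_bump_step[OF Z S(1) conjunct1[OF True] conjunct2[OF True]] by (elim exE)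
      then show ?thesis by (intro exI[of _ "(x, u, V')"] impI, unfold fst_conv snd_conv)
    qed (rule exI, rule impI, erule notE)
  qed
  from choice[OF this] obtain Q where Q: "\<forall>V. ?R V (Q V)" by (elim exE)
  define V where "V = rec_nat (topspace Z) (\<lambda>_ V. snd (snd (Q V)))"
  have V0: "V 0 = topspace Z" and VS: "\<And>n. V (Suc n) = snd (snd (Q (V n)))" by (simp_all add: V_def)
  have V: "openin Z (V n) \<and> infinite (V n \<inter> S)" for n
  proof (induction n)
    case 0
    show ?case using S by (simp add: V0 Int_absorb1)
  next
    case (Suc n)
    show ?case using Q[rule_format, OF Suc] unfolding VS by (elim conjE) (intro conjI)
  qed
  define x where "x n = fst (Q (V n))" for n
  define h where "h n = fst (snd (Q (V n)))" for n
  have P: "x n \<in> V n \<inter> S" "h n \<in> cfun Z" "\<forall>z. \<bar>h n z\<bar> \<le> 1" "h n (x n) = 1"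
    "\<forall>z. z \<notin> V n \<longrightarrow> h n z = 0" "V (Suc n) \<subseteq> V n" "\<forall>z\<in>V (Suc n). h n z = 0" for n
    using Q[rule_format, OF V[of n]] unfolding x_def h_def VS by - (elim conjE, assumption)+
  have dec: "V m \<subseteq> V n" if "n \<le> m" for n m using that P(6) by (rule lift_Suc_antimono_le[rotated])
  have lt: "h n z = 0 \<or> h m z = 0" if "n < m" for n m z
    using P(5)[of m] P(7)[of n] dec[of "Suc n" m] that by (cases "z \<in> V m") auto
  have disj: "h n z = 0 \<or> h m z = 0" if "n \<noteq> m" for n m z
    using that lt[of n m z] lt[of m n z] by (cases n m rule: linorder_cases) auto
  show ?thesis
  proof (rule that[of x h])
    show "h n (x m) = (if n = m then 1 else 0)" for n m
      using disj[of n m "x m"] P(4)[of m] by (cases "n = m") auto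
  qed (use P disj in auto)
qed

lemma tvs_bounded_singleton_Ck:
  assumes h: "h \<in> cfun Z" "\<And>z. \<bar>h z\<bar> \<le> 1"
  shows "tvs_bounded (Ck Z) {h}"
  unfolding tvs_bounded_def
proof (intro conjI allI impI)
  show "{h} \<subseteq> topspace (Ck Z)" using h(1) by simp
  fix U assume U: "openin (Ck Z) U \<and> 0 \<in> U"
  obtain K e where K: "compactin Z K" "e > 0" "\<forall>f\<in>cfun Z. (\<forall>z\<in>K. \<bar>f z\<bar> < e) \<longrightarrow> f \<in> U"
    using Ck_nbhd_0[OF conjunct1[OF U] conjunct2[OF U]] by (elim exE conjE)
  have "{h} \<subseteq> (\<lambda>x. s *\<^sub>R x) ` U" if s: "s \<ge> 2 / e" for s
  proof -
    have s0: "s > 0" using s K(2) by (meson divide_pos_pos less_le_trans zero_less_numeral)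
    have "1 / s < e"
    proof -
      have "2 \<le> s * e" using s K(2) by (simp add: pos_divide_le_eq)
      then show ?thesis using s0 by (simp add: pos_divide_less_eq mult.commute)
    qed
    define g where "g = (\<lambda>z. 1 / s * h z)"
    have g: "g \<in> cfun Z" unfolding g_def by (rule cfun_lambda_intros(4)[OF h(1)])
    have "\<bar>g z\<bar> < e" for z
    proof -
      have "\<bar>g z\<bar> = 1 / s * \<bar>h z\<bar>" using s0 by (simp add: g_def abs_mult)
      also have "\<dots> \<le> 1 / s * 1" using h(2)[of z] s0 by (intro mult_left_mono) simp_all
      finally show ?thesis using \<open>1 / s < e\<close> by simp
    qed
    then have "g \<in> U" using K(3) g by blast
    moreover have "h = s *\<^sub>R g" by (rule ext) (use s0 in \<open>simp add: g_def scaleR_fun_def\<close>)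
    ultimately show ?thesis by blast
  qed
  then show "\<exists>r>0. \<forall>s\<ge>r. {h} \<subseteq> (\<lambda>x. s *\<^sub>R x) ` U"
    using K(2) by (intro exI[of _ "2 / e"]) simp
qed

lemma tvs_bounded_Ck_uniform:
  assumes B: "tvs_bounded (Ck Z) B" and K: "compactin Z K"
  obtains c where "c > 0" "\<And>f z. f \<in> B \<Longrightarrow> z \<in> K \<Longrightarrow> \<bar>f z\<bar> \<le> c"
proof -
  have 0: "0 \<in> cfun Z" by (rule subspace_0[OF subspace_cfun])
  obtain U where U: "openin (Ck Z) U" "0 \<in> U" "\<And>g z. g \<in> U \<Longrightarrow> z \<in> K \<Longrightarrow> \<bar>g z - 0 z\<bar> < 1"
    using Ck_nbhd[OF 0 K zero_less_one] by blast
  obtain r where r: "r > 0" "\<forall>s\<ge>r. B \<subseteq> (\<lambda>x. s *\<^sub>R x) ` U"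
    using B U(1,2) unfolding tvs_bounded_def by blast
  have "\<bar>f z\<bar> \<le> r" if f: "f \<in> B" and z: "z \<in> K" for f z
  proof -
    obtain g where g: "g \<in> U" "f = r *\<^sub>R g" using r(2) f by blast
    have "\<bar>g z\<bar> < 1" using U(3)[OF g(1) z] by simp
    then have "r * \<bar>g z\<bar> \<le> r * 1" using r(1) by (intro mult_left_mono) simp_all
    moreover have "f z = r * g z" unfolding g(2) by (simp add: scaleR_fun_def)
    ultimately show ?thesis using r(1) by (simp add: abs_mult)
  qed
  then show ?thesis by (rule that[OF r(1)])
qed

lemma evaluation_in_bidual:
  assumes h: "h \<in> cfun Z" "\<And>z. \<bar>h z\<bar> \<le> 1"
  shows "(\<lambda>\<phi>. if \<phi> \<in> dual (Ck Z) then \<phi> h else 0) \<in> dual (strong_dual (Ck Z))"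
proof (rule dualI)
  let ?y = "\<lambda>\<phi>. if \<phi> \<in> dual (Ck Z) then \<phi> h else 0"
  have "openin (strong_dual (Ck Z)) {\<phi> \<in> dual (Ck Z). ?y \<phi> \<in> V}" if V: "open V" for V
    unfolding openin_strong_dual
  proof (intro conjI ballI)
    fix \<phi> assume "\<phi> \<in> {\<phi> \<in> dual (Ck Z). ?y \<phi> \<in> V}"
    then have \<phi>: "\<phi> h \<in> V" by (auto split: if_splits)
    obtain e where e: "e > 0" "ball (\<phi> h) e \<subseteq> V" using V \<phi> open_contains_ball by blast
    have "{\<psi> \<in> dual (Ck Z). \<forall>x\<in>{h}. \<bar>\<psi> x - \<phi> x\<bar> < e} \<subseteq> {\<phi> \<in> dual (Ck Z). ?y \<phi> \<in> V}"
      using e(2) by (auto simp: dist_real_def abs_minus_commute)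
    then show "\<exists>B e. tvs_bounded (Ck Z) B \<and> 0 < e \<and> {\<psi> \<in> dual (Ck Z). \<forall>x\<in>B. \<bar>\<psi> x - \<phi> x\<bar> < e}
        \<subseteq> {\<phi> \<in> dual (Ck Z). ?y \<phi> \<in> V}"
      using tvs_bounded_singleton_Ck[OF h] e(1) by (intro exI[of _ "{h}"] exI[of _ e] conjI)
  qed auto
  then show "continuous_map (strong_dual (Ck Z)) euclideanreal ?y"
    by (simp add: continuous_map_def)
  show "?y (\<phi> + \<psi>) = ?y \<phi> + ?y \<psi>"
    if "\<phi> \<in> topspace (strong_dual (Ck Z))" "\<psi> \<in> topspace (strong_dual (Ck Z))" for \<phi> \<psi>
    using that subspace_add[OF subspace_dual, of \<phi> "Ck Z" \<psi>] by simp
  show "?y (c *\<^sub>R \<phi>) = c * ?y \<phi>" if "\<phi> \<in> topspace (strong_dual (Ck Z))" for c \<phi>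
    using that subspace_scale[OF subspace_dual, of \<phi> "Ck Z" c] by (simp add: scaleR_fun_def)
qed simp

lemma sum_disjoint_bumps_le:
  fixes N :: nat
  assumes "\<And>n z. \<bar>h n z\<bar> \<le> (1::real)" "\<And>n m z. n \<noteq> m \<Longrightarrow> h n z = 0 \<or> h m z = 0" "\<And>n. \<bar>c n\<bar> \<le> 1"
  shows "\<bar>\<Sum>n<N. c n * h n z\<bar> \<le> 1"
proof (cases "\<exists>k<N. h k z \<noteq> 0")
  case True
  then obtain k where k: "k < N" "h k z \<noteq> 0" by blast
  have "(\<Sum>n<N. c n * h n z) = (\<Sum>n\<in>{k}. c n * h n z)"
    using k assms(2)[of _ k z] by (intro sum.mono_neutral_right) auto
  then show ?thesis using mult_mono[OF assms(3)[of k] assms(1)[of k z]] by (simp add: abs_mult)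
qed simp

text \<open>Take the points \<open>x n\<close> in an infinite compact set if there is one. The functional
\<open>P = (\<Sum>n. \<phi> (h n) * \<delta>(x n))\<close> is then continuous and the series converges uniformly on bounded sets, that is, in the
strong dual. If all compact sets are finite, \<open>\<phi>\<close> is finitely supported and the series has only finitely many terms,
as the \<open>h n\<close> are disjoint. In both cases \<open>\<phi> - P\<close> is annihilated by all evaluations at \<open>h n\<close>, so that an element of
the weak-star closed span of these takes the same value at \<open>\<phi>\<close> and at \<open>P\<close>.\<close>

theorem bidual_basic_sequence:
  assumes Z: "tychonoff_space Z" "infinite (topspace Z)"
  shows "\<exists>y. basic_sequence (weak_star_bidual (Ck Z)) y"
proof -
  have "\<exists>S. infinite S \<and> S \<subseteq> topspace Z \<and> (compactin Z S \<or> (\<forall>K. compactin Z K \<longrightarrow> finite K))"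
  proof (cases "\<forall>K. compactin Z K \<longrightarrow> finite K")
    case True
    then show ?thesis using Z(2) by (intro exI[of _ "topspace Z"] conjI disjI2 subset_refl)
  next
    case False
    then obtain K where K: "compactin Z K" "infinite K" by (simp only: not_all not_imp) (elim exE conjE)
    then show ?thesis by (intro exI[of _ K] conjI disjI1 compactin_subset_topspace)
  qed
  then obtain S where S: "infinite S" "S \<subseteq> topspace Z" "compactin Z S \<or> (\<forall>K. compactin Z K \<longrightarrow> finite K)"
    by (elim exE conjE)
  obtain x :: "nat \<Rightarrow> 'a" and h where xh: "\<And>n. x n \<in> S" "\<And>n. h n \<in> cfun Z" "\<And>n z. \<bar>h n z\<bar> \<le> 1"
    "\<And>n m. h n (x m) = (if n = m then 1 else 0)" "\<And>n m z. n \<noteq> m \<Longrightarrow> h n z = 0 \<or> h m z = 0"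
    using disjoint_bumps[OF Z(1) S(2,1)] by metis
  have xt: "x n \<in> topspace Z" for n using xh(1) S(2) by blast
  define E where "E = strong_dual (Ck Z)"
  have tE: "topspace E = dual (Ck Z)" by (simp add: E_def)
  define y where "y n = (\<lambda>\<phi>. if \<phi> \<in> dual (Ck Z) then \<phi> (h n) else 0)" for n
  have y: "y n \<in> dual E" for n unfolding y_def E_def by (rule evaluation_in_bidual[OF xh(2,3)])
  define e where "e n = dirac Z (x n)" for n
  have e: "e n \<in> dual (Ck Z)" for n unfolding e_def by (rule dirac_in_dual[OF xt])
  have "basic_sequence (weak_star E) y"
  proof (rule weak_star_basic_sequence[of _ y e])
    show "subspace (topspace E)" unfolding tE by (rule subspace_dual)
    show "e n \<in> topspace E" for n unfolding tE by (rule e)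
    show "y m (e n) = (if m = n then 1 else 0)" for m n
    proof -
      have "e n (h m) = h m (x n)" using xh(2)[of m] by (simp add: e_def dirac_def)
      then show ?thesis using e[of n] xh(4)[of m n] by (simp add: y_def)
    qed
    fix \<Phi> \<phi> assume \<Phi>: "\<Phi> \<in> dual E" and \<phi>: "\<phi> \<in> topspace E"
      and kill: "\<And>\<psi>. \<psi> \<in> topspace E \<Longrightarrow> (\<And>n. y n \<psi> = 0) \<Longrightarrow> \<Phi> \<psi> = 0"
    have \<phi>d: "\<phi> \<in> dual (Ck Z)" using \<phi> unfolding tE .
    obtain K M where K: "compactin Z K" "M \<ge> 0"
      "\<forall>f\<in>cfun Z. \<forall>c\<ge>0. (\<forall>z\<in>K. \<bar>f z\<bar> \<le> c) \<longrightarrow> \<bar>\<phi> f\<bar> \<le> M * c"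
      using dual_Ck_bound[OF \<phi>d] by (elim exE conjE)
    define a where "a n = \<phi> (h n)" for n
    have sa: "summable (\<lambda>n. \<bar>a n\<bar>)"
    proof (rule summableI_nonneg_bounded[where x = M])
      fix N
      define f where "f = (\<Sum>n<N. sgn (a n) *\<^sub>R h n)"
      have f: "f \<in> cfun Z" unfolding f_def using xh(2) by (intro subspace_sum subspace_scale subspace_cfun)
      have "\<bar>f z\<bar> \<le> 1" for z
        unfolding f_def sum_scaleR_fun_apply by (rule sum_disjoint_bumps_le) (use xh(3,5) in \<open>auto simp: sgn_if\<close>)
      then have "\<bar>\<phi> f\<bar> \<le> M * 1" using K(3)[rule_format, OF f, of 1] by simp
      moreover have "\<phi> f = (\<Sum>n<N. sgn (a n) * a n)"
        unfolding f_def a_def using dual_sum[OF \<phi>d, of "{..<N}" h] subspace_cfun[of Z] xh(2) by simp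
      moreover have "sgn (a n) * a n = \<bar>a n\<bar>" for n by (simp add: sgn_if)
      ultimately show "(\<Sum>n<N. \<bar>a n\<bar>) \<le> M" by simp
    qed simp
    have "\<exists>K0. compactin Z K0 \<and> (\<forall>n. a n \<noteq> 0 \<longrightarrow> x n \<in> K0)"
    proof (cases "compactin Z S")
      case False
      then have finK: "finite K" using S(3) K(1) by blast
      have "\<exists>z\<in>K. h n z \<noteq> 0" if "a n \<noteq> 0" for n
      proof (rule ccontr)
        assume "\<not> (\<exists>z\<in>K. h n z \<noteq> 0)"
        then have "\<bar>\<phi> (h n)\<bar> \<le> M * 0" by (intro K(3)[rule_format, OF xh(2)]) simp_all
        then show False using that by (simp add: a_def)
      qed
      then have "{n. a n \<noteq> 0} \<subseteq> (\<Union>z\<in>K. {n. h n z \<noteq> 0})" by blast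
      moreover have "finite {n. h n z \<noteq> 0}" for z
      proof (cases "{n. h n z \<noteq> 0} = {}")
        case False
        then obtain k where "h k z \<noteq> 0" by blast
        then have "{n. h n z \<noteq> 0} \<subseteq> {k}" using xh(5)[of _ k z] by auto
        then show ?thesis by (rule finite_subset) simp
      qed simp
      ultimately have "finite {n. a n \<noteq> 0}" using finK by (meson finite_UN_I finite_subset)
      then have "compactin Z (x ` {n. a n \<noteq> 0})"
        using xt by (intro finite_imp_compactin) auto
      then show ?thesis by blast
    qed (use xh(1) in blast)
    then obtain K0 where K0: "compactin Z K0" "\<And>n. a n \<noteq> 0 \<Longrightarrow> x n \<in> K0" by blast
    have absterm: "\<bar>a n * f (x n)\<bar> \<le> \<bar>a n\<bar> * c" if "\<And>z. z \<in> K0 \<Longrightarrow> \<bar>f z\<bar> \<le> c" for n f c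
      using that[of "x n"] K0(2)[of n] by (cases "a n = 0") (simp_all add: abs_mult mult_left_mono)
    have sf: "summable (\<lambda>n. a n * f (x n))" if f: "f \<in> cfun Z" for f
    proof -
      obtain c where c: "c \<ge> 0" "\<And>z. z \<in> K0 \<Longrightarrow> \<bar>f z\<bar> \<le> c"
        using cfun_bounded_on_compact[OF f K0(1)] by blast
      show ?thesis
        by (rule summable_comparison_test'[OF summable_mult2[OF sa, of c], of 0]) (use absterm[OF c(2)] in simp)
    qed
    define P where "P f = (if f \<in> cfun Z then (\<Sum>n. a n * f (x n)) else 0)" for f
    have tailbd: "\<bar>\<Sum>n. a (n + N) * f (x (n + N))\<bar> \<le> (\<Sum>n. \<bar>a (n + N)\<bar>) * c"
      if f: "f \<in> cfun Z" and c: "\<And>z. z \<in> K0 \<Longrightarrow> \<bar>f z\<bar> \<le> c" for f c N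
    proof -
      have s1: "summable (\<lambda>n. \<bar>a (n + N)\<bar>)" using sa by (simp add: summable_iff_shift[of "\<lambda>n. \<bar>a n\<bar>"])
      have s2: "summable (\<lambda>n. \<bar>a (n + N)\<bar> * c)" by (rule summable_mult2[OF s1])
      have s3: "summable (\<lambda>n. \<bar>a (n + N) * f (x (n + N))\<bar>)"
        by (rule summable_comparison_test'[OF s2, of 0]) (use absterm[OF c] in simp)
      have "\<bar>\<Sum>n. a (n + N) * f (x (n + N))\<bar> \<le> (\<Sum>n. \<bar>a (n + N) * f (x (n + N))\<bar>)"
        by (rule summable_rabs[OF s3])
      also have "\<dots> \<le> (\<Sum>n. \<bar>a (n + N)\<bar> * c)" by (rule suminf_le[OF _ s3 s2]) (rule absterm[OF c])
      also have "\<dots> = (\<Sum>n. \<bar>a (n + N)\<bar>) * c" by (rule suminf_mult2[OF s1, symmetric])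
      finally show ?thesis .
    qed
    have Pd: "P \<in> dual (Ck Z)"
    proof (rule dual_CkI[OF K0(1), of _ "\<Sum>n. \<bar>a n\<bar>"])
      show "P (f + g) = P f + P g" if "f \<in> cfun Z" "g \<in> cfun Z" for f g
        using that subspace_add[OF subspace_cfun that] suminf_add[OF sf[OF that(1)] sf[OF that(2)]]
        by (simp add: P_def distrib_left)
      show "P (c *\<^sub>R f) = c * P f" if "f \<in> cfun Z" for c f
        using that subspace_scale[OF subspace_cfun that, of c] suminf_mult[OF sf[OF that], of c]
        by (simp add: P_def) (simp add: scaleR_fun_def mult.left_commute)
      show "\<bar>P f\<bar> \<le> (\<Sum>n. \<bar>a n\<bar>) * c" if "f \<in> cfun Z" "\<And>z. z \<in> K0 \<Longrightarrow> \<bar>f z\<bar> \<le> c" "0 \<le> c" for f c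
        using tailbd[OF that(1,2), of 0] that(1) by (simp add: P_def)
    qed (simp add: P_def)
    have sE: "subspace (topspace E)" unfolding tE by (rule subspace_dual)
    have "\<Phi> (\<phi> - P) = 0"
    proof (rule kill)
      have d: "\<phi> - P \<in> dual (Ck Z)" by (rule subspace_diff[OF subspace_dual \<phi>d Pd])
      then show "\<phi> - P \<in> topspace E" unfolding tE .
      fix m
      have "(\<Sum>n. a n * h m (x n)) = (\<Sum>n\<in>{m}. a n * h m (x n))"
        by (rule suminf_finite) (auto simp: xh(4))
      then have "P (h m) = a m" using xh(2) by (simp add: P_def xh(4))
      then show "y m (\<phi> - P) = 0" using d by (simp add: y_def a_def)
    qed
    then have \<Phi>P: "\<Phi> \<phi> = \<Phi> P" using dual_diff[OF \<Phi> sE \<phi>, of P] Pd tE by simp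
    have ev: "y n \<phi> = a n" for n using \<phi>d by (simp add: y_def a_def)
    define T where "T N = (\<Sum>n<N. a n *\<^sub>R e n)" for N
    have Td: "T N \<in> dual (Ck Z)" for N
      unfolding T_def using e by (intro subspace_sum subspace_scale subspace_dual)
    have \<Phi>T: "\<Phi> (T N) = (\<Sum>n<N. \<Phi> (e n) * y n \<phi>)" for N
      unfolding T_def using dual_sum[OF \<Phi> sE, of "{..<N}" e a] e tE by (simp add: ev mult.commute)
    show "(\<lambda>N. \<Sum>n<N. \<Phi> (e n) * y n \<phi>) \<longlonglongrightarrow> \<Phi> \<phi>"
    proof (rule LIMSEQ_I)
      fix r :: real assume r: "0 < r"
      define W where "W = {\<psi> \<in> topspace E. \<Phi> \<psi> \<in> ball (\<Phi> P) r}"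
      have "openin E W" unfolding W_def
        by (rule openin_continuous_map_preimage[OF dual_continuous[OF \<Phi>]]) simp
      moreover have "P \<in> W" using Pd r by (simp add: W_def tE)
      ultimately obtain B d where B: "tvs_bounded (Ck Z) B" "d > 0"
        "{\<psi> \<in> dual (Ck Z). \<forall>f\<in>B. \<bar>\<psi> f - P f\<bar> < d} \<subseteq> W"
        unfolding E_def openin_strong_dual by meson
      obtain c where c: "c > 0" "\<And>f z. f \<in> B \<Longrightarrow> z \<in> K0 \<Longrightarrow> \<bar>f z\<bar> \<le> c"
        using tvs_bounded_Ck_uniform[OF B(1) K0(1)] by blast
      have "(\<lambda>N. (\<Sum>n. \<bar>a (n + N)\<bar>) * c) \<longlonglongrightarrow> 0 * c"
        by (intro tendsto_mult_right suminf_exist_split2[OF sa])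
      then have "\<forall>\<^sub>F N in sequentially. (\<Sum>n. \<bar>a (n + N)\<bar>) * c < d"
        using B(2) by (intro order_tendstoD(2)) simp_all
      then obtain N0 where N0: "\<And>N. N0 \<le> N \<Longrightarrow> (\<Sum>n. \<bar>a (n + N)\<bar>) * c < d"
        by (auto simp: eventually_sequentially)
      have "norm ((\<Sum>n<N. \<Phi> (e n) * y n \<phi>) - \<Phi> \<phi>) < r" if N: "N0 \<le> N" for N
      proof -
        have "\<bar>T N f - P f\<bar> < d" if fB: "f \<in> B" for f
        proof -
          have f: "f \<in> cfun Z" using B(1) fB by (auto simp: tvs_bounded_def)
          have "T N f = (\<Sum>n<N. a n * f (x n))"
            unfolding T_def sum_scaleR_fun_apply using f by (simp add: e_def dirac_def)
          then have "P f - T N f = (\<Sum>n. a (n + N) * f (x (n + N)))"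
            using suminf_split_initial_segment[OF sf[OF f], of N] f by (simp add: P_def)
          then have "\<bar>P f - T N f\<bar> \<le> (\<Sum>n. \<bar>a (n + N)\<bar>) * c"
            using tailbd[OF f c(2)[OF fB], of N] by simp
          then show ?thesis using N0[OF N] by (simp add: abs_minus_commute)
        qed
        then have "T N \<in> W" using B(3) Td by blast
        then show ?thesis unfolding \<Phi>T[symmetric] \<Phi>P by (simp add: W_def dist_real_def abs_minus_commute)
      qed
      then show "\<exists>N0. \<forall>N\<ge>N0. norm ((\<Sum>n<N. \<Phi> (e n) * y n \<phi>) - \<Phi> \<phi>) < r" by blast
    qed
  qed (rule y)
  then show ?thesis unfolding E_def by blast
qed

section \<open>Sign measures on products\<close>

lemma compact_space_cfun_bounded:
  assumes "compact_space Z" "f \<in> cfun Z"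
  shows "\<exists>c. \<forall>z. \<bar>f z\<bar> \<le> c"
proof -
  obtain c where c: "c \<ge> 0" "\<And>z. z \<in> topspace Z \<Longrightarrow> \<bar>f z\<bar> \<le> c"
    using cfun_bounded_on_compact[OF assms(2), of "topspace Z"] assms(1) unfolding compact_space_def by blast
  have "\<bar>f z\<bar> \<le> c" for z
    using c cfun_outside[OF assms(2), of z] by (cases "z \<in> topspace Z") simp_all
  then show ?thesis by blast
qed

lemma sup_norm_upper:
  assumes "compact_space Z" "f \<in> cfun Z" "z \<in> topspace Z"
  shows "\<bar>f z\<bar> \<le> sup_norm Z f"
proof -
  obtain c where "\<forall>z. \<bar>f z\<bar> \<le> c" using compact_space_cfun_bounded[OF assms(1,2)] by blast
  then have "bdd_above ((\<lambda>z. \<bar>f z\<bar>) ` topspace Z)" by (intro bdd_aboveI2[where M = c]) simp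
  then show ?thesis unfolding sup_norm_def by (rule cSUP_upper[OF assms(3)])
qed

lemma sup_norm_least:
  assumes "topspace Z \<noteq> {}" "\<And>z. z \<in> topspace Z \<Longrightarrow> \<bar>f z\<bar> \<le> c"
  shows "sup_norm Z f \<le> c"
  unfolding sup_norm_def by (rule cSUP_least[OF assms(1)]) (rule assms(2))

context
  fixes Z :: "'z topology"
  assumes cZ: "compact_space Z" and ne: "topspace Z \<noteq> {}"
begin

interpretation M: Metric_space "cfun Z"
  "\<lambda>f g. if f \<in> cfun Z \<and> g \<in> cfun Z then sup_norm Z (f - g) else 0"
  by (rule Metric_space_sup_norm[OF cZ ne])

lemma C_Banach_eq_mtopology: "C_Banach Z = M.mtopology"
  by (simp add: norm_topology_def)

lemma topspace_C_Banach: "topspace (C_Banach Z) = cfun Z"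
  unfolding C_Banach_eq_mtopology by (rule M.topspace_mtopology)

text \<open>The norm topology is coarser than the compact-open one because \<open>Z\<close> itself is compact; conversely a
compact-open continuous functional is bounded by a multiple of the sup norm.\<close>

lemma dual_C_Banach: "dual (C_Banach Z) = dual (Ck Z)"
proof (rule antisym; rule subsetI)
  have topsp: "compactin Z (topspace Z)" using cZ by (simp add: compact_space_def)
  fix \<phi>
  {
    assume \<phi>: "\<phi> \<in> dual (C_Banach Z)"
    have coarser: "openin (Ck Z) U" if U: "openin (C_Banach Z) U" for U
    proof (subst openin_subopen, intro ballI)
      fix f assume f: "f \<in> U"
      have Uc: "U \<subseteq> cfun Z" using openin_subset[OF U] unfolding topspace_C_Banach .
      obtain r where r: "r > 0" "M.mball f r \<subseteq> U"
        using U f unfolding C_Banach_eq_mtopology M.openin_mtopology by blast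
      have f': "f \<in> cfun Z" using f Uc by blast
      have r2: "r / 2 > 0" using r(1) by simp
      obtain V where V: "openin (Ck Z) V" "f \<in> V" "\<And>g z. g \<in> V \<Longrightarrow> z \<in> topspace Z \<Longrightarrow> \<bar>g z - f z\<bar> < r / 2"
        using Ck_nbhd[OF f' topsp r2] by blast
      have "V \<subseteq> U"
      proof
        fix g assume g: "g \<in> V"
        have g': "g \<in> cfun Z" using openin_subset[OF V(1)] g by auto
        have "sup_norm Z (f - g) \<le> r / 2"
        proof (rule sup_norm_least[OF ne])
          fix z assume "z \<in> topspace Z"
          then show "\<bar>(f - g) z\<bar> \<le> r / 2" using V(3)[OF g, of z] by (simp add: abs_minus_commute)
        qed
        then have "g \<in> M.mball f r" using f' g' r(1) by (simp add: M.in_mball)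
        then show "g \<in> U" using r(2) by blast
      qed
      then show "\<exists>T. openin (Ck Z) T \<and> f \<in> T \<and> T \<subseteq> U" using V(1,2) by blast
    qed
    show "\<phi> \<in> dual (Ck Z)"
    proof (rule dualI)
      show "continuous_map (Ck Z) euclideanreal \<phi>"
      proof -
        have "\<forall>U. open U \<longrightarrow> openin (C_Banach Z) {f \<in> cfun Z. \<phi> f \<in> U}"
          using dual_continuous[OF \<phi>] by (simp add: continuous_map_def topspace_C_Banach)
        then show ?thesis by (simp add: continuous_map_def coarser)
      qed
    qed (use dual_add[OF \<phi>] dual_scale[OF \<phi>] dual_outside[OF \<phi>] in \<open>simp_all add: topspace_C_Banach\<close>)
  next
    assume \<phi>: "\<phi> \<in> dual (Ck Z)"
    obtain K M where K: "compactin Z K" "M \<ge> 0"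
      "\<forall>f\<in>cfun Z. \<forall>c\<ge>0. (\<forall>z\<in>K. \<bar>f z\<bar> \<le> c) \<longrightarrow> \<bar>\<phi> f\<bar> \<le> M * c"
      using dual_Ck_bound[OF \<phi>] by (elim exE conjE)
    have Kt: "K \<subseteq> topspace Z" by (rule compactin_subset_topspace[OF K(1)])
    have op: "openin (C_Banach Z) {f \<in> cfun Z. \<phi> f \<in> V}" if V: "open V" for V
      unfolding C_Banach_eq_mtopology M.openin_mtopology
    proof (intro conjI allI impI)
      fix f assume f: "f \<in> {f \<in> cfun Z. \<phi> f \<in> V}"
      then obtain e where e: "e > 0" "ball (\<phi> f) e \<subseteq> V" using V open_contains_ball by blast
      define r where "r = e / (M + 1)"
      have r: "r > 0" "M * r < e" using e(1) K(2) by (simp_all add: r_def field_simps)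
      have "M.mball f r \<subseteq> {f \<in> cfun Z. \<phi> f \<in> V}"
      proof
        fix g assume "g \<in> M.mball f r"
        then have g: "g \<in> cfun Z" "sup_norm Z (f - g) < r"
          using f by (auto simp: M.in_mball split: if_splits)
        have d: "f - g \<in> cfun Z" using f g(1) by (intro subspace_diff[OF subspace_cfun]) simp_all
        have "\<bar>\<phi> (f - g)\<bar> \<le> M * r"
        proof (rule K(3)[rule_format, OF d])
          fix z assume "z \<in> K"
          then have "\<bar>(f - g) z\<bar> \<le> sup_norm Z (f - g)" using Kt by (intro sup_norm_upper[OF cZ d]) blast
          then show "\<bar>(f - g) z\<bar> \<le> r" using g(2) by linarith
        qed (use r(1) in simp)
        moreover have "\<phi> (f - g) = \<phi> f - \<phi> g"
          using dual_diff[OF \<phi>, of f g] subspace_cfun[of Z] f g(1) by simp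
        ultimately have "\<phi> g \<in> ball (\<phi> f) e" using r(2) by (simp add: dist_real_def)
        then show "g \<in> {f \<in> cfun Z. \<phi> f \<in> V}" using e(2) g(1) by blast
      qed
      then show "\<exists>r>0. M.mball f r \<subseteq> {f \<in> cfun Z. \<phi> f \<in> V}" using r(1) by blast
    qed simp
    show "\<phi> \<in> dual (C_Banach Z)"
    proof (rule dualI)
      show "continuous_map (C_Banach Z) euclideanreal \<phi>"
        unfolding continuous_map_def topspace_C_Banach using op by simp
    qed (use dual_add[OF \<phi>] dual_scale[OF \<phi>] dual_outside[OF \<phi>] in \<open>simp_all add: topspace_C_Banach\<close>)
  }
qed

lemma dense_in_C_Banach:
  assumes S: "S \<subseteq> cfun Z" and approx: "\<And>f e. f \<in> cfun Z \<Longrightarrow> e > 0 \<Longrightarrow> \<exists>g\<in>S. \<forall>z. \<bar>f z - g z\<bar> \<le> e"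
  shows "C_Banach Z closure_of S = cfun Z"
proof (rule antisym)
  show "C_Banach Z closure_of S \<subseteq> cfun Z"
    using closure_of_subset_topspace[of "C_Banach Z" S] unfolding topspace_C_Banach .
  show "cfun Z \<subseteq> C_Banach Z closure_of S"
    unfolding C_Banach_eq_mtopology M.metric_closure_of
  proof (rule subsetI, rule CollectI, intro conjI allI impI)
    fix f and r :: real assume f: "f \<in> cfun Z" and r: "0 < r"
    have "r / 2 > 0" using r by simp
    then obtain g where g: "g \<in> S" "\<forall>z. \<bar>f z - g z\<bar> \<le> r / 2" using approx[OF f] by blast
    have "sup_norm Z (f - g) \<le> r / 2"
      by (rule sup_norm_least[OF ne]) (use g(2) in simp)
    then have "g \<in> M.mball f r" using f g(1) S r by (auto simp: M.in_mball)
    then show "\<exists>y\<in>S. y \<in> M.mball f r" using g(1) by blast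
  qed
qed

lemma dual_norm_point_functional:
  assumes tych: "tychonoff_space Z" and S: "finite S" "S \<subseteq> topspace Z" and one: "(\<Sum>z\<in>S. \<bar>a z\<bar>) = 1"
  shows "dual_norm (cfun Z) (sup_norm Z) (point_functional Z S a) = 1"
proof -
  obtain f where f: "f \<in> cfun Z" "\<And>z. z \<in> S \<Longrightarrow> f z = sgn (a z)" "\<And>z. \<bar>f z\<bar> \<le> 1"
    by (rule tychonoff_interpolation[OF tych S closedin_empty, of "\<lambda>z. sgn (a z)" 1]) (auto simp: sgn_if)
  have "sup_norm Z f \<le> 1" by (rule sup_norm_least[OF ne]) (rule f(3))
  moreover have "point_functional Z S a f = (\<Sum>z\<in>S. \<bar>a z\<bar>)"
    unfolding point_functional_apply[OF f(1)] by (rule sum.cong) (simp_all add: f(2) sgn_if)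
  ultimately have "1 \<in> (\<lambda>f. \<bar>point_functional Z S a f\<bar>) ` {f \<in> cfun Z. sup_norm Z f \<le> 1}"
    using f(1) one by (intro image_eqI[of _ _ f]) simp_all
  moreover have "t \<le> 1" if t: "t \<in> (\<lambda>f. \<bar>point_functional Z S a f\<bar>) ` {f \<in> cfun Z. sup_norm Z f \<le> 1}" for t
  proof -
    obtain g where g: "t = \<bar>point_functional Z S a g\<bar>" "g \<in> cfun Z" "sup_norm Z g \<le> 1" using t by auto
    have "t \<le> (\<Sum>z\<in>S. \<bar>a z * g z\<bar>)"
      unfolding g(1) point_functional_apply[OF g(2)] by (rule sum_abs)
    also have "\<dots> \<le> (\<Sum>z\<in>S. \<bar>a z\<bar>)"
    proof (rule sum_mono)
      fix z assume "z \<in> S"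
      then have "\<bar>g z\<bar> \<le> 1" using sup_norm_upper[OF cZ g(2), of z] S(2) g(3) by auto
      then show "\<bar>a z * g z\<bar> \<le> \<bar>a z\<bar>" using mult_left_mono[of "\<bar>g z\<bar>" 1 "\<bar>a z\<bar>"] by (simp add: abs_mult)
    qed
    finally show ?thesis using one by simp
  qed
  ultimately show ?thesis unfolding dual_norm_def by (rule cSup_eq_maximum)
qed

end

text \<open>Subtracting from \<open>f\<close> a small lift of the tail of \<open>(y n f)\<close> leaves a function at which only finitely many \<open>y n\<close> do
not vanish.\<close>

lemma strongly_normal_of_lifting:
  assumes Z: "compact_space Z" "topspace Z \<noteq> {}"
    and y: "\<And>n. y n \<in> dual (Ck Z)" "\<And>n. dual_norm (cfun Z) (sup_norm Z) (y n) = 1"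
    and null: "\<And>f. f \<in> cfun Z \<Longrightarrow> (\<lambda>n. y n f) \<longlonglongrightarrow> 0"
    and lift: "\<And>b. b \<longlonglongrightarrow> 0 \<Longrightarrow> \<exists>h\<in>cfun Z. (\<forall>z. \<bar>h z\<bar> \<le> 2 * supnorm_seq b) \<and> (\<forall>n. y n h = b n)"
  shows "strongly_normal (cfun Z) (sup_norm Z) y"
  unfolding strongly_normal_def
proof (intro conjI)
  show "range y \<subseteq> dual (C_Banach Z)" unfolding dual_C_Banach[OF Z] using y(1) by (rule image_subsetI)
  show "\<forall>n. dual_norm (cfun Z) (sup_norm Z) (y n) = 1" using y(2) by (rule allI)
  show "C_Banach Z closure_of {f \<in> cfun Z. summable (\<lambda>n. \<bar>y n f\<bar>)} = cfun Z"
  proof (rule dense_in_C_Banach[OF Z])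
    fix f and e :: real assume f: "f \<in> cfun Z" and e: "e > 0"
    have "(\<lambda>N. supnorm_seq (tail N (\<lambda>n. y n f))) \<longlonglongrightarrow> 0" by (rule tail_c0(2)[OF null[OF f]])
    then have "\<forall>\<^sub>F N in sequentially. supnorm_seq (tail N (\<lambda>n. y n f)) < e / 2"
      by (rule order_tendstoD(2)) (use e in simp)
    then obtain N where N: "supnorm_seq (tail N (\<lambda>n. y n f)) < e / 2" by (auto simp: eventually_sequentially)
    obtain h where h: "h \<in> cfun Z" "\<forall>z. \<bar>h z\<bar> \<le> 2 * supnorm_seq (tail N (\<lambda>n. y n f))"
      "\<forall>n. y n h = tail N (\<lambda>n. y n f) n"
      using lift[OF tail_c0(1)[OF null[OF f], of N]] by blast
    have g: "f - h \<in> cfun Z" by (rule subspace_diff[OF subspace_cfun f h(1)])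
    have "y n (f - h) = 0" if "n \<notin> {..<N}" for n
      using dual_diff[OF y(1)[of n], of f h] subspace_cfun[of Z] f h that by (simp add: tail_def)
    then have "summable (\<lambda>n. \<bar>y n (f - h)\<bar>)" by (intro summable_finite[of "{..<N}"]) simp_all
    moreover have "\<bar>f z - (f - h) z\<bar> \<le> e" for z using h(2)[rule_format, of z] N by simp
    ultimately show "\<exists>g\<in>{f \<in> cfun Z. summable (\<lambda>n. \<bar>y n f\<bar>)}. \<forall>z. \<bar>f z - g z\<bar> \<le> e"
      using g by (intro bexI[of _ "f - h"]) simp_all
  qed simp
qed

lemma tychonoff_prod_topology:
  assumes "tychonoff_space X" "tychonoff_space Y"
  shows "tychonoff_space (prod_topology X Y)"
  using assms unfolding tychonoff_space_def completely_regular_space_prod_topology Hausdorff_space_prod_topology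
  by blast

lemma infinite_sign_families:
  assumes "infinite A" "infinite B"
  shows "\<exists>K L \<phi>. K \<subseteq> A \<and> finite K \<and> card K = 2 ^ n \<and> L \<subseteq> B \<and> finite L \<and> card L = n \<and>
    bij_betw (\<phi> :: 'a \<Rightarrow> 'b \<Rightarrow> real) K (L \<rightarrow>\<^sub>E {-1, 1})"
proof -
  obtain K where K: "finite K" "card K = 2 ^ n" "K \<subseteq> A" using infinite_arbitrarily_large[OF assms(1)] by blast
  obtain L where L: "finite L" "card L = n" "L \<subseteq> B" using infinite_arbitrarily_large[OF assms(2)] by blast
  have "finite (L \<rightarrow>\<^sub>E {-1, 1::real})" "card (L \<rightarrow>\<^sub>E {-1, 1::real}) = 2 ^ n"
    using L(1,2) by (simp_all add: finite_PiE card_signs)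
  then obtain \<phi> where "bij_betw \<phi> K (L \<rightarrow>\<^sub>E {-1, 1::real})"
    using finite_same_card_bij[OF K(1)] K(2) by metis
  then show ?thesis using K L by blast
qed

text \<open>If all continuous functions on the product are bounded, sign measures on arbitrary finite subsets of the two factors
do; otherwise an unbounded function does.\<close>

theorem product_basic_sequence:
  fixes X :: "'a topology" and Y :: "'b topology"
  assumes X: "tychonoff_space X" "infinite (topspace X)" and Y: "tychonoff_space Y" "infinite (topspace Y)"
  shows "\<exists>y. basic_sequence (weak_star (Ck (prod_topology X Y))) y"
proof (cases "\<forall>f\<in>cfun (prod_topology X Y). \<exists>c. \<forall>z. \<bar>f z\<bar> \<le> c")
  case False
  then obtain f where "f \<in> cfun (prod_topology X Y)" "\<And>c. \<exists>z. \<bar>f z\<bar> > c" by (meson not_le)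
  then show ?thesis
    by (rule unbounded_function_basic_sequence[OF tychonoff_prod_topology[OF X(1) Y(1)]])
next
  case True
  define Q where "Q n q \<longleftrightarrow> fst q \<subseteq> topspace X \<and> finite (fst q) \<and> card (fst q) = 2 ^ n \<and> fst (snd q) \<subseteq> topspace Y \<and>
      finite (fst (snd q)) \<and> card (fst (snd q)) = n \<and> bij_betw (snd (snd q) :: 'a \<Rightarrow> 'b \<Rightarrow> real) (fst q) (fst (snd q) \<rightarrow>\<^sub>E {-1, 1})"
    for n and q :: "'a set \<times> 'b set \<times> ('a \<Rightarrow> 'b \<Rightarrow> real)"
  have "\<exists>q. Q n q" for n
  proof -
    obtain K L and \<phi> :: "'a \<Rightarrow> 'b \<Rightarrow> real" where "K \<subseteq> topspace X \<and> finite K \<and> card K = 2 ^ n \<and> L \<subseteq> topspace Y \<and> finite L \<and> card L = n \<and>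
      bij_betw \<phi> K (L \<rightarrow>\<^sub>E {-1, 1})" using infinite_sign_families[OF X(2) Y(2), of n] by (elim exE)
    then show ?thesis by (intro exI[of _ "(K, L, \<phi>)"], unfold Q_def fst_conv snd_conv)
  qed
  then have "\<forall>n. \<exists>q. Q n q" by (rule allI)
  from choice[OF this] obtain q where q: "\<forall>n. Q n (q n)" by (elim exE)
  have ne: "topspace Y \<noteq> {}" using Y(2) by auto
  have bdd: "\<exists>c. \<forall>z. \<bar>g z\<bar> \<le> c" if "g \<in> cfun (prod_topology X Y)" for g using True that by (rule bspec)
  have qs: "fst (q n) \<subseteq> topspace X" "finite (fst (q n))" "card (fst (q n)) = 2 ^ n" "fst (snd (q n)) \<subseteq> topspace Y"
    "finite (fst (snd (q n)))" "card (fst (snd (q n))) = n" "bij_betw (snd (snd (q n))) (fst (q n)) (fst (snd (q n)) \<rightarrow>\<^sub>E {-1, 1})"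
    for n using q[rule_format, of n] unfolding Q_def by - (elim conjE, assumption)+
  have k: "strict_mono Suc" "1 \<le> Suc n" for n by (simp_all add: strict_mono_Suc_iff)
  define S where "S n = fst (q (Suc n)) \<times> fst (snd (q (Suc n)))" for n
  define a where "a n p = snd (snd (q (Suc n))) (fst p) (snd p) / (real (Suc n) * 2 ^ Suc n)" for n p
  note SM = sign_measures_subsequence[where K = "\<lambda>n. fst (q n)" and L = "\<lambda>n. fst (snd (q n))" and
      \<phi> = "\<lambda>n. snd (snd (q n))" and k = Suc, OF tychonoff_prod_topology[OF X(1) Y(1)] ne bdd k qs,
      folded S_def a_def]
  have SM1: "finite (S n)" "S n \<subseteq> topspace (prod_topology X Y)" "(\<Sum>z\<in>S n. \<bar>a n z\<bar>) = 1" for n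
    by (rule SM(1), assumption+) (rule SM(2), assumption+, rule SM(3), assumption+)
  have SM4: "(\<lambda>n. \<Sum>z\<in>S n. a n z * f z) \<longlonglongrightarrow> 0" if "f \<in> cfun (prod_topology X Y)" for f
    by (rule SM(4)[OF _ that])
  have SM5: "(\<lambda>n. if z \<in> S n then \<bar>a n z\<bar> else 0) \<longlonglongrightarrow> 0" for z by (rule SM(5))
  show ?thesis
  proof (rule point_functionals_subsequence[OF tychonoff_prod_topology[OF X(1) Y(1)] SM1 SM4 SM5])
    fix r
    assume "basic_sequence (weak_star (Ck (prod_topology X Y))) (\<lambda>n. point_functional (prod_topology X Y) (S (r n)) (a (r n)))"
    then show ?thesis by (rule exI[where P = "basic_sequence (weak_star (Ck (prod_topology X Y)))"])
  qed
qed

theorem sign_measures_strongly_normal_basic: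
  fixes X :: "'a topology" and Y :: "'b topology"
  assumes X: "tychonoff_space X" "infinite (topspace X)" "compact_space X"
    and Y: "tychonoff_space Y" "infinite (topspace Y)" "compact_space Y"
    and K: "\<And>n. 1 \<le> n \<Longrightarrow> K n \<subseteq> topspace X" "\<And>n. 1 \<le> n \<Longrightarrow> finite (K n)" "\<And>n. 1 \<le> n \<Longrightarrow> card (K n) = 2 ^ n"
    and L: "\<And>n. 1 \<le> n \<Longrightarrow> L n \<subseteq> topspace Y" "\<And>n. 1 \<le> n \<Longrightarrow> finite (L n)" "\<And>n. 1 \<le> n \<Longrightarrow> card (L n) = n"
    and \<phi>: "\<And>n. 1 \<le> n \<Longrightarrow> bij_betw (\<phi> n) (K n) (L n \<rightarrow>\<^sub>E {-1, 1 :: real})"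
    and \<mu>: "\<And>n. 1 \<le> n \<Longrightarrow> \<mu> n = (1 / (real n * 2 ^ n)) *\<^sub>R
                  (\<Sum>(s, j)\<in>K n \<times> L n. \<phi> n s j *\<^sub>R dirac (prod_topology X Y) (s, j))"
    and k: "strict_mono k" "\<And>n. 1 \<le> k n"
  shows "\<exists>r :: nat \<Rightarrow> nat. strict_mono r \<and>
      strongly_normal (cfun (prod_topology X Y)) (sup_norm (prod_topology X Y)) (\<lambda>n. \<mu> (k (r n))) \<and>
      basic_sequence (weak_star (C_Banach (prod_topology X Y))) (\<lambda>n. \<mu> (k (r n)))"
proof -
  define W where "W = prod_topology X Y"
  have Wt: "tychonoff_space W" unfolding W_def by (rule tychonoff_prod_topology[OF X(1) Y(1)])
  have Wc: "compact_space W" using X(3) Y(3) by (simp add: W_def compact_space_prod_topology)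
  have neY: "topspace Y \<noteq> {}" using Y(2) by auto
  have ne: "topspace W \<noteq> {}" using X(2) Y(2) by (auto simp: W_def)
  have bdd: "\<exists>c. \<forall>z. \<bar>g z\<bar> \<le> c" if "g \<in> cfun (prod_topology X Y)" for g
    using compact_space_cfun_bounded[OF Wc] that by (simp add: W_def)
  define a where "a n p = \<phi> (k n) (fst p) (snd p) / (real (k n) * 2 ^ k n)" for n p
  define S where "S n = K (k n) \<times> L (k n)" for n
  note SM = sign_measures_subsequence[where K = K and L = L and \<phi> = \<phi> and k = k,
      OF Wt[unfolded W_def] neY bdd k K L \<phi>, folded W_def S_def a_def]
  have \<mu>S: "\<mu> (k n) = point_functional W (S n) (a n)" for n
  proof -
    have "\<mu> (k n) = (\<Sum>p\<in>S n. (1 / (real (k n) * 2 ^ k n)) *\<^sub>R (\<phi> (k n) (fst p) (snd p) *\<^sub>R dirac W p))"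
      unfolding \<mu>[OF k(2)] scaleR_sum_right by (simp add: S_def W_def case_prod_unfold)
    also have "\<dots> = (\<Sum>p\<in>S n. a n p *\<^sub>R dirac W p)" by (rule sum.cong) (simp_all add: a_def)
    finally show ?thesis by (simp add: point_functional_def)
  qed
  have SM1: "finite (S n)" "S n \<subseteq> topspace W" "(\<Sum>z\<in>S n. \<bar>a n z\<bar>) = 1" for n
    by (rule SM(1), assumption+) (rule SM(2), assumption+, rule SM(3), assumption+)
  have SM4: "(\<lambda>n. \<Sum>z\<in>S n. a n z * f z) \<longlonglongrightarrow> 0" if "f \<in> cfun W" for f
    by (rule SM(4)[OF _ _ _ _ _ _ _ _ that])
  have SM5: "(\<lambda>n. if z \<in> S n then \<bar>a n z\<bar> else 0) \<longlonglongrightarrow> 0" for z by (rule SM(5))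
  show ?thesis
  proof (rule point_functionals_subsequence[OF Wt SM1 SM4 SM5])
    fix r assume r: "strict_mono r"
      "basic_sequence (weak_star (Ck W)) (\<lambda>n. point_functional W (S (r n)) (a (r n)))"
      "\<And>b. b \<longlonglongrightarrow> 0 \<Longrightarrow> \<exists>h\<in>cfun W. (\<forall>z. \<bar>h z\<bar> \<le> 2 * supnorm_seq b) \<and>
         (\<forall>n. point_functional W (S (r n)) (a (r n)) h = b n)"
    have "strongly_normal (cfun W) (sup_norm W) (\<lambda>n. point_functional W (S (r n)) (a (r n)))"
    proof (rule strongly_normal_of_lifting[OF Wc ne])
      show "point_functional W (S (r n)) (a (r n)) \<in> dual (Ck W)" for n
        by (rule point_functional_in_dual[OF SM1(2)])
      show "dual_norm (cfun W) (sup_norm W) (point_functional W (S (r n)) (a (r n))) = 1" for n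
        by (rule dual_norm_point_functional[OF Wc ne Wt SM1])
      show "(\<lambda>n. point_functional W (S (r n)) (a (r n)) f) \<longlonglongrightarrow> 0" if f: "f \<in> cfun W" for f
        unfolding point_functional_apply[OF f] using LIMSEQ_subseq_LIMSEQ[OF SM4[OF f] r(1)] by (simp add: o_def)
    qed (rule r(3))
    moreover have "weak_star (C_Banach W) = weak_star (Ck W)"
      by (rule weak_star_cong) (simp_all add: topspace_C_Banach[OF Wc ne] dual_C_Banach[OF Wc ne])
    ultimately show ?thesis using r(1,2) unfolding \<mu>S W_def[symmetric] by (intro exI[of _ r]) simp
  qed
qed

theorem theorem2:
  fixes X :: "'a topology" and Y :: "'b topology"
  assumes "tychonoff_space X" and "infinite (topspace X)"
    and "tychonoff_space Y" and "infinite (topspace Y)"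
  shows
   "(\<exists>e. basic_sequence (weak_star (Ck (prod_topology X Y))) e) \<and>
    (\<exists>e. basic_sequence (weak_star_bidual (Ck X)) e) \<and>
    (barrelled (Ck X) \<longrightarrow> (\<exists>e. basic_sequence (weak_star (Ck X)) e)) \<and>
    ((\<exists>D. infinite D \<and> D \<subseteq> topspace X \<and> subtopology X D = discrete_topology D \<and>
        C_star_embedded X D) \<longrightarrow>
      (\<exists>e. basic_sequence (weak_star (Ck X)) e)) \<and>
    (compact_space X \<and> compact_space Y \<longrightarrow>
      (\<forall>(K :: nat \<Rightarrow> 'a set) (L :: nat \<Rightarrow> 'b set) (\<phi> :: nat \<Rightarrow> 'a \<Rightarrow> 'b \<Rightarrow> real) \<mu>.
        (\<forall>n\<ge>1. K n \<subseteq> topspace X \<and> finite (K n) \<and> card (K n) = 2 ^ n \<and>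
                L n \<subseteq> topspace Y \<and> finite (L n) \<and> card (L n) = n \<and>
                bij_betw (\<phi> n) (K n) (L n \<rightarrow>\<^sub>E {-1, 1}) \<and>
                \<mu> n = (1 / (real n * 2 ^ n)) *\<^sub>R
                  (\<Sum>(s, j)\<in>K n \<times> L n. \<phi> n s j *\<^sub>R dirac (prod_topology X Y) (s, j))) \<longrightarrow>
        (\<forall>k. strict_mono k \<and> (\<forall>n. k n \<ge> 1) \<longrightarrow>
          (\<exists>r :: nat \<Rightarrow> nat. strict_mono r \<and>
            strongly_normal (cfun (prod_topology X Y)) (sup_norm (prod_topology X Y))
              (\<lambda>n. \<mu> (k (r n))) \<and>
            basic_sequence (weak_star (C_Banach (prod_topology X Y))) (\<lambda>n. \<mu> (k (r n)))))))"
proof (intro conjI impI allI)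
  show "\<exists>e. basic_sequence (weak_star (Ck (prod_topology X Y))) e"
    by (rule product_basic_sequence[OF assms])
  show "\<exists>e. basic_sequence (weak_star_bidual (Ck X)) e"
    by (rule bidual_basic_sequence[OF assms(1,2)])
  show "\<exists>e. basic_sequence (weak_star (Ck X)) e" if "barrelled (Ck X)"
    by (rule barrelled_basic_sequence[OF assms(1,2) that])
  show "\<exists>e. basic_sequence (weak_star (Ck X)) e"
    if D: "\<exists>D. infinite D \<and> D \<subseteq> topspace X \<and> subtopology X D = discrete_topology D \<and> C_star_embedded X D"
  proof -
    obtain D where "infinite D" "subtopology X D = discrete_topology D" "C_star_embedded X D"
      using D by (elim exE conjE)
    then show ?thesis by (rule C_star_embedded_basic_sequence[OF assms(1)])
  qed
next
  fix K :: "nat \<Rightarrow> 'a set" and L :: "nat \<Rightarrow> 'b set" and \<phi> :: "nat \<Rightarrow> 'a \<Rightarrow> 'b \<Rightarrow> real" and \<mu> and k :: "nat \<Rightarrow> nat"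
  assume c: "compact_space X \<and> compact_space Y"
    and A: "\<forall>n\<ge>1. K n \<subseteq> topspace X \<and> finite (K n) \<and> card (K n) = 2 ^ n \<and>
                L n \<subseteq> topspace Y \<and> finite (L n) \<and> card (L n) = n \<and>
                bij_betw (\<phi> n) (K n) (L n \<rightarrow>\<^sub>E {-1, 1}) \<and>
                \<mu> n = (1 / (real n * 2 ^ n)) *\<^sub>R
                  (\<Sum>(s, j)\<in>K n \<times> L n. \<phi> n s j *\<^sub>R dirac (prod_topology X Y) (s, j))"
    and k: "strict_mono k \<and> (\<forall>n. k n \<ge> 1)"
  have A': "K n \<subseteq> topspace X" "finite (K n)" "card (K n) = 2 ^ n"
      "L n \<subseteq> topspace Y" "finite (L n)" "card (L n) = n" "bij_betw (\<phi> n) (K n) (L n \<rightarrow>\<^sub>E {-1, 1})"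
      "\<mu> n = (1 / (real n * 2 ^ n)) *\<^sub>R
                  (\<Sum>(s, j)\<in>K n \<times> L n. \<phi> n s j *\<^sub>R dirac (prod_topology X Y) (s, j))" if "1 \<le> n" for n
    using A[THEN spec, THEN mp, OF that] by - (elim conjE, assumption)+
  show "\<exists>r :: nat \<Rightarrow> nat. strict_mono r \<and>
      strongly_normal (cfun (prod_topology X Y)) (sup_norm (prod_topology X Y)) (\<lambda>n. \<mu> (k (r n))) \<and>
      basic_sequence (weak_star (C_Banach (prod_topology X Y))) (\<lambda>n. \<mu> (k (r n)))"
    by (rule sign_measures_strongly_normal_basic[OF assms(1,2) conjunct1[OF c] assms(3,4) conjunct2[OF c] A'
        conjunct1[OF k] spec[OF conjunct2[OF k]]])
qed

end
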